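(* (i) Let $\mathbb{A}$ be an algebraic left (resp. right) alternative real algebra with no nontrivial joint zero-divisors. Then $\mathbb{A}$ is locally complex and, equipped with its natural norm, is isometrically isomorphic to $\mathbb{R}$, $\mathbb{C}$, $\mathbb{H}$, or $\mathbb{O}$. (ii) Let $\mathbb{A}$ be a left (resp. right) alternative real algebra. If one of the following conditions holds, then $\mathbb{A}$ is locally complex and, equipped with its natural norm, is isometrically isomorphic to $\mathbb{R}$, $\mathbb{C}$, $\mathbb{H}$, or $\mathbb{O}$: (a) $\mathbb{A}$ is endowed with a vector space norm relative to which its multiplication is separately continuous, and $\mathbb{A}$ has no nontrivial joint topological zero-divisors; (b) $\mathbb{A}$ is a quasi-division real algebra endowed with a vector space norm relative to which its multiplication is separately continuous; (c) $\mathbb{A}$ is endowed with a $c$-supermultiplicative vector space norm for some $c>0$ relative to which the multiplication is separately continuous (e.g., a real nearly absolute value); (d) $\mathbb{A}$ is a topological quasi-division real algebra, equivalently, a (topological) classical division algebra, whose topological dual separates its points. (iii) Let $\mathbb{A}$ be a left (resp. right) alternative real algebra. Then $\mathbb{A}$ is isometrically isomorphic to $\mathbb{R}$, $\mathbb{C}$, $\mathbb{H}$, or $\mathbb{O}$ if one of the following conditions holds, in which case the given norm of $\mathbb{A}$ coincides with its natural norm coming from its locally complex structure: (a) $\mathbb{A}$ is a real $C^*$-algebra with no nontrivial joint topological zero-divisors or a quasi-division real $C^*$-algebra; (b) $\mathbb{A}$ is endowed with a vector space norm $\|\cdot\|$ relative to which its multiplication is separately continuous and satisfying the identity $\|x^k\|=\|x\|^k$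 on $\mathbb{A}$ for a fixed positive integer $k>1$, and $\mathbb{A}$ has no nontrivial joint topological zero-divisors; (c) $\mathbb{A}$ is a quasi-division real algebra endowed with a vector space norm $\|\cdot\|$ relative to which its multiplication is separately continuous and satisfying the identity $\|x^k\|=\|x\|^k$ on $\mathbb{A}$ for a fixed positive integer $k>1$; (d) $\mathbb{A}$ is an absolute-valued real algebra.
   Context: Algebras are nonzero and not necessarily associative, commutative or unital. $L_ax=ax$, $R_ax=xa$. An algebra is left (resp. right) alternative if $a(ab)=(aa)b$ (resp. $a(bb)=(ab)b$) for all $a,b$ (over $\mathbb{R}$ such algebras are power-associative); algebraic if every subalgebra generated by one element is finite-dimensional. An element $a$ is a joint zero-divisor if $ab=ba=0$ for some $b\neq0$; zero is the trivial one. A unital algebra is quadratic if the unital subalgebra generated by any element is at most two-dimensional. A real quadratic algebra is locally complex if the unital subalgebra generated by any element is a field extension of $\mathbb{R}$. The natural norm of a locally complex algebra is the unique vector space norm on it that comes from an inner product and satisfies $\|x^k\|=\|x\|^k$ for all $x$ and all $k\in\mathbb{N}$. An algebra is quasi-division if for every $a\neq 0$ at least one of $L_a,R_a$ is bijective; a classical division algebra if it is unital and every nonzero element is invertible ($a$ is invertible if there is a unique $a^{-1}$ with $aa^{-1}=a^{-1}a=1$). A topological real algebra has a Hausdorff topology such that addition and scalar multiplication are continuous, multiplication is separately continuous, and inversion is continuous on the set of invertible elements; its topological dual is the space of continuous linear functionals. A norm is $c$-supermultiplicative if $c\|a\|\|b\|\le\|ab\|$ for all $a,b$; a nearly absolute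 value is a submultiplicative norm that is $c$-supermultiplicative for some $c>0$; an absolute value is a norm with $\|ab\|=\|a\|\|b\|$, and an absolute-valued algebra is an algebra with an absolute value. An element $a$ is a joint topological zero-divisor if there are $b_n$ with $\|b_n\|=1$ and $\lim_n ab_n=\lim_n b_na=0$; zero is the trivial one. A $C^*$-algebra is a complex (not necessarily associative) Banach algebra with an involution $*$ satisfying $\|a^*a\|=\|a\|^2$; a real $C^*$-algebra is a closed real $*$-subalgebra of a $C^*$-algebra. $\mathbb{R}$, $\mathbb{C}$, $\mathbb{H}$ (real quaternions), $\mathbb{O}$ (real octonions) carry the Euclidean norm; "isomorphic" means as real algebras. *)

theory Defs
  imports "HOL-Analysis.Analysis" "HOL-Algebra.Ring"
begin

text \<open>
  A not necessarily associative real algebra is a real vector space \<open>'a\<close> with an explicit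
  bilinear product \<open>m\<close>.  The norms and topologies under consideration are explicit as well,
  since an algebra without a given norm may carry several of them.
\<close>

definition nonassoc_algebra :: "('a::real_vector \<Rightarrow> 'a \<Rightarrow> 'a) \<Rightarrow> bool" where
  "nonassoc_algebra m \<longleftrightarrow> bilinear m \<and> (\<exists>x::'a. x \<noteq> 0)"

definition left_alternative :: "('a \<Rightarrow> 'a \<Rightarrow> 'a) \<Rightarrow> bool" where
  "left_alternative m \<longleftrightarrow> (\<forall>a b. m a (m a b) = m (m a a) b)"

definition right_alternative :: "('a \<Rightarrow> 'a \<Rightarrow> 'a) \<Rightarrow> bool" where
  "right_alternative m \<longleftrightarrow> (\<forall>a b. m a (m b b) = m (m a b) b)"

text \<open>
  \<open>alg_power m x k\<close> is the power \<open>x\<^sup>k = x (x (\<dots> x))\<close>, meaningful for \<open>k \<ge> 1\<close> only; in a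
  power-associative algebra the bracketing does not matter.
\<close>

definition alg_power :: "('a \<Rightarrow> 'a \<Rightarrow> 'a) \<Rightarrow> 'a \<Rightarrow> nat \<Rightarrow> 'a" where
  "alg_power m x k = (m x ^^ (k - 1)) x"

definition is_subalgebra :: "('a::real_vector \<Rightarrow> 'a \<Rightarrow> 'a) \<Rightarrow> 'a set \<Rightarrow> bool" where
  "is_subalgebra m S \<longleftrightarrow> subspace S \<and> (\<forall>x\<in>S. \<forall>y\<in>S. m x y \<in> S)"

text \<open>
  The library's \<^const>\<open>dim\<close> is \<open>0\<close> on infinite-dimensional spaces, so dimension
  bounds are expressed by finite spanning sets.
\<close>

definition algebraic_algebra :: "('a::real_vector \<Rightarrow> 'a \<Rightarrow> 'a) \<Rightarrow> bool" where
  "algebraic_algebra m \<longleftrightarrow> (\<forall>a. \<exists>B. finite B \<and> is_subalgebra m hull {a} \<subseteq> span B)"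

definition joint_zero_divisor :: "('a::zero \<Rightarrow> 'a \<Rightarrow> 'a) \<Rightarrow> 'a \<Rightarrow> bool" where
  "joint_zero_divisor m a \<longleftrightarrow> (\<exists>b. b \<noteq> 0 \<and> m a b = 0 \<and> m b a = 0)"

definition quasi_division :: "('a::zero \<Rightarrow> 'a \<Rightarrow> 'a) \<Rightarrow> bool" where
  "quasi_division m \<longleftrightarrow> (\<forall>a. a \<noteq> 0 \<longrightarrow> bij (\<lambda>x. m a x) \<or> bij (\<lambda>x. m x a))"

definition is_unit_element :: "('a \<Rightarrow> 'a \<Rightarrow> 'a) \<Rightarrow> 'a \<Rightarrow> bool" where
  "is_unit_element m e \<longleftrightarrow> (\<forall>x. m e x = x \<and> m x e = x)"

definition unital :: "('a \<Rightarrow> 'a \<Rightarrow> 'a) \<Rightarrow> bool" where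
  "unital m \<longleftrightarrow> (\<exists>e. is_unit_element m e)"

definition unit_of :: "('a \<Rightarrow> 'a \<Rightarrow> 'a) \<Rightarrow> 'a" where
  "unit_of m = (THE e. is_unit_element m e)"

definition is_inverse :: "('a \<Rightarrow> 'a \<Rightarrow> 'a) \<Rightarrow> 'a \<Rightarrow> 'a \<Rightarrow> bool" where
  "is_inverse m a b \<longleftrightarrow> m a b = unit_of m \<and> m b a = unit_of m"

definition invertible_in :: "('a \<Rightarrow> 'a \<Rightarrow> 'a) \<Rightarrow> 'a \<Rightarrow> bool" where
  "invertible_in m a \<longleftrightarrow> unital m \<and> (\<exists>!b. is_inverse m a b)"

definition inverse_in :: "('a \<Rightarrow> 'a \<Rightarrow> 'a) \<Rightarrow> 'a \<Rightarrow> 'a" where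
  "inverse_in m a = (THE b. is_inverse m a b)"

definition classical_division :: "('a::zero \<Rightarrow> 'a \<Rightarrow> 'a) \<Rightarrow> bool" where
  "classical_division m \<longleftrightarrow> unital m \<and> (\<forall>a. a \<noteq> 0 \<longrightarrow> invertible_in m a)"

definition unital_subalgebra_gen :: "('a::real_vector \<Rightarrow> 'a \<Rightarrow> 'a) \<Rightarrow> 'a \<Rightarrow> 'a set" where
  "unital_subalgebra_gen m x = is_subalgebra m hull {unit_of m, x}"

definition quadratic_algebra :: "('a::real_vector \<Rightarrow> 'a \<Rightarrow> 'a) \<Rightarrow> bool" where
  "quadratic_algebra m \<longleftrightarrow> unital m \<and>
     (\<forall>x. \<exists>B. finite B \<and> card B \<le> 2 \<and> unital_subalgebra_gen m x \<subseteq> span B)"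

definition ring_on :: "('a::ab_group_add \<Rightarrow> 'a \<Rightarrow> 'a) \<Rightarrow> 'a set \<Rightarrow> 'a ring" where
  "ring_on m S = \<lparr>carrier = S, mult = m, one = unit_of m, zero = 0, add = (+)\<rparr>"

text \<open>
  A unital subalgebra contains the real multiples of the unit element, so it is a field extension
  of the reals as soon as it is a field.
\<close>

definition locally_complex :: "('a::real_vector \<Rightarrow> 'a \<Rightarrow> 'a) \<Rightarrow> bool" where
  "locally_complex m \<longleftrightarrow> quadratic_algebra m \<and>
     (\<forall>x. Ring.field (ring_on m (unital_subalgebra_gen m x)))"

definition vs_norm :: "('a::real_vector \<Rightarrow> real) \<Rightarrow> bool" where
  "vs_norm N \<longleftrightarrow> (\<forall>x. 0 \<le> N x) \<and> (\<forall>x. N x = 0 \<longleftrightarrow> x = 0) \<and>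
     (\<forall>x y. N (x + y) \<le> N x + N y) \<and> (\<forall>r x. N (r *\<^sub>R x) = \<bar>r\<bar> * N x)"

definition from_inner_product :: "('a::real_vector \<Rightarrow> real) \<Rightarrow> bool" where
  "from_inner_product N \<longleftrightarrow> (\<exists>ip :: 'a \<Rightarrow> 'a \<Rightarrow> real. bilinear ip \<and> (\<forall>x y. ip x y = ip y x) \<and>
     (\<forall>x. x \<noteq> 0 \<longrightarrow> 0 < ip x x) \<and> (\<forall>x. N x = sqrt (ip x x)))"

definition power_norm :: "('a \<Rightarrow> 'a \<Rightarrow> 'a) \<Rightarrow> ('a \<Rightarrow> real) \<Rightarrow> nat \<Rightarrow> bool" where
  "power_norm m N k \<longleftrightarrow> (\<forall>x. N (alg_power m x k) = N x ^ k)"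

definition natural_norm_props :: "('a::real_vector \<Rightarrow> 'a \<Rightarrow> 'a) \<Rightarrow> ('a \<Rightarrow> real) \<Rightarrow> bool" where
  "natural_norm_props m N \<longleftrightarrow> vs_norm N \<and> from_inner_product N \<and> (\<forall>k\<ge>1. power_norm m N k)"

definition natural_norm :: "('a::real_vector \<Rightarrow> 'a \<Rightarrow> 'a) \<Rightarrow> ('a \<Rightarrow> real) \<Rightarrow> bool" where
  "natural_norm m N \<longleftrightarrow> natural_norm_props m N \<and> (\<forall>N'. natural_norm_props m N' \<longrightarrow> N' = N)"

definition joint_top_zero_divisor ::
    "('a \<Rightarrow> 'a \<Rightarrow> 'a) \<Rightarrow> ('a \<Rightarrow> real) \<Rightarrow> 'a \<Rightarrow> bool" where
  "joint_top_zero_divisor m N a \<longleftrightarrow> (\<exists>b :: nat \<Rightarrow> 'a. (\<forall>n. N (b n) = 1) \<and>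
     (\<lambda>n. N (m a (b n))) \<longlonglongrightarrow> 0 \<and> (\<lambda>n. N (m (b n) a)) \<longlonglongrightarrow> 0)"

definition supermultiplicative :: "('a \<Rightarrow> 'a \<Rightarrow> 'a) \<Rightarrow> ('a \<Rightarrow> real) \<Rightarrow> real \<Rightarrow> bool" where
  "supermultiplicative m N c \<longleftrightarrow> (\<forall>a b. c * N a * N b \<le> N (m a b))"

definition nearly_absolute_value :: "('a::real_vector \<Rightarrow> 'a \<Rightarrow> 'a) \<Rightarrow> ('a \<Rightarrow> real) \<Rightarrow> bool" where
  "nearly_absolute_value m N \<longleftrightarrow> vs_norm N \<and> (\<forall>a b. N (m a b) \<le> N a * N b) \<and>
     (\<exists>c>0. supermultiplicative m N c)"

definition absolute_value :: "('a::real_vector \<Rightarrow> 'a \<Rightarrow> 'a) \<Rightarrow> ('a \<Rightarrow> real) \<Rightarrow> bool" where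
  "absolute_value m N \<longleftrightarrow> vs_norm N \<and> (\<forall>a b. N (m a b) = N a * N b)"

definition norm_topology :: "('a::real_vector \<Rightarrow> real) \<Rightarrow> 'a topology" where
  "norm_topology N = Metric_space.mtopology UNIV (\<lambda>x y. N (x - y))"

definition separately_continuous :: "('a \<Rightarrow> 'a \<Rightarrow> 'a) \<Rightarrow> 'a topology \<Rightarrow> bool" where
  "separately_continuous m T \<longleftrightarrow>
     (\<forall>a. continuous_map T T (\<lambda>x. m a x) \<and> continuous_map T T (\<lambda>x. m x a))"

definition topological_algebra :: "('a::real_vector \<Rightarrow> 'a \<Rightarrow> 'a) \<Rightarrow> 'a topology \<Rightarrow> bool" where
  "topological_algebra m T \<longleftrightarrow> topspace T = UNIV \<and> Hausdorff_space T \<and>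
     continuous_map (prod_topology T T) T (\<lambda>(x, y). x + y) \<and>
     continuous_map (prod_topology euclideanreal T) T (\<lambda>(r, x). r *\<^sub>R x) \<and>
     separately_continuous m T \<and>
     continuous_map (subtopology T {a. invertible_in m a}) T (inverse_in m)"

definition dual_separates_points :: "'a::real_vector topology \<Rightarrow> bool" where
  "dual_separates_points T \<longleftrightarrow> (\<forall>x y. x \<noteq> y \<longrightarrow>
     (\<exists>f :: 'a \<Rightarrow> real. linear f \<and> continuous_map T euclideanreal f \<and> f x \<noteq> f y))"

text \<open>
  A complex nonassociative \<open>C\<^sup>*\<close>-algebra: a real Banach space \<open>'b\<close> with a compatible complex
  scalar multiplication \<open>sc\<close>, a product \<open>m\<close> and an involution \<open>st\<close>.
\<close>

definition cstar_algebra ::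
    "(complex \<Rightarrow> 'b::banach \<Rightarrow> 'b) \<Rightarrow> ('b \<Rightarrow> 'b \<Rightarrow> 'b) \<Rightarrow> ('b \<Rightarrow> 'b) \<Rightarrow> bool" where
  "cstar_algebra sc m st \<longleftrightarrow>
     vector_space sc \<and> (\<forall>r x. sc (complex_of_real r) x = r *\<^sub>R x) \<and>
     (\<forall>c x. norm (sc c x) = cmod c * norm x) \<and>
     bilinear m \<and> (\<forall>c x y. m (sc c x) y = sc c (m x y) \<and> m x (sc c y) = sc c (m x y)) \<and>
     (\<forall>x y. norm (m x y) \<le> norm x * norm y) \<and>
     (\<forall>x y. st (x + y) = st x + st y) \<and> (\<forall>c x. st (sc c x) = sc (cnj c) (st x)) \<and>
     (\<forall>x. st (st x) = x) \<and> (\<forall>x y. st (m x y) = m (st y) (st x)) \<and>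
     (\<forall>x. norm (m (st x) x) = norm x ^ 2)"

text \<open>
  The type argument \<open>'b\<close> is the ambient \<open>C\<^sup>*\<close>-algebra; since HOL cannot quantify
  over types inside a formula, it stays a free (hence universally quantified) type variable of the
  statements using this notion.  The map \<open>j\<close> identifies the algebra with a closed real
  \<open>*\<close>-subalgebra of \<open>'b\<close> and \<open>N\<close> with the restricted norm.
\<close>

definition real_cstar_algebra ::
    "'b::banach itself \<Rightarrow> ('a::real_vector \<Rightarrow> 'a \<Rightarrow> 'a) \<Rightarrow> ('a \<Rightarrow> real) \<Rightarrow> bool" where
  "real_cstar_algebra (_ :: 'b itself) m N \<longleftrightarrow>
     (\<exists>(sc :: complex \<Rightarrow> 'b \<Rightarrow> 'b) mB st (j :: 'a \<Rightarrow> 'b).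
        cstar_algebra sc mB st \<and>
        linear j \<and> inj j \<and> (\<forall>x y. j (m x y) = mB (j x) (j y)) \<and> (\<forall>x. N x = norm (j x)) \<and>
        is_subalgebra mB (range j) \<and> st ` range j \<subseteq> range j \<and> closed (range j))"

text \<open>
  The quaternions and octonions come from the complex numbers by the Cayley-Dickson process.
  The library norm of a product space is the Euclidean one.
\<close>

definition cd_mult :: "('a::ab_group_add \<Rightarrow> 'a \<Rightarrow> 'a) \<Rightarrow> ('a \<Rightarrow> 'a) \<Rightarrow> 'a \<times> 'a \<Rightarrow> 'a \<times> 'a \<Rightarrow> 'a \<times> 'a" where
  "cd_mult m cj = (\<lambda>(a, b) (c, d). (m a c - m (cj d) b, m d a + m b (cj c)))"

definition cd_conj :: "('a::ab_group_add \<Rightarrow> 'a) \<Rightarrow> 'a \<times> 'a \<Rightarrow> 'a \<times> 'a" where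
  "cd_conj cj = (\<lambda>(a, b). (cj a, - b))"

type_synonym quaternion = "complex \<times> complex"
type_synonym octonion = "quaternion \<times> quaternion"

definition quat_mult :: "quaternion \<Rightarrow> quaternion \<Rightarrow> quaternion" where
  "quat_mult = cd_mult (*) cnj"

definition quat_conj :: "quaternion \<Rightarrow> quaternion" where
  "quat_conj = cd_conj cnj"

definition oct_mult :: "octonion \<Rightarrow> octonion \<Rightarrow> octonion" where
  "oct_mult = cd_mult quat_mult quat_conj"

definition isometric_isomorphism ::
    "('a::real_vector \<Rightarrow> 'a \<Rightarrow> 'a) \<Rightarrow> ('a \<Rightarrow> real) \<Rightarrow>
     ('k::real_normed_vector \<Rightarrow> 'k \<Rightarrow> 'k) \<Rightarrow> ('a \<Rightarrow> 'k) \<Rightarrow> bool" where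
  "isometric_isomorphism m N mK f \<longleftrightarrow> linear f \<and> bij f \<and>
     (\<forall>x y. f (m x y) = mK (f x) (f y)) \<and> (\<forall>x. norm (f x) = N x)"

definition isometric_to_RCHO :: "('a::real_vector \<Rightarrow> 'a \<Rightarrow> 'a) \<Rightarrow> ('a \<Rightarrow> real) \<Rightarrow> bool" where
  "isometric_to_RCHO m N \<longleftrightarrow>
     (\<exists>f :: 'a \<Rightarrow> real. isometric_isomorphism m N (*) f) \<or>
     (\<exists>f :: 'a \<Rightarrow> complex. isometric_isomorphism m N (*) f) \<or>
     (\<exists>f :: 'a \<Rightarrow> quaternion. isometric_isomorphism m N quat_mult f) \<or>
     (\<exists>f :: 'a \<Rightarrow> octonion. isometric_isomorphism m N oct_mult f)"

end

(*
  Write L_x for the left multiplication by x.  In a left alternative algebra L is a homomorphism of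
  Jordan algebras, L (x y + y x) = L_x L_y + L_y L_x, and therefore L (x (y x)) = L_x L_y L_x.
  Without joint zero-divisors this forces every nonzero idempotent to be a unit element, and one-sided
  inverses to be two-sided.  Each of the analytic or algebraic hypotheses yields for every x a
  relation x^3 = 2 a x^2 - (a^2 + b^2) x; it produces an idempotent, so the algebra is unital and
  quadratic, and it carries a Euclidean form.  For orthogonal imaginary u, v and w = u v the identity
  w (w u) = w^2 u gives |w| = |u| |v|, so the form permits composition and Hurwitz's theorem applies.
*)
theory Submission
  imports Defs
    "HOL-Computational_Algebra.Fundamental_Theorem_Algebra"
    "HOL-Complex_Analysis.Cauchy_Integral_Formula"
begin

section \<open>Left alternative algebras without joint zero-divisors\<close>

text \<open>The factor t^2 - 2 a t + (a^2 + b^2) equals (t - z) (t - cnj z) for z = a + i b, so the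
  cubic relation is a real way of saying that x has the spectral value z; passing to the
  complexification would in general create zero-divisors. The extra factor x is there because no
  unit element is known when the relation is derived. The shape a^2 + b^2 of the last coefficient
  matters twice: if it vanishes, then so does 2 a, and once e is available it makes (x - a e)^2 a
  nonpositive multiple of e. The obstacle is the origin of the relation. Polynomials in one element
  still multiply commutatively, so an algebraic x can be treated by its minimal polynomial. Under
  the normed hypotheses neither inverses nor limits need exist, and Liouville's theorem for the
  resolvent is replaced by norm estimates between polynomials in L_x. In a topological division
  algebra resolvents exist but there is no norm to estimate them; continuity of inversion and
  continuous functionals bring Liouville's theorem back.\<close>

locale bilinear_algebra =
  fixes m :: "'a::real_vector \<Rightarrow> 'a \<Rightarrow> 'a"  (infixl "\<odot>" 70)
  assumes bilinear_mult: "bilinear m"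
begin

lemmas mult_simps =
  bilinear_ladd[OF bilinear_mult] bilinear_radd[OF bilinear_mult]
  bilinear_lsub[OF bilinear_mult] bilinear_rsub[OF bilinear_mult]
  bilinear_lmul[OF bilinear_mult] bilinear_rmul[OF bilinear_mult]
  bilinear_lneg[OF bilinear_mult] bilinear_rneg[OF bilinear_mult]
  bilinear_lzero[OF bilinear_mult] bilinear_rzero[OF bilinear_mult]

lemma linear_mult_left: "linear (m a)"
  using bilinear_mult by (simp add: bilinear_def)

end

locale left_alternative_algebra = bilinear_algebra +
  assumes left_alternative: "left_alternative m"
begin

lemma left_alt: "(x \<odot> x) \<odot> y = x \<odot> (x \<odot> y)"
  using left_alternative by (simp add: left_alternative_def)

lemma left_alt_linearized: "(x \<odot> y + y \<odot> x) \<odot> z = x \<odot> (y \<odot> z) + y \<odot> (x \<odot> z)"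
  using left_alt[of "x + y" z] left_alt[of x z] left_alt[of y z]
  by (simp add: mult_simps algebra_simps)

text \<open>
  The Jordan product \<open>x \<odot> y + y \<odot> x\<close> goes to the Jordan product of left multiplications, hence
  so does the quadratic operator \<open>y \<mapsto> x \<odot> (y \<odot> x)\<close>.
\<close>

lemma left_moufang: "(x \<odot> (y \<odot> x)) \<odot> z = x \<odot> (y \<odot> (x \<odot> z))"
proof -
  define s where "s = x \<odot> y + y \<odot> x"
  have s: "s \<odot> w = x \<odot> (y \<odot> w) + y \<odot> (x \<odot> w)" for w
    unfolding s_def by (rule left_alt_linearized)
  have xs: "x \<odot> s = (x \<odot> x) \<odot> y + x \<odot> (y \<odot> x)"
    by (simp add: s_def mult_simps left_alt)
  have "(s \<odot> x + x \<odot> s) \<odot> z = s \<odot> (x \<odot> z) + x \<odot> (s \<odot> z)"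
    by (rule left_alt_linearized)
  then have "(s \<odot> x + x \<odot> s) \<odot> z
      = 2 *\<^sub>R (x \<odot> (y \<odot> (x \<odot> z))) + (y \<odot> ((x \<odot> x) \<odot> z) + (x \<odot> x) \<odot> (y \<odot> z))"
    by (simp add: s mult_simps left_alt scaleR_2)
  also have "y \<odot> ((x \<odot> x) \<odot> z) + (x \<odot> x) \<odot> (y \<odot> z) = (y \<odot> (x \<odot> x) + (x \<odot> x) \<odot> y) \<odot> z"
    by (simp only: left_alt_linearized)
  finally have "2 *\<^sub>R ((x \<odot> (y \<odot> x)) \<odot> z) = 2 *\<^sub>R (x \<odot> (y \<odot> (x \<odot> z)))"
    by (simp add: s xs mult_simps scaleR_2 algebra_simps)
  then show ?thesis by simp
qed

end

locale left_alternative_domain = left_alternative_algebra +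
  assumes no_joint_zero_divisor: "x \<odot> y = 0 \<Longrightarrow> y \<odot> x = 0 \<Longrightarrow> x = 0 \<or> y = 0"
begin

lemma square_eq_zero: "x \<odot> x = 0 \<Longrightarrow> x = 0"
  using no_joint_zero_divisor by blast

lemma fourth_power_eq_zero: "x \<odot> (x \<odot> (x \<odot> x)) = 0 \<Longrightarrow> x = 0"
  using square_eq_zero left_alt by metis

text \<open>Peirce decomposition with respect to the projection P = L_e. The absence of joint
  zero-divisors gives (1 - P) L_x (1 - P) = 0 for every x. For h = x - e (x e) the operator L_h is
  therefore purely off-diagonal; applying the same identity to h h gives L_h P L_h = 0. So the
  fourth power of h vanishes, h = 0, and every x equals e (x e).\<close>

lemma idempotent_unit:
  assumes e: "e \<odot> e = e" "e \<noteq> 0"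
  shows "is_unit_element m e"
proof -
  have ee: "e \<odot> (e \<odot> z) = e \<odot> z" for z
    using left_alt[of e z] e by simp
  have star: "x = e \<odot> x + x \<odot> e - e \<odot> (x \<odot> e)" for x
  proof -
    \<comment> \<open>The Peirce component of x that e annihilates from both sides.\<close>
    define w where "w = x - e \<odot> x - x \<odot> e + e \<odot> (x \<odot> e)"
    have "e \<odot> w = 0" by (simp add: w_def mult_simps ee)
    moreover have "w \<odot> e = 0"
    proof -
      have "(e \<odot> x) \<odot> e + (x \<odot> e) \<odot> e = e \<odot> (x \<odot> e) + x \<odot> e"
        using left_alt_linearized[of e x e] e by (simp add: mult_simps)
      moreover have "(e \<odot> (x \<odot> e)) \<odot> e = e \<odot> (x \<odot> e)"
        using left_moufang[of e x e] e by simp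
      ultimately show ?thesis by (simp add: w_def mult_simps algebra_simps)
    qed
    ultimately have "w = 0" using no_joint_zero_divisor e by blast
    then show ?thesis by (simp add: w_def algebra_simps)
  qed
  have star_op: "x \<odot> z = e \<odot> (x \<odot> z) + x \<odot> (e \<odot> z) - e \<odot> (x \<odot> (e \<odot> z))" for x z
    by (subst star[of x])
      (simp add: mult_simps(3) left_alt_linearized left_moufang)
  have corner: "e \<odot> (x \<odot> e) = x" for x
  proof -
    define h where "h = x - e \<odot> (x \<odot> e)"
    have h: "h \<odot> z = x \<odot> z - e \<odot> (x \<odot> (e \<odot> z))" for z
      by (simp add: h_def mult_simps left_moufang)
    have ehe: "e \<odot> (h \<odot> (e \<odot> z)) = 0" for z
      by (simp add: h mult_simps ee)
    have hsum: "h \<odot> z = e \<odot> (h \<odot> z) + h \<odot> (e \<odot> z)" for z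
      using star_op[of h z] ehe by simp
    have ehhe: "e \<odot> (h \<odot> (h \<odot> z)) = e \<odot> (h \<odot> (h \<odot> (e \<odot> z)))" for z
    proof -
      have "e \<odot> (h \<odot> (h \<odot> z)) = e \<odot> (h \<odot> (e \<odot> (h \<odot> z) + h \<odot> (e \<odot> z)))"
        using hsum[of z] by simp
      also have "\<dots> = e \<odot> (h \<odot> (h \<odot> (e \<odot> z)))" by (simp add: mult_simps ehe)
      finally show ?thesis .
    qed
    have hh: "h \<odot> (h \<odot> z) = h \<odot> (h \<odot> (e \<odot> z))" for z
      using star_op[of "h \<odot> h" z] ehhe[of z] by (simp add: left_alt)
    have heh: "h \<odot> (e \<odot> (h \<odot> z)) = 0" for z
    proof -
      have "h \<odot> (e \<odot> (h \<odot> z)) = h \<odot> (h \<odot> z) - h \<odot> (h \<odot> (e \<odot> z))"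
        using arg_cong[OF hsum[of z], of "m h"] by (simp add: mult_simps)
      then show ?thesis using hh[of z] by simp
    qed
    have "h \<odot> (h \<odot> (h \<odot> h)) = h \<odot> (h \<odot> (e \<odot> (h \<odot> h)))" by (rule hh)
    also have "\<dots> = 0" by (simp only: heh mult_simps)
    finally have "h = 0" by (rule fourth_power_eq_zero)
    then show ?thesis by (simp add: h_def)
  qed
  have "e \<odot> x = x" for x
    using ee[of "x \<odot> e"] by (simp only: corner)
  moreover have "x \<odot> e = x" for x
    using corner[of x] calculation by simp
  ultimately show ?thesis by (simp add: is_unit_element_def)
qed

text \<open>The defect v = a c - e has L_v = -(p + q), where p = 1 - L_a L_c and q = 1 - L_c L_a
  satisfy L_a q = 0 and p L_a = 0. For suitable b the element v (b v) has left multiplication q L_b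
  p, is annihilated by a from both sides and so vanishes. For b = a and b = a a this makes w = a v +
  v a nilpotent; from w = 0 follows v a = a v = 0.\<close>

lemma left_inverse_is_right_inverse:
  assumes e: "is_unit_element m e" and ca: "c \<odot> a = e"
  shows "a \<odot> c = e"
proof (cases "e = 0")
  case True
  then show ?thesis using e unfolding is_unit_element_def by (metis bilinear_lzero[OF bilinear_mult])
next
  case False
  have ex [simp]: "e \<odot> z = z" "z \<odot> e = z" for z
    using e by (auto simp: is_unit_element_def)
  have "a \<noteq> 0" using ca False by (auto simp: mult_simps)
  have aca: "a \<odot> (c \<odot> (a \<odot> z)) = a \<odot> z" for z
    using left_moufang[of a c z] ca by simp
  have cac_e: "c \<odot> (a \<odot> c) = c"
  proof -
    define w where "w = c \<odot> (a \<odot> c) - c"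
    have "a \<odot> w = 0" by (simp add: w_def mult_simps aca)
    moreover have "w \<odot> a = 0"
      by (simp add: w_def mult_simps left_moufang ca)
    ultimately show ?thesis using no_joint_zero_divisor[of a w] \<open>a \<noteq> 0\<close> by (simp add: w_def)
  qed
  have cac: "c \<odot> (a \<odot> (c \<odot> z)) = c \<odot> z" for z
    using left_moufang[of c a z] cac_e by simp
  define p where "p = (\<lambda>z. z - a \<odot> (c \<odot> z))"
  define q where "q = (\<lambda>z. z - c \<odot> (a \<odot> z))"
  define v where "v = a \<odot> c - e"
  have v: "v \<odot> z = - (p z + q z)" for z
    using left_alt_linearized[of a c z] ca
    by (simp add: v_def p_def q_def mult_simps algebra_simps)
  have aq: "a \<odot> q z = 0" and pa: "p (a \<odot> z) = 0" for z
    by (simp_all add: p_def q_def mult_simps aca)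
  have lin: "p (x + y) = p x + p y" "q (x + y) = q x + q y" "p (- x) = - p x" "q (- x) = - q x"
      "p 0 = 0" "q 0 = 0" "q (q x) = q x" for x y
    by (simp_all add: p_def q_def mult_simps aca)
  have sandwich: "q (b \<odot> p z) = 0"
    if b: "\<And>z. a \<odot> (b \<odot> z) = b \<odot> (a \<odot> z)" "\<And>z. p (b \<odot> z) = 0" "\<And>z. b \<odot> q z = 0" for b z
  proof -
    define t where "t = v \<odot> (b \<odot> v)"
    have t: "t \<odot> z = q (b \<odot> p z)" for z
      unfolding t_def left_moufang by (simp add: v lin mult_simps b)
    have "t = q (b \<odot> p e)" using t[of e] by simp
    then have "a \<odot> t = 0" by (simp add: aq)
    moreover have "t \<odot> a = 0" using t[of a] pa[of e] by (simp add: mult_simps lin)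
    ultimately have "t = 0" using no_joint_zero_divisor \<open>a \<noteq> 0\<close> by blast
    then show ?thesis using t[of z] by (simp add: mult_simps)
  qed
  have qap: "q (a \<odot> p z) = 0" for z
    using sandwich[of a z] by (simp add: aq pa)
  have qaap: "q (a \<odot> (a \<odot> p z)) = 0" for z
    using sandwich[of "a \<odot> a" z] by (simp add: aq pa left_alt mult_simps)
  define w where "w = a \<odot> v + v \<odot> a"
  have w: "w \<odot> z = - (a \<odot> p z + q (a \<odot> z))" for z
    unfolding w_def left_alt_linearized by (simp add: v mult_simps aq pa)
  have "w \<odot> (w \<odot> (w \<odot> w)) = 0"
    by (simp add: w lin mult_simps aq pa qap qaap)
  then have "w = 0" by (rule fourth_power_eq_zero)
  then have wz: "a \<odot> p z + q (a \<odot> z) = 0" for z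
    using w[of z] by (simp only: mult_simps neg_0_equal_iff_equal)
  have "q (a \<odot> z) = 0" for z
    using arg_cong[OF wz[of z], of q] qap[of z] by (simp add: lin)
  from this[of e] have "v \<odot> a = 0" using v[of a] pa[of e] by simp
  moreover have "a \<odot> v = 0" using \<open>w = 0\<close> calculation by (simp add: w_def)
  ultimately show ?thesis using no_joint_zero_divisor[of a v] \<open>a \<noteq> 0\<close> by (simp add: v_def)
qed

end

context left_alternative_algebra
begin

text \<open>L_a L_c and L_c L_a are idempotent by the Moufang identity and add up to 2. If P and 2 -
  P are both idempotent, then P = 1.\<close>

lemma left_mult_inverse:
  assumes e: "is_unit_element m e" and ac: "a \<odot> c = e" and ca: "c \<odot> a = e"
  shows "a \<odot> (c \<odot> z) = z"
proof -
  have ex [simp]: "e \<odot> z = z" "z \<odot> e = z" for z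
    using e by (auto simp: is_unit_element_def)
  have aca: "a \<odot> (c \<odot> (a \<odot> z)) = a \<odot> z" for z
    using left_moufang[of a c z] ca by simp
  have cac: "c \<odot> (a \<odot> (c \<odot> z)) = c \<odot> z" for z
    using left_moufang[of c a z] ac by simp
  have sum: "a \<odot> (c \<odot> z) + c \<odot> (a \<odot> z) = 2 *\<^sub>R z" for z
    using left_alt_linearized[of a c z] ac ca by (simp add: mult_simps scaleR_2)
  have "a \<odot> (c \<odot> (c \<odot> z)) = c \<odot> z" for z
    using sum[of "c \<odot> z"] cac[of z] by (simp add: scaleR_2)
  then have "a \<odot> (c \<odot> (c \<odot> (a \<odot> z))) = c \<odot> (a \<odot> z)" by simp
  moreover have "a \<odot> (c \<odot> (c \<odot> (a \<odot> z))) = a \<odot> (c \<odot> z)"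
  proof -
    have "c \<odot> (a \<odot> z) = 2 *\<^sub>R z - a \<odot> (c \<odot> z)" using sum[of z] by (simp add: algebra_simps)
    then have "a \<odot> (c \<odot> (c \<odot> (a \<odot> z))) = 2 *\<^sub>R (a \<odot> (c \<odot> z)) - a \<odot> (c \<odot> (a \<odot> (c \<odot> z)))"
      by (simp add: mult_simps)
    then show ?thesis by (simp add: aca scaleR_2)
  qed
  ultimately have "2 *\<^sub>R (a \<odot> (c \<odot> z)) = 2 *\<^sub>R z" using sum[of z] by (simp add: scaleR_2)
  then show ?thesis by simp
qed

end

section \<open>The composition form of a quadratic algebra\<close>

locale inner_form =
  fixes ip :: "'a::real_vector \<Rightarrow> 'a \<Rightarrow> real"
  assumes ip_bilinear: "bilinear ip"
    and ip_commute: "ip x y = ip y x"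
    and ip_pos: "x \<noteq> 0 \<Longrightarrow> 0 < ip x x"
begin

lemmas ip_simps =
  bilinear_ladd[OF ip_bilinear] bilinear_radd[OF ip_bilinear]
  bilinear_lsub[OF ip_bilinear] bilinear_rsub[OF ip_bilinear]
  bilinear_lmul[OF ip_bilinear] bilinear_rmul[OF ip_bilinear]
  bilinear_lneg[OF ip_bilinear] bilinear_rneg[OF ip_bilinear]
  bilinear_lzero[OF ip_bilinear] bilinear_rzero[OF ip_bilinear]

lemma ip_eq_zero_iff [simp]: "ip x x = 0 \<longleftrightarrow> x = 0"
  using ip_pos[of x] ip_simps(9)[of x] by force

lemma ip_nonneg [simp]: "0 \<le> ip x x"
  using ip_pos[of x] by (cases "x = 0") (auto simp: ip_simps)

lemma ip_ext: "(\<And>z. ip x z = ip y z) \<Longrightarrow> x = y"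
  using ip_eq_zero_iff[of "x - y"] by (simp add: ip_simps)

end

locale euclidean_composition_algebra = bilinear_algebra m + inner_form ip
  for m :: "'a::real_vector \<Rightarrow> 'a \<Rightarrow> 'a" (infixl "\<odot>" 70) and ip +
  fixes e
  assumes unit: "is_unit_element m e"
    and unit_nonzero: "e \<noteq> 0"
    and composition: "ip (x \<odot> y) (x \<odot> y) = ip x x * ip y y"

context left_alternative_algebra
begin

text \<open>The heart is the case of orthogonal imaginary u, v: expanding both sides of w (w u) = (w
  w) u gives the relation \<open>rel\<close> between e, u, v and w, and its coefficients yield the
  length of w as well as its orthogonality to e, u and v. General factors are reduced to this case
  by orthogonal decomposition.\<close>

lemma composition_of_quadratic:
  assumes "inner_form ip" and e: "is_unit_element m e" "e \<noteq> 0"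
    and quad: "\<And>x. x \<odot> x = (2 * ip e x) *\<^sub>R x - ip x x *\<^sub>R e"
  shows "euclidean_composition_algebra m ip e"
proof -
  interpret inner_form ip by fact
  have ex [simp]: "e \<odot> z = z" "z \<odot> e = z" for z
    using e by (auto simp: is_unit_element_def)
  have ee: "ip e e = 1"
  proof -
    have "ip e e *\<^sub>R e = e" using quad[of e] by (simp add: scaleR_2 flip: scaleR_scaleR)
    then have "(ip e e - 1) *\<^sub>R e = 0" by (simp add: algebra_simps)
    then show ?thesis using \<open>e \<noteq> 0\<close> by simp
  qed
  have polar: "y \<odot> x = (2 * ip e x) *\<^sub>R y + (2 * ip e y) *\<^sub>R x - (2 * ip x y) *\<^sub>R e - x \<odot> y" for x y
    using quad[of "x + y"] quad[of x] quad[of y]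
    by (simp add: mult_simps ip_simps ip_commute[of y x] algebra_simps)
  have imag: "ip (u \<odot> v) (u \<odot> v) = ip u u * ip v v \<and> ip e (u \<odot> v) = 0
      \<and> ip u (u \<odot> v) = 0 \<and> ip v (u \<odot> v) = 0"
    if uv: "ip e u = 0" "ip e v = 0" "ip u v = 0" for u v
  proof (cases "u = 0 \<or> v = 0")
    case True
    then show ?thesis by (auto simp: mult_simps ip_simps)
  next
    case False
    then have nz: "u \<noteq> 0" "v \<noteq> 0" by auto
    define w where "w = u \<odot> v"
    note sym = ip_commute[of v u] ip_commute[of w u] ip_commute[of w v] ip_commute[of v e]
      ip_commute[of u e] ip_commute[of w e]
    have uu: "u \<odot> u = - (ip u u *\<^sub>R e)" and vv: "v \<odot> v = - (ip v v *\<^sub>R e)"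
      using quad[of u] quad[of v] uv by auto
    have vu: "v \<odot> u = - w" using polar[of v u] uv by (simp add: w_def)
    have uw: "u \<odot> w = - (ip u u *\<^sub>R v)"
      unfolding w_def using left_alt[of u v] uu by (simp add: mult_simps)
    have vw: "v \<odot> w = ip v v *\<^sub>R u"
      using left_alt[of v u] vv vu by (simp add: mult_simps)
    have wu: "w \<odot> u = (2 * ip e w) *\<^sub>R u - (2 * ip u w) *\<^sub>R e + ip u u *\<^sub>R v"
      using polar[of w u] uv uw by (simp add: sym)
    have wv: "w \<odot> v = (2 * ip e w) *\<^sub>R v - (2 * ip v w) *\<^sub>R e - ip v v *\<^sub>R u"
      using polar[of w v] uv vw by (simp add: sym)
    have "w \<odot> (w \<odot> u) = (2 * ip e w) *\<^sub>R (w \<odot> u) - ip w w *\<^sub>R u"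
      unfolding left_alt[symmetric] by (subst quad[of w]) (simp add: mult_simps)
    moreover have "w \<odot> (w \<odot> u)
        = (2 * ip e w) *\<^sub>R (w \<odot> u) - (2 * ip u w) *\<^sub>R w + ip u u *\<^sub>R (w \<odot> v)"
      by (subst wu) (simp add: mult_simps)
    ultimately have rel: "(2 * ip u w) *\<^sub>R w
        = ip w w *\<^sub>R u + (2 * ip u u * ip e w) *\<^sub>R v - (2 * ip u u * ip v w) *\<^sub>R e
          - (ip u u * ip v v) *\<^sub>R u"
      by (simp add: wv algebra_simps)
    \<comment> \<open>Otherwise \<open>rel\<close> would put w into the span of e, u and v.
      Multiplying by u and comparing the components along v would then give c^2 = - |u|^2, where c
      is the coefficient of v in w.\<close>
    have uw0: "ip u w = 0"
    proof (rule ccontr)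
      assume "ip u w \<noteq> 0"
      define k where "k = inverse (2 * ip u w)"
      have "w = k *\<^sub>R ((2 * ip u w) *\<^sub>R w)" using \<open>ip u w \<noteq> 0\<close> by (simp add: k_def)
      then have "w = (- (k * (2 * ip u u * ip v w))) *\<^sub>R e
          + (k * (ip w w - ip u u * ip v v)) *\<^sub>R u + (k * (2 * ip u u * ip e w)) *\<^sub>R v"
        unfolding rel by (simp add: algebra_simps)
      then obtain a b c where w: "w = a *\<^sub>R e + b *\<^sub>R u + c *\<^sub>R v" by blast
      then have "u \<odot> w = a *\<^sub>R u - (b * ip u u) *\<^sub>R e + c *\<^sub>R w"
        by (simp add: mult_simps uu w_def)
      then have eq: "- (ip u u *\<^sub>R v) = a *\<^sub>R u - (b * ip u u) *\<^sub>R e + c *\<^sub>R (a *\<^sub>R e + b *\<^sub>R u + c *\<^sub>R v)"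
        using uw w by simp
      have "- (ip u u * ip v v) = c * c * ip v v"
        using arg_cong[OF eq, of "ip v"] uv by (simp add: ip_simps sym)
      then have "(c * c + ip u u) * ip v v = 0" by (simp add: algebra_simps)
      moreover have "0 < (c * c + ip u u) * ip v v"
        using ip_pos[OF nz(1)] ip_pos[OF nz(2)] by (intro mult_pos_pos add_nonneg_pos) auto
      ultimately show False by linarith
    qed
    with rel have rel: "ip w w *\<^sub>R u + (2 * ip u u * ip e w) *\<^sub>R v - (2 * ip u u * ip v w) *\<^sub>R e
          - (ip u u * ip v v) *\<^sub>R u = 0"
      by simp
    have "ip w w * ip u u = ip u u * ip v v * ip u u"
      using arg_cong[OF rel, of "ip u"] uv by (simp add: ip_simps sym)
    then have "ip w w = ip u u * ip v v" using nz by simp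
    moreover have "2 * ip u u * ip e w * ip v v = 0"
      using arg_cong[OF rel, of "ip v"] uv by (simp add: ip_simps sym)
    then have "ip e w = 0" using nz by simp
    moreover have "2 * ip u u * ip v w = 0"
      using arg_cong[OF rel, of "ip e"] uv by (simp add: ip_simps sym ee)
    then have "ip v w = 0" using nz by simp
    ultimately show ?thesis using uw0 by (simp add: w_def)
  qed
  show ?thesis
  proof
    fix x y
    define a where "a = ip e x"
    define u where "u = x - a *\<^sub>R e"
    define b where "b = ip e y"
    \<comment> \<open>Gram-Schmidt coefficient of y along u; for u = 0 any value serves, since v is
      orthogonal to 0 anyway.\<close>
    define c where "c = (if u = 0 then 0 else ip u y / ip u u)"
    define v where "v = y - b *\<^sub>R e - c *\<^sub>R u"
    have x: "x = a *\<^sub>R e + u" and y: "y = b *\<^sub>R e + c *\<^sub>R u + v"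
      by (simp_all add: u_def v_def)
    have eu: "ip e u = 0" by (simp add: u_def a_def ip_simps ee)
    have ev: "ip e v = 0" by (simp add: v_def b_def ip_simps ee eu)
    have uv: "ip u v = 0"
      using eu by (simp add: v_def c_def ip_simps ip_commute[of u e])
    have uu: "u \<odot> u = - (ip u u *\<^sub>R e)" using quad[of u] eu by simp
    have xy: "x \<odot> y = (a * b - c * ip u u) *\<^sub>R e + (a * c + b) *\<^sub>R u + a *\<^sub>R v + u \<odot> v"
      by (simp add: x y mult_simps uu algebra_simps)
    note i = imag[OF eu ev uv]
    define w where "w = u \<odot> v"
    note sym = ip_commute[of v u] ip_commute[of w u] ip_commute[of w v] ip_commute[of v e]
      ip_commute[of u e] ip_commute[of w e]
    have w: "ip w w = ip u u * ip v v" "ip e w = 0" "ip u w = 0" "ip v w = 0"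
      using i by (simp_all add: w_def)
    have "ip (x \<odot> y) (x \<odot> y)
        = (a * b - c * ip u u)\<^sup>2 + (a * c + b)\<^sup>2 * ip u u + a\<^sup>2 * ip v v + ip u u * ip v v"
      unfolding xy w_def[symmetric]
      by (simp add: ip_simps sym w eu ev uv ee power2_eq_square algebra_simps)
    moreover have "ip x x = a\<^sup>2 + ip u u" "ip y y = b\<^sup>2 + c\<^sup>2 * ip u u + ip v v"
      unfolding x y by (simp_all add: ip_simps sym eu ev uv ee power2_eq_square algebra_simps)
    ultimately show "ip (x \<odot> y) (x \<odot> y) = ip x x * ip y y"
      by (simp add: power2_eq_square algebra_simps)
  qed (use e in auto)
qed

end

section \<open>The unit element and the Euclidean form obtained from the cubic relation\<close>

context left_alternative_domain
begin

text \<open>Solving the cubic relation for x gives an element y in the span of x and x x with y x =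
  x. It also fixes x x, hence itself, and so is a nonzero idempotent. Division by \<gamma> is
  legitimate because \<gamma> = 0 forces \<alpha> = \<beta> = 0 and makes x nilpotent.\<close>

lemma exists_unit:
  assumes nz: "\<exists>x::'a. x \<noteq> 0"
    and cubic: "\<And>x. \<exists>\<alpha> \<beta>. x \<odot> (x \<odot> x) = (2 * \<alpha>) *\<^sub>R (x \<odot> x) - (\<alpha>\<^sup>2 + \<beta>\<^sup>2) *\<^sub>R x"
  obtains e where "is_unit_element m e" "e \<noteq> 0"
proof -
  obtain x :: 'a where x: "x \<noteq> 0" using nz by blast
  obtain \<alpha> \<beta> where c: "x \<odot> (x \<odot> x) = (2 * \<alpha>) *\<^sub>R (x \<odot> x) - (\<alpha>\<^sup>2 + \<beta>\<^sup>2) *\<^sub>R x"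
    using cubic by blast
  define \<gamma> where "\<gamma> = \<alpha>\<^sup>2 + \<beta>\<^sup>2"
  have "\<gamma> \<noteq> 0"
  proof
    assume "\<gamma> = 0"
    then have "x \<odot> (x \<odot> (x \<odot> x)) = 0" using c by (simp add: \<gamma>_def sum_power2_eq_zero_iff mult_simps)
    then show False using fourth_power_eq_zero x by blast
  qed
  define y where "y = (1 / \<gamma>) *\<^sub>R ((2 * \<alpha>) *\<^sub>R x - x \<odot> x)"
  have y: "y \<odot> z = (1 / \<gamma>) *\<^sub>R ((2 * \<alpha>) *\<^sub>R (x \<odot> z) - x \<odot> (x \<odot> z))" for z
    by (simp add: y_def mult_simps left_alt)
  have yx: "y \<odot> x = x" using \<open>\<gamma> \<noteq> 0\<close> by (simp add: y c \<gamma>_def[symmetric])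
  have "x \<odot> (x \<odot> (x \<odot> x)) = (2 * \<alpha>) *\<^sub>R (x \<odot> (x \<odot> x)) - \<gamma> *\<^sub>R (x \<odot> x)"
    by (subst c) (simp add: mult_simps \<gamma>_def)
  then have yxx: "y \<odot> (x \<odot> x) = x \<odot> x" using \<open>\<gamma> \<noteq> 0\<close> by (simp add: y)
  have "y \<odot> y = y"
    by (subst (2) y_def) (simp only: mult_simps yx yxx, simp only: y_def)
  moreover have "y \<noteq> 0" using yx x by (auto simp: mult_simps)
  ultimately show ?thesis using idempotent_unit that by blast
qed

text \<open>Frobenius' argument: the elements whose square is a nonpositive multiple of e form a
  complement of the line through e. This gives a real part and a conjugation, and x times its
  conjugate defines the form.\<close>

theorem exists_composition_form:
  assumes nz: "\<exists>x::'a. x \<noteq> 0"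
    and cubic: "\<And>x. \<exists>\<alpha> \<beta>. x \<odot> (x \<odot> x) = (2 * \<alpha>) *\<^sub>R (x \<odot> x) - (\<alpha>\<^sup>2 + \<beta>\<^sup>2) *\<^sub>R x"
  shows "\<exists>ip e. euclidean_composition_algebra m ip e"
proof -
  obtain e where e: "is_unit_element m e" "e \<noteq> 0" using exists_unit[OF nz cubic] .
  have ex [simp]: "e \<odot> z = z" "z \<odot> e = z" for z
    using e by (auto simp: is_unit_element_def)
  have quadratic: "\<exists>\<alpha> \<beta>. x \<odot> x = (2 * \<alpha>) *\<^sub>R x - (\<alpha>\<^sup>2 + \<beta>\<^sup>2) *\<^sub>R e" for x
  proof (cases "x = 0")
    case True
    then show ?thesis by (intro exI[of _ 0]) (simp add: mult_simps)
  next
    case False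
    obtain \<alpha> \<beta> where c: "x \<odot> (x \<odot> x) = (2 * \<alpha>) *\<^sub>R (x \<odot> x) - (\<alpha>\<^sup>2 + \<beta>\<^sup>2) *\<^sub>R x"
      using cubic by blast
    define w where "w = x \<odot> x - (2 * \<alpha>) *\<^sub>R x + (\<alpha>\<^sup>2 + \<beta>\<^sup>2) *\<^sub>R e"
    have "x \<odot> w = 0" "w \<odot> x = 0"
      by (simp_all add: w_def mult_simps left_alt c)
    then have "w = 0" using no_joint_zero_divisor False by blast
    then show ?thesis unfolding w_def by (intro exI[of _ \<alpha>] exI[of _ \<beta>]) (simp add: algebra_simps)
  qed
  define imag where "imag v \<longleftrightarrow> (\<exists>s\<ge>0. v \<odot> v = - (s *\<^sub>R e))" for v
  have imagD: "\<exists>s. 0 \<le> s \<and> v \<odot> v = - (s *\<^sub>R e)" if "imag v" for v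
    using that by (simp only: imag_def)
  have imag_scalar: "r = 0" if im: "imag (r *\<^sub>R e)" for r
  proof -
    obtain s where "s \<ge> 0" "(r *\<^sub>R e) \<odot> (r *\<^sub>R e) = - (s *\<^sub>R e)" using imagD[OF im] by metis
    then have "(r * r + s) *\<^sub>R e = 0" by (simp add: mult_simps algebra_simps)
    then have "r * r + s = 0" using e by simp
    then show ?thesis using \<open>s \<ge> 0\<close> by (metis add_nonneg_eq_0_iff mult_eq_0_iff zero_le_square)
  qed
  have imag_scale: "imag (r *\<^sub>R v)" if im: "imag v" for r v
  proof -
    obtain s where "s \<ge> 0" "v \<odot> v = - (s *\<^sub>R e)" using imagD[OF im] by metis
    then show ?thesis unfolding imag_def
      by (intro exI[of _ "r * r * s"]) (simp add: mult_simps)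
  qed
  have imag_shift: "d = 0" if im: "imag v" "imag (v + d *\<^sub>R e)" for v d
  proof (rule ccontr)
    assume d: "d \<noteq> 0"
    obtain s where s: "s \<ge> 0" "v \<odot> v = - (s *\<^sub>R e)" using imagD[OF im(1)] by metis
    obtain s' where s': "s' \<ge> 0" "(v + d *\<^sub>R e) \<odot> (v + d *\<^sub>R e) = - (s' *\<^sub>R e)" using imagD[OF im(2)] by metis
    have "(2 * d) *\<^sub>R v = (s - s' - d * d) *\<^sub>R e"
      using s(2) s'(2) by (simp add: mult_simps algebra_simps scaleR_2 flip: scaleR_scaleR)
    then have "v = ((s - s' - d * d) / (2 * d)) *\<^sub>R e"
      using d by (simp add: eq_vector_fraction_iff)
    then obtain r where v: "v = r *\<^sub>R e" by blast
    then have "r = 0" using im(1) imag_scalar by simp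
    with v im(2) have "imag (d *\<^sub>R e)" by simp
    then show False using imag_scalar d by blast
  qed
  have decompose: "\<exists>\<alpha>. imag (x - \<alpha> *\<^sub>R e)" for x
  proof -
    obtain \<alpha> \<beta> where q: "x \<odot> x = (2 * \<alpha>) *\<^sub>R x - (\<alpha>\<^sup>2 + \<beta>\<^sup>2) *\<^sub>R e" using quadratic by blast
    have "(x - \<alpha> *\<^sub>R e) \<odot> (x - \<alpha> *\<^sub>R e) = - (\<beta>\<^sup>2 *\<^sub>R e)"
      by (simp add: mult_simps q algebra_simps power2_eq_square scaleR_2 flip: scaleR_scaleR)
    then show ?thesis unfolding imag_def by (metis zero_le_power2)
  qed
  \<comment> \<open>The only hard closure property. Writing the quadratic equations of u + v and u -
    v and adding them, the parallelogram identity leaves a linear relation between u, v and e. If v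
    lies outside the span of u and e, it forces both traces to vanish.\<close>
  have imag_add: "imag (u + v)" if u: "imag u" and v: "imag v" for u v
  proof (cases "\<exists>c d. v = c *\<^sub>R u + d *\<^sub>R e")
    case True
    then obtain c d where cd: "v = c *\<^sub>R u + d *\<^sub>R e" by blast
    then have "d = 0" using imag_shift[OF imag_scale[OF u]] v by blast
    then have "u + v = (1 + c) *\<^sub>R u" using cd by (simp add: algebra_simps)
    then show ?thesis using imag_scale[OF u] by metis
  next
    case False
    obtain a a' where a: "(u + v) \<odot> (u + v) = (2 * a) *\<^sub>R (u + v) - (a\<^sup>2 + a'\<^sup>2) *\<^sub>R e"
      using quadratic by blast
    obtain b b' where b: "(u - v) \<odot> (u - v) = (2 * b) *\<^sub>R (u - v) - (b\<^sup>2 + b'\<^sup>2) *\<^sub>R e"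
      using quadratic by blast
    obtain s where s: "s \<ge> 0" "u \<odot> u = - (s *\<^sub>R e)" using imagD[OF u] by metis
    obtain s' where s': "s' \<ge> 0" "v \<odot> v = - (s' *\<^sub>R e)" using imagD[OF v] by metis
    have "(u + v) \<odot> (u + v) + (u - v) \<odot> (u - v) = 2 *\<^sub>R (u \<odot> u + v \<odot> v)"
      by (simp add: mult_simps algebra_simps scaleR_2)
    then have "(2 * a) *\<^sub>R (u + v) - (a\<^sup>2 + a'\<^sup>2) *\<^sub>R e + ((2 * b) *\<^sub>R (u - v) - (b\<^sup>2 + b'\<^sup>2) *\<^sub>R e)
        = 2 *\<^sub>R (- (s *\<^sub>R e) - s' *\<^sub>R e)"
      by (simp only: a b s s') simp
    then have rel: "(2 * (a - b)) *\<^sub>R v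
        = (- 2 * (a + b)) *\<^sub>R u + (a\<^sup>2 + a'\<^sup>2 + b\<^sup>2 + b'\<^sup>2 - 2 * s - 2 * s') *\<^sub>R e"
      by (simp add: algebra_simps)
    have "a = b"
    proof (rule ccontr)
      assume "a \<noteq> b"
      define k where "k = inverse (2 * (a - b))"
      have "k *\<^sub>R ((2 * (a - b)) *\<^sub>R v) = v" using \<open>a \<noteq> b\<close> by (simp add: k_def)
      then have "v = (k * (- 2 * (a + b))) *\<^sub>R u
          + (k * (a\<^sup>2 + a'\<^sup>2 + b\<^sup>2 + b'\<^sup>2 - 2 * s - 2 * s')) *\<^sub>R e"
        unfolding rel by (simp add: scaleR_right_distrib)
      then show False using False by blast
    qed
    \<comment> \<open>With a = b the term in v has disappeared, so a nonzero a would make the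
      imaginary u a multiple of e, that is u = 0; then the equation of u + v makes v a multiple of e
      too.\<close>
    have "a = 0"
    proof (rule ccontr)
      assume "a \<noteq> 0"
      define k where "k = inverse (4 * a)"
      have "(4 * a) *\<^sub>R u = (a\<^sup>2 + a'\<^sup>2 + b\<^sup>2 + b'\<^sup>2 - 2 * s - 2 * s') *\<^sub>R e"
        using rel \<open>a = b\<close> by (simp add: algebra_simps)
      moreover have "u = k *\<^sub>R ((4 * a) *\<^sub>R u)" using \<open>a \<noteq> 0\<close> by (simp add: k_def)
      ultimately have "u = (k * (a\<^sup>2 + a'\<^sup>2 + b\<^sup>2 + b'\<^sup>2 - 2 * s - 2 * s')) *\<^sub>R e"
        by (metis scaleR_scaleR)
      then have "u = 0" using imag_scalar u by (metis scaleR_zero_left)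
      have "(2 * a) *\<^sub>R v = v \<odot> v + (a\<^sup>2 + a'\<^sup>2) *\<^sub>R e"
        using a \<open>u = 0\<close> by simp
      then have "(2 * a) *\<^sub>R v = (a\<^sup>2 + a'\<^sup>2 - s') *\<^sub>R e" using s' by (simp add: algebra_simps)
      then have "inverse (2 * a) *\<^sub>R ((2 * a) *\<^sub>R v) = (inverse (2 * a) * (a\<^sup>2 + a'\<^sup>2 - s')) *\<^sub>R e"
        by simp
      then have "v = 0 *\<^sub>R u + (inverse (2 * a) * (a\<^sup>2 + a'\<^sup>2 - s')) *\<^sub>R e" using \<open>a \<noteq> 0\<close> by simp
      then show False using False by blast
    qed
    then have "(u + v) \<odot> (u + v) = - (a'\<^sup>2 *\<^sub>R e)" using a by simp
    then show ?thesis unfolding imag_def by (metis zero_le_power2)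
  qed
  define re where "re x = (THE \<alpha>. imag (x - \<alpha> *\<^sub>R e))" for x
  have re_unique: "re x = \<alpha>" if "imag (x - \<alpha> *\<^sub>R e)" for x \<alpha>
    unfolding re_def
  proof (rule the_equality[where P = "\<lambda>\<alpha>. imag (x - \<alpha> *\<^sub>R e)", OF that])
    fix \<beta> assume "imag (x - \<beta> *\<^sub>R e)"
    then have "imag ((x - \<alpha> *\<^sub>R e) + (\<alpha> - \<beta>) *\<^sub>R e)" by (simp add: algebra_simps)
    then show "\<beta> = \<alpha>" using imag_shift[OF that] by fastforce
  qed
  have re_imag: "imag (x - re x *\<^sub>R e)" for x
    using decompose[of x] re_unique by auto
  have re_linear: "linear re"
  proof
    fix x y show "re (x + y) = re x + re y"
      using imag_add[OF re_imag[of x] re_imag[of y]] by (intro re_unique) (simp add: algebra_simps)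
  next
    fix r x show "re (r *\<^sub>R x) = r *\<^sub>R re x"
      using imag_scale[OF re_imag[of x], of r] by (intro re_unique) (simp add: algebra_simps)
  qed
  note re_simps = linear_add[OF re_linear] linear_diff[OF re_linear] linear_cmul[OF re_linear]
    linear_neg[OF re_linear] linear_0[OF re_linear]
  have re_e: "re e = 1" by (rule re_unique) (auto simp: imag_def mult_simps intro: exI[of _ 0])
  define cj where "cj x = (2 * re x) *\<^sub>R e - x" for x
  have cj_linear: "linear cj"
    by (rule linearI) (simp_all add: cj_def re_simps algebra_simps)
  note cj_simps = linear_add[OF cj_linear] linear_cmul[OF cj_linear]
  define ip where "ip x y = (re (x \<odot> cj y) + re (y \<odot> cj x)) / 2" for x y
  have norm: "\<exists>s\<ge>0. x \<odot> cj x = ((re x)\<^sup>2 + s) *\<^sub>R e \<and> (s = 0 \<longrightarrow> x = re x *\<^sub>R e)" for x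
  proof -
    obtain s where s: "s \<ge> 0" "(x - re x *\<^sub>R e) \<odot> (x - re x *\<^sub>R e) = - (s *\<^sub>R e)"
      using imagD[OF re_imag[of x]] by metis
    then have "x \<odot> cj x = ((re x)\<^sup>2 + s) *\<^sub>R e"
      by (simp add: cj_def mult_simps algebra_simps power2_eq_square scaleR_2 flip: scaleR_scaleR)
    moreover have "s = 0 \<longrightarrow> x = re x *\<^sub>R e" using s square_eq_zero[of "x - re x *\<^sub>R e"] by auto
    ultimately show ?thesis using s by blast
  qed
  have xcjx: "x \<odot> cj x = ip x x *\<^sub>R e" for x
    using norm[of x] by (auto simp: ip_def re_simps re_e)
  have form: "inner_form ip"
  proof
    show "bilinear ip"
      unfolding bilinear_def
      by (intro conjI allI linearI)
        (simp_all add: ip_def cj_simps mult_simps re_simps algebra_simps add_divide_distrib)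
    show "ip x y = ip y x" for x y by (simp add: ip_def)
    fix x :: 'a assume "x \<noteq> 0"
    obtain s where s: "s \<ge> 0" "x \<odot> cj x = ((re x)\<^sup>2 + s) *\<^sub>R e" "s = 0 \<longrightarrow> x = re x *\<^sub>R e"
      using norm by blast
    then have "ip x x = (re x)\<^sup>2 + s" using xcjx[of x] e by simp
    moreover have "(re x)\<^sup>2 + s \<noteq> 0"
      using s \<open>x \<noteq> 0\<close> by (metis add_nonneg_eq_0_iff scaleR_zero_left zero_eq_power2 zero_le_power2)
    ultimately show "0 < ip x x" using s(1) by (smt (verit) zero_le_power2)
  qed
  have ipe: "ip e x = re x" for x by (simp add: ip_def cj_def re_simps re_e mult_simps)
  have "x \<odot> x = (2 * ip e x) *\<^sub>R x - ip x x *\<^sub>R e" for x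
    using xcjx[of x] by (simp add: ipe cj_def mult_simps algebra_simps)
  from composition_of_quadratic[OF form e this] show ?thesis by blast
qed

end

section \<open>Local complexity and the natural norm of a Euclidean composition algebra\<close>

context inner_form
begin

lemma cauchy_schwarz: "(ip x y)\<^sup>2 \<le> ip x x * ip y y"
proof (cases "y = 0")
  case True
  then show ?thesis by (simp add: ip_simps)
next
  case False
  define c where "c = ip x y / ip y y"
  have "0 \<le> ip (x - c *\<^sub>R y) (x - c *\<^sub>R y) * ip y y" by simp
  also have "\<dots> = ip x x * ip y y - (ip x y)\<^sup>2"
    using False by (simp add: ip_simps ip_commute[of y x] c_def field_simps power2_eq_square)
  finally show ?thesis by simp
qed

lemma vs_norm_sqrt_ip: "vs_norm (\<lambda>x. sqrt (ip x x))"
  unfolding vs_norm_def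
proof (intro conjI allI)
  fix x y :: 'a and r :: real
  show "sqrt (ip (x + y) (x + y)) \<le> sqrt (ip x x) + sqrt (ip y y)"
  proof (rule real_le_lsqrt)
    have "ip x y \<le> sqrt (ip x x * ip y y)"
      using cauchy_schwarz[of x y] by (intro real_le_rsqrt)
    then show "ip (x + y) (x + y) \<le> (sqrt (ip x x) + sqrt (ip y y))\<^sup>2"
      by (simp add: ip_simps ip_commute[of y x] power2_sum real_sqrt_mult)
  qed simp
  show "sqrt (ip (r *\<^sub>R x) (r *\<^sub>R x)) = \<bar>r\<bar> * sqrt (ip x x)"
    by (simp add: ip_simps real_sqrt_mult flip: mult.assoc)
qed auto

end

lemma unit_of_eqI: "is_unit_element m e \<Longrightarrow> unit_of m = e"
  unfolding unit_of_def by (rule the_equality) (auto simp: is_unit_element_def, metis)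

lemma is_subalgebra_hull: "is_subalgebra m (is_subalgebra m hull S)"
  by (rule hull_in) (auto simp: is_subalgebra_def intro: subspace_Inter)

context euclidean_composition_algebra
begin

lemma unit_mult [simp]: "e \<odot> x = x" "x \<odot> e = x"
  using unit by (auto simp: is_unit_element_def)

lemma ip_unit [simp]: "ip e e = 1"
  using composition[of e e] unit_nonzero by simp

lemma composition_right: "ip (x \<odot> y) (x \<odot> z) = ip x x * ip y z"
  using composition[of x "y + z"] composition[of x y] composition[of x z]
  by (simp add: mult_simps ip_simps ip_commute[of "x \<odot> z" "x \<odot> y"] ip_commute[of z y] algebra_simps)

lemma composition_left: "ip (x \<odot> z) (y \<odot> z) = ip x y * ip z z"
  using composition[of "x + y" z] composition[of x z] composition[of y z]
  by (simp add: mult_simps ip_simps ip_commute[of "y \<odot> z" "x \<odot> z"] ip_commute[of y x] algebra_simps)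

lemma composition_exchange: "ip (x \<odot> y) (w \<odot> z) + ip (w \<odot> y) (x \<odot> z) = 2 * ip x w * ip y z"
  using composition_right[of "x + w" y z] composition_right[of x y z] composition_right[of w y z]
  by (simp add: mult_simps ip_simps ip_commute[of w x] algebra_simps)

definition conjugate :: "'a \<Rightarrow> 'a" where
  "conjugate x = (2 * ip e x) *\<^sub>R e - x"

lemma conj_linear: "linear conjugate"
  by (rule linearI) (simp_all add: conjugate_def ip_simps algebra_simps)

lemma conj_conj [simp]: "conjugate (conjugate x) = x"
  by (simp add: conjugate_def ip_simps algebra_simps)

lemma ip_conj: "ip (conjugate x) y = ip x (conjugate y)"
  by (simp add: conjugate_def ip_simps ip_commute[of x e])

lemma ip_conj_conj [simp]: "ip (conjugate x) (conjugate y) = ip x y"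
  by (simp add: ip_conj)

text \<open>The exchange identity with one factor equal to e. Adjointness turns the composition law
  into operator identities such as \<open>conj_mult_left\<close>.\<close>

lemma adjoint_left: "ip (x \<odot> y) z = ip y (conjugate x \<odot> z)"
  using composition_exchange[of x y e z]
  by (simp add: conjugate_def mult_simps ip_simps ip_commute[of x e])

lemma adjoint_right: "ip (y \<odot> x) z = ip y (z \<odot> conjugate x)"
  using composition_exchange[of y x z e]
  by (simp add: conjugate_def mult_simps ip_simps ip_commute[of x e] ip_commute[of "z \<odot> x" y] algebra_simps)

lemma conj_mult_left: "conjugate x \<odot> (x \<odot> y) = ip x x *\<^sub>R y"
proof (rule ip_ext)
  fix z
  show "ip (conjugate x \<odot> (x \<odot> y)) z = ip (ip x x *\<^sub>R y) z"
    by (simp only: adjoint_left conj_conj) (simp add: adjoint_left[symmetric] composition_right ip_simps)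
qed

lemma conj_mult_right: "(y \<odot> x) \<odot> conjugate x = ip x x *\<^sub>R y"
proof (rule ip_ext)
  fix z
  show "ip ((y \<odot> x) \<odot> conjugate x) z = ip (ip x x *\<^sub>R y) z"
    by (simp only: adjoint_right conj_conj) (simp add: adjoint_right[symmetric] composition_left ip_simps)
qed

text \<open>Polarization of \<open>conj_mult_left\<close>. For orthogonal x and y the two can be
  exchanged at the cost of a sign; the product formulas of the doubling process rest on
  this.\<close>

lemma conj_exchange_left: "x \<odot> (conjugate y \<odot> z) + y \<odot> (conjugate x \<odot> z) = (2 * ip x y) *\<^sub>R z"
  using conj_mult_left[of "conjugate (x + y)" z] conj_mult_left[of "conjugate x" z] conj_mult_left[of "conjugate y" z]
  by (simp add: linear_add[OF conj_linear] mult_simps ip_simps ip_commute[of y x] algebra_simps)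

lemma conj_exchange_right: "(z \<odot> conjugate y) \<odot> x + (z \<odot> conjugate x) \<odot> y = (2 * ip x y) *\<^sub>R z"
  using conj_mult_right[of z "conjugate (x + y)"] conj_mult_right[of z "conjugate x"] conj_mult_right[of z "conjugate y"]
  by (simp add: linear_add[OF conj_linear] mult_simps ip_simps ip_commute[of y x] algebra_simps)

lemma conj_mult: "conjugate (x \<odot> y) = conjugate y \<odot> conjugate x"
proof (rule ip_ext)
  fix z
  have "ip (conjugate (x \<odot> y)) z = ip y (conjugate x \<odot> conjugate z)"
    by (simp add: ip_conj adjoint_left)
  also have "\<dots> = ip (y \<odot> z) (conjugate x)"
    by (simp add: adjoint_right)
  also have "\<dots> = ip (conjugate y \<odot> conjugate x) z"
    by (simp add: adjoint_left ip_commute)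
  finally show "ip (conjugate (x \<odot> y)) z = ip (conjugate y \<odot> conjugate x) z" .
qed

lemma square: "x \<odot> x = (2 * ip e x) *\<^sub>R x - ip x x *\<^sub>R e"
  using conj_mult_left[of x e] by (simp add: conjugate_def mult_simps algebra_simps)

lemma unit_of_eq [simp]: "unit_of m = e"
  using unit by (rule unit_of_eqI)

lemma mult_in_plane:
  "(a *\<^sub>R e + b *\<^sub>R x) \<odot> (c *\<^sub>R e + d *\<^sub>R x)
    = (a * c - b * d * ip x x) *\<^sub>R e + (a * d + b * c + 2 * b * d * ip e x) *\<^sub>R x"
  by (simp add: mult_simps square[of x] algebra_simps)

lemma in_plane_iff: "u \<in> span {e, x} \<longleftrightarrow> (\<exists>a b. u = a *\<^sub>R e + b *\<^sub>R x)"
  by (auto simp: span_breakdown_eq span_empty algebra_simps eq_diff_eq)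

lemma is_subalgebra_plane: "is_subalgebra m (span {e, x})"
proof -
  have "u \<odot> v \<in> span {e, x}" if "u \<in> span {e, x}" "v \<in> span {e, x}" for u v
    using that unfolding in_plane_iff by (metis mult_in_plane)
  then show ?thesis by (simp add: is_subalgebra_def subspace_span)
qed

lemma unital_subalgebra_gen_subset: "unital_subalgebra_gen m x \<subseteq> span {e, x}"
  unfolding unital_subalgebra_gen_def
  by (rule hull_minimal) (auto simp: is_subalgebra_plane span_base)

lemma plane_commute:
  "u \<in> span {e, x} \<Longrightarrow> v \<in> span {e, x} \<Longrightarrow> u \<odot> v = v \<odot> u"
  unfolding in_plane_iff by (auto simp: mult_in_plane mult.commute add.commute mult.left_commute add.left_commute)

lemma plane_assoc:
  assumes "u \<in> span {e, x}" "v \<in> span {e, x}" "w \<in> span {e, x}"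
  shows "(u \<odot> v) \<odot> w = u \<odot> (v \<odot> w)"
proof -
  obtain a b c d p q where u: "u = a *\<^sub>R e + b *\<^sub>R x" and v: "v = c *\<^sub>R e + d *\<^sub>R x"
    and w: "w = p *\<^sub>R e + q *\<^sub>R x"
    using assms unfolding in_plane_iff by blast
  show ?thesis
    unfolding u v w mult_in_plane
    \<comment> \<open>The coefficients of e and of x are compared separately.\<close>
    by (rule arg_cong2[where f = "(+)"]; rule arg_cong[where f = "\<lambda>r. r *\<^sub>R _"]; simp add: algebra_simps)
qed

text \<open>Everything happens in the span of e and x, where the product is commutative and
  associative. The inverse of u is its conjugate divided by \<open>ip u u\<close>; it stays in the
  generated subalgebra because the conjugate is a combination of e and u.\<close>

lemma locally_complex: "locally_complex m"
  unfolding locally_complex_def quadratic_algebra_def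
proof (intro conjI allI)
  show "unital m" using unit by (auto simp: unital_def)
  fix x
  show "\<exists>B. finite B \<and> card B \<le> 2 \<and> unital_subalgebra_gen m x \<subseteq> span B"
    using unital_subalgebra_gen_subset[of x]
    by (intro exI[of _ "{e, x}"]) (simp add: card_insert_if)
  define S where "S = unital_subalgebra_gen m x"
  have plane: "\<And>u. u \<in> S \<Longrightarrow> u \<in> span {e, x}"
    using unital_subalgebra_gen_subset by (auto simp: S_def)
  have sub: "subspace S" and closed: "\<And>u v. u \<in> S \<Longrightarrow> v \<in> S \<Longrightarrow> u \<odot> v \<in> S"
    using is_subalgebra_hull[of m "{unit_of m, x}"]
    by (auto simp: S_def unital_subalgebra_gen_def is_subalgebra_def)
  have "e \<in> S"
    using hull_subset[of "{unit_of m, x}" "is_subalgebra m"] by (auto simp: S_def unital_subalgebra_gen_def)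
  note [simp] = ring_on_def
  have "cring (ring_on m S)"
  proof (rule cringI)
    show "abelian_group (ring_on m S)"
      by (rule abelian_groupI)
        (auto simp: subspace_add[OF sub] subspace_0[OF sub] add_ac
          intro: bexI[OF _ subspace_neg[OF sub]])
    show "comm_monoid (ring_on m S)"
      by (rule comm_monoidI) (auto simp: closed \<open>e \<in> S\<close> plane_assoc[where x = x] plane
          intro: plane_commute[OF plane plane])
  qed (simp add: mult_simps)
  then show "Ring.field (ring_on m (unital_subalgebra_gen m x))"
    unfolding S_def[symmetric]
  proof (rule cring.cring_fieldI)
    have "u \<in> Units (ring_on m S)" if u: "u \<in> S" "u \<noteq> 0" for u
    proof -
      define v where "v = (1 / ip u u) *\<^sub>R conjugate u"
      have "v \<in> S" unfolding v_def conjugate_def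
        using u \<open>e \<in> S\<close> sub by (auto intro!: subspace_scale subspace_diff)
      moreover have "v \<odot> u = e" using conj_mult_left[of u e] u by (simp add: v_def mult_simps)
      moreover have "u \<odot> v = e"
        using calculation plane_commute[OF plane[OF u(1)] plane[of v]] by simp
      ultimately show ?thesis using u by (auto simp: Units_def)
    qed
    moreover have "0 \<notin> Units (ring_on m S)"
      using unit_nonzero by (auto simp: Units_def mult_simps)
    moreover have "Units (ring_on m S) \<subseteq> S" by (auto simp: Units_def)
    ultimately show "Units (ring_on m S) = carrier (ring_on m S) - {\<zero>\<^bsub>ring_on m S\<^esub>}"
      by auto
  qed
qed

lemma sqrt_ip_mult: "sqrt (ip (x \<odot> y) (x \<odot> y)) = sqrt (ip x x) * sqrt (ip y y)"
  by (simp add: composition real_sqrt_mult)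

lemma power_norm_sqrt_ip:
  assumes "k \<ge> 1"
  shows "power_norm m (\<lambda>x. sqrt (ip x x)) k"
proof -
  have "sqrt (ip ((m x ^^ n) x) ((m x ^^ n) x)) = sqrt (ip x x) ^ Suc n" for x n
    by (induction n) (simp_all add: sqrt_ip_mult)
  from this[where n = "k - 1"] show ?thesis using assms by (simp add: power_norm_def alg_power_def)
qed

text \<open>
  On a plane through the unit element, \<open>M\<close> is equivalent to the Euclidean norm, so the sequence
  \<open>M x\<close>, \<open>M x ^ k\<close>, \<open>M x ^ (k ^ 2)\<close>, ... stays bounded away from zero and infinity when
  \<open>x\<close> is a unit vector.
\<close>

lemma power_norm_on_eq_sqrt_ip:
  assumes M: "vs_norm M" and k: "k > 1" and x: "x \<in> Y"
    and Mpow: "\<And>x. x \<in> Y \<Longrightarrow> M (alg_power m x k) = M x ^ k"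
    and Ypow: "\<And>x. x \<in> Y \<Longrightarrow> alg_power m x k \<in> Y"
    and Yscale: "\<And>r x. x \<in> Y \<Longrightarrow> r *\<^sub>R x \<in> Y"
  shows "M x = sqrt (ip x x)"
proof -
  have Mnn: "0 \<le> M x" and M0: "M x = 0 \<longleftrightarrow> x = 0" and Mtri: "M (x + y) \<le> M x + M y"
    and Mscale: "M (r *\<^sub>R x) = \<bar>r\<bar> * M x" for x y r
    using M by (auto simp: vs_norm_def)
  have "sqrt (ip (alg_power m x k) (alg_power m x k)) = sqrt (ip x x) ^ k" for x
    using power_norm_sqrt_ip[of k] k by (simp add: power_norm_def)
  then have unit_pow: "ip (alg_power m x k) (alg_power m x k) = 1" if "ip x x = 1" for x
    using that by (metis power_one real_sqrt_eq_1_iff)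
  \<comment> \<open>\<open>P\<close> and \<open>Y\<close> play different roles: the bounds hold on
    all unit vectors of \<open>P\<close>, whereas the power law is available only in
    \<open>Y\<close>. Only the orbit of x under k-th powers has to lie in both.\<close>
  have iterate_unit: "M x = 1"
    if P: "is_subalgebra m P" and x: "x \<in> P" "ip x x = 1" and xY: "x \<in> Y"
      and bounds: "0 < c" "\<And>u. u \<in> P \<Longrightarrow> ip u u = 1 \<Longrightarrow> c \<le> M u \<and> M u \<le> C" for P x c C
  proof -
    have powP: "alg_power m u k \<in> P" if "u \<in> P" for u
    proof -
      have "(m u ^^ n) u \<in> P" for n
        using P that by (induction n) (auto simp: is_subalgebra_def)
      then show ?thesis by (simp add: alg_power_def)
    qed
    have iter: "\<exists>u\<in>P \<inter> Y. ip u u = 1 \<and> M u = M x ^ (k ^ j)" for j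
    proof (induction j)
      case 0
      then show ?case using x xY by auto
    next
      case (Suc j)
      then obtain u where "u \<in> P" "u \<in> Y" "ip u u = 1" "M u = M x ^ (k ^ j)" by blast
      then show ?case using powP unit_pow Mpow Ypow
        by (intro bexI[of _ "alg_power m u k"]) (auto simp flip: power_mult simp: mult.commute)
    qed
    then have bnd: "c \<le> M x ^ (k ^ j)" "M x ^ (k ^ j) \<le> C" for j
      using bounds(2) by (metis IntD1)+
    have kj: "j \<le> k ^ j" for j
      using k less_exp[of j] power_mono[of 2 k j] by (simp add: order.trans[OF less_imp_le])
    show ?thesis
    proof (cases "M x" "1 :: real" rule: linorder_cases)
      case less
      then obtain n where "M x ^ n < c" using real_arch_pow_inv bounds(1) by blast
      moreover have "M x ^ (k ^ n) \<le> M x ^ n" using less Mnn kj by (intro power_decreasing) auto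
      ultimately show ?thesis using bnd(1)[of n] by simp
    next
      case greater
      then obtain n where "C < M x ^ n" using real_arch_pow by blast
      moreover have "M x ^ n \<le> M x ^ (k ^ n)" using greater kj by (intro power_increasing) auto
      ultimately show ?thesis using bnd(2)[of n] by simp
    qed
  qed
  have unit_plane: "M x = 1" if w: "ip e w = 0" "ip w w = 1" and x: "ip x x = 1" "x \<in> span {e, w}" "x \<in> Y" for w x
  proof -
    \<comment> \<open>Complex numbers serve as coordinates in the plane of e and w, so the minimum
      of M over the unit vectors is attained by compactness of the circle. It is positive because e
      and w are independent.\<close>
    define f where "f z = M (Re z *\<^sub>R e + Im z *\<^sub>R w)" for z
    have up: "f z \<le> (M e + M w) * cmod z" for z
    proof -
      have "f z \<le> \<bar>Re z\<bar> * M e + \<bar>Im z\<bar> * M w"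
        using Mtri[of "Re z *\<^sub>R e" "Im z *\<^sub>R w"] by (simp add: f_def Mscale)
      also have "\<dots> \<le> cmod z * M e + cmod z * M w"
        by (intro add_mono mult_right_mono abs_Re_le_cmod abs_Im_le_cmod Mnn)
      finally show ?thesis by (simp add: algebra_simps)
    qed
    have diff: "f z \<le> f z' + (M e + M w) * dist z z'" for z z'
    proof -
      have "f z \<le> f z' + f (z - z')"
        using Mtri[of "Re z' *\<^sub>R e + Im z' *\<^sub>R w" "Re (z - z') *\<^sub>R e + Im (z - z') *\<^sub>R w"]
        by (simp add: f_def algebra_simps)
      then show ?thesis using up[of "z - z'"] by (simp add: dist_norm)
    qed
    have "(M e + M w)-lipschitz_on (sphere 0 1) f"
    proof (rule lipschitz_onI)
      show "dist (f z) (f z') \<le> (M e + M w) * dist z z'" for z z'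
        using diff[of z z'] diff[of z' z] by (simp add: dist_real_def abs_le_iff dist_commute)
    qed (use Mnn in simp)
    then have "continuous_on (sphere 0 1) f" by (rule lipschitz_on_continuous_on)
    then obtain z0 where z0: "z0 \<in> sphere 0 1" "\<And>z. z \<in> sphere 0 1 \<Longrightarrow> f z0 \<le> f z"
      using continuous_attains_inf[of "sphere (0::complex) 1" f] by (auto intro!: exI[of _ 1])
    have coords: "\<exists>z\<in>sphere 0 1. M u = f z" if "u \<in> span {e, w}" "ip u u = 1" for u
    proof -
      obtain a b where u: "u = a *\<^sub>R e + b *\<^sub>R w" using \<open>u \<in> span {e, w}\<close> in_plane_iff by blast
      then have "a\<^sup>2 + b\<^sup>2 = 1" using \<open>ip u u = 1\<close> w
        by (simp add: ip_simps ip_commute[of w e] power2_eq_square)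
      then show ?thesis using u by (intro bexI[of _ "Complex a b"]) (auto simp: f_def cmod_def)
    qed
    have "f z0 \<noteq> 0"
    proof
      assume "f z0 = 0"
      then have 0: "Re z0 *\<^sub>R e + Im z0 *\<^sub>R w = 0" by (simp add: f_def M0)
      have "Re z0 = 0" using arg_cong[OF 0, of "ip e"] w by (simp add: ip_simps)
      moreover have "Im z0 = 0" using arg_cong[OF 0, of "ip w"] w by (simp add: ip_simps ip_commute[of w e])
      ultimately show False using z0(1) by (simp add: cmod_def)
    qed
    then have "0 < f z0" using Mnn by (simp add: f_def less_le)
    then show ?thesis
    proof (rule iterate_unit[OF is_subalgebra_plane x(2,1,3), where C = "M e + M w"])
      fix u assume "u \<in> span {e, w}" "ip u u = 1"
      then obtain z where z: "z \<in> sphere 0 1" "M u = f z" using coords by blast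
      then show "f z0 \<le> M u \<and> M u \<le> M e + M w"
        using z0(2)[of z] up[of z] by simp
    qed
  qed
  have unit_x: "M x = 1" if x: "ip x x = 1" and xY: "x \<in> Y" for x
  proof (cases "x = ip e x *\<^sub>R e")
    case True
    \<comment> \<open>A multiple of e determines no second direction w, and in dimension one there
      is none; the line through e is used instead of a plane.\<close>
    have eP: "is_subalgebra m (span {e})"
      using is_subalgebra_plane[of e] by simp
    have "M x = 1"
    proof (rule iterate_unit[OF eP _ x xY, where c = "M e" and C = "M e"])
      show "x \<in> span {e}" using True by (metis span_base span_scale singletonI)
      show "0 < M e" using Mnn[of e] M0[of e] unit_nonzero by linarith
      fix u assume "u \<in> span {e}" "ip u u = 1"
      then obtain r where r: "u = r *\<^sub>R e" by (auto simp: span_singleton)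
      then have "\<bar>r\<bar> = 1" using \<open>ip u u = 1\<close> by (simp add: ip_simps flip: power2_eq_square) (auto simp: power2_eq_1_iff)
      then show "M e \<le> M u \<and> M u \<le> M e" using r by (simp add: Mscale)
    qed
    then show ?thesis .
  next
    case False
    define v where "v = x - ip e x *\<^sub>R e"
    define r where "r = sqrt (ip v v)"
    have "v \<noteq> 0" using False by (simp add: v_def)
    then have r: "r > 0" "r * r = ip v v" using ip_pos by (auto simp: r_def)
    define w where "w = (1 / r) *\<^sub>R v"
    show ?thesis
    proof (rule unit_plane[of w])
      show "ip e w = 0" by (simp add: w_def v_def ip_simps)
      show "ip w w = 1" using r by (simp add: w_def ip_simps flip: r(2))
      have "x = ip e x *\<^sub>R e + r *\<^sub>R w" using r by (simp add: w_def v_def)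
      then show "x \<in> span {e, w}" using in_plane_iff by blast
    qed (rule x xY)+
  qed
  show ?thesis
  proof (cases "x = 0")
    case True
    then show ?thesis using M0 by (simp add: ip_simps)
  next
    case False
    define r where "r = sqrt (ip x x)"
    have r: "r > 0" "r * r = ip x x" using False ip_pos by (auto simp: r_def)
    have "M ((1 / r) *\<^sub>R x) = 1"
      using r x Yscale by (intro unit_x) (auto simp: ip_simps simp flip: r(2))
    then show ?thesis using r by (simp add: Mscale r_def[symmetric] field_simps)
  qed
qed

lemma power_norm_eq_sqrt_ip:
  assumes "vs_norm M" "k > 1" "power_norm m M k"
  shows "M x = sqrt (ip x x)"
  using assms by (intro power_norm_on_eq_sqrt_ip[of M k x UNIV]) (auto simp: power_norm_def)

lemma natural_norm_sqrt_ip: "natural_norm m (\<lambda>x. sqrt (ip x x))"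
proof -
  have "from_inner_product (\<lambda>x. sqrt (ip x x))"
    unfolding from_inner_product_def
    by (intro exI[of _ ip]) (auto simp: ip_bilinear ip_commute ip_pos)
  then have "natural_norm_props m (\<lambda>x. sqrt (ip x x))"
    by (simp add: natural_norm_props_def vs_norm_sqrt_ip power_norm_sqrt_ip)
  moreover have "N' = (\<lambda>x. sqrt (ip x x))" if "natural_norm_props m N'" for N'
    using that power_norm_eq_sqrt_ip[of N' 2] by (auto simp: natural_norm_props_def)
  ultimately show ?thesis unfolding natural_norm_def by blast
qed

end

section \<open>Hurwitz's theorem\<close>

definition oct_conj :: "octonion \<Rightarrow> octonion" where
  "oct_conj = cd_conj quat_conj"

text \<open>A pair of zero-divisors in the sedenions. It stops the doubling process after the
  octonions.\<close>

lemma cd_mult_octonions_zero_divisor: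
  "cd_mult oct_mult oct_conj (((\<i>, 0), (0, 0)), ((0, 1), (0, 0))) (((0, 0), (1, 0)), ((0, 0), (0, - \<i>))) = 0"
  by (simp add: cd_mult_def cd_conj_def oct_mult_def quat_mult_def quat_conj_def oct_conj_def zero_prod_def)

context euclidean_composition_algebra
begin

text \<open>Having \<open>e\<close> in the range stands in for preservation of the unit, so no unit
  of the model has to be named. The model is a Euclidean space because the orthogonal projection
  onto its image is written with \<open>Basis\<close>.\<close>

definition embedding :: "('k::euclidean_space \<Rightarrow> 'k \<Rightarrow> 'k) \<Rightarrow> ('k \<Rightarrow> 'k) \<Rightarrow> ('k \<Rightarrow> 'a) \<Rightarrow> bool" where
  "embedding mK cK f \<longleftrightarrow> linear f \<and> (\<forall>x y. f (mK x y) = f x \<odot> f y) \<and>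
     (\<forall>x. f (cK x) = conjugate (f x)) \<and> (\<forall>x. ip (f x) (f x) = (norm x)\<^sup>2) \<and> e \<in> range f"

lemma embedding_norm_mult:
  assumes "embedding mK cK f"
  shows "(norm (mK x y))\<^sup>2 = (norm x)\<^sup>2 * (norm y)\<^sup>2"
proof -
  have "f (mK x y) = f x \<odot> f y" and "\<And>z. (norm z)\<^sup>2 = ip (f z) (f z)"
    using assms by (auto simp: embedding_def)
  then show ?thesis by (simp only: composition)
qed

text \<open>Let K be the image of f. Since l is orthogonal to K and K is closed under products and
  conjugation, K l is orthogonal to K. The conjugate of l is -l, and the exchange identities then
  force the Cayley-Dickson product on K + K l.\<close>

lemma embedding_doubling:
  assumes f: "embedding mK cK f" and l: "\<And>a. ip l (f a) = 0" "ip l l = 1"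
  shows "embedding (cd_mult mK cK) (cd_conj cK) (\<lambda>(a, b). f a + f b \<odot> l)"
proof -
  have lin: "linear f" and mult: "\<And>x y. f (mK x y) = f x \<odot> f y" and cnj: "\<And>x. f (cK x) = conjugate (f x)"
    and norm: "\<And>x. ip (f x) (f x) = (norm x)\<^sup>2" and e: "e \<in> range f"
    using f by (auto simp: embedding_def)
  note f_simps = linear_add[OF lin] linear_diff[OF lin] linear_cmul[OF lin] linear_neg[OF lin] linear_0[OF lin]
  have le: "ip l e = 0" "ip e l = 0" using l e ip_commute by auto
  then have cl: "conjugate l = - l" by (simp add: conjugate_def)
  have orth: "ip (f a) l = 0" for a using l ip_commute by auto
  have orthl: "ip (f b \<odot> l) (f a) = 0" for a b
    using l(1)[of "mK (cK b) a"] by (simp add: adjoint_left mult cnj)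
  have orthr: "ip (f a) (f b \<odot> l) = 0" for a b
    using orthl ip_commute by metis
  have comm: "f b \<odot> l = l \<odot> conjugate (f b)" for b
  proof -
    have "conjugate (f b \<odot> l) = - (f b \<odot> l)"
      using orthr[of _ b] e by (auto simp: conjugate_def)
    moreover have "conjugate (f b \<odot> l) = - (l \<odot> conjugate (f b))"
      by (simp add: conj_mult cl mult_simps)
    ultimately show ?thesis by simp
  qed
  \<comment> \<open>The facts \<open>1\<close>, \<open>2\<close> and \<open>3\<close> are the three
    nontrivial parts of the Cayley-Dickson product: a (d l), (b l) c and (b l) (d l).\<close>
  have 1: "f a \<odot> (f d \<odot> l) = (f d \<odot> f a) \<odot> l" for a d
  proof -
    have "f a \<odot> (f d \<odot> l) = - (f a \<odot> (conjugate l \<odot> conjugate (f d)))"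
      by (simp add: comm cl mult_simps)
    also have "\<dots> = l \<odot> (conjugate (f a) \<odot> conjugate (f d))"
      using conj_exchange_left[of "f a" l "conjugate (f d)"] orth[of a] by (simp add: neg_eq_iff_add_eq_0 add.commute)
    also have "\<dots> = f (mK d a) \<odot> l"
      using comm[of "mK d a"] by (simp add: mult conj_mult)
    finally show ?thesis by (simp add: mult)
  qed
  have 2: "(f b \<odot> l) \<odot> f c = (f b \<odot> conjugate (f c)) \<odot> l" for b c
    using conj_exchange_right[of "f b" l "f c"] orth[of c] l(1)[of c] cl
    by (simp add: mult_simps)
  have 3: "(f b \<odot> l) \<odot> (f d \<odot> l) = - (conjugate (f d) \<odot> f b)" for b d
  proof -
    have cbl: "conjugate (f b \<odot> l) = - (f b \<odot> l)"
      using orthr[of _ b] e by (auto simp: conjugate_def)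
    have "ip (f b \<odot> l) (conjugate (f d)) = 0" using orthl[of b "cK d"] by (simp add: cnj)
    then have "(f b \<odot> l) \<odot> (f d \<odot> l) = - (conjugate (f d) \<odot> (conjugate (f b \<odot> l) \<odot> l))"
      using conj_exchange_left[of "f b \<odot> l" "conjugate (f d)" l] by (simp add: eq_neg_iff_add_eq_0)
    also have "\<dots> = - (conjugate (f d) \<odot> ((f b \<odot> l) \<odot> conjugate l))"
      by (simp add: cbl cl mult_simps)
    also have "\<dots> = - (conjugate (f d) \<odot> f b)"
      by (simp only: conj_mult_right l(2)) simp
    finally show ?thesis .
  qed
  have "linear (\<lambda>(a, b). f a + f b \<odot> l)"
    by (rule linearI) (auto simp: f_simps mult_simps algebra_simps)
  moreover have "ip (f a + f b \<odot> l) (f a + f b \<odot> l) = (norm (a, b))\<^sup>2" for a b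
    by (simp add: ip_simps orthl orthr composition norm l(2) norm_Pair)
  moreover have "conjugate (f a + f b \<odot> l) = conjugate (f a) - f b \<odot> l" for a b
  proof -
    have "conjugate (f b \<odot> l) = - (f b \<odot> l)"
      using orthr[of _ b] e by (auto simp: conjugate_def)
    then show ?thesis by (simp add: linear_add[OF conj_linear])
  qed
  moreover have "e \<in> range (\<lambda>(a, b). f a + f b \<odot> l)"
  proof -
    obtain a where "e = f a" using e by blast
    then show ?thesis by (intro image_eqI[of _ _ "(a, 0)"]) (simp_all add: f_simps mult_simps)
  qed
  ultimately show ?thesis
    by (auto simp: embedding_def cd_mult_def cd_conj_def f_simps mult_simps mult cnj 1 2 3 algebra_simps)
qed

text \<open>Subtracting from a point outside the range its orthogonal projection gives a nonzero
  normal vector. The projection exists because the range is finite-dimensional, whatever the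
  dimension of the algebra.\<close>

lemma embedding_complement:
  assumes f: "embedding mK cK f" and nsurj: "range f \<noteq> UNIV"
  obtains l where "\<And>a. ip l (f a) = 0" "ip l l = 1"
proof -
  have lin: "linear f" and norm: "\<And>x. ip (f x) (f x) = (norm x)\<^sup>2"
    using f by (auto simp: embedding_def)
  note f_simps = linear_add[OF lin] linear_cmul[OF lin] linear_sum[OF lin]
  have inner: "ip (f a) (f b) = a \<bullet> b" for a b
    using norm[of "a + b"] norm[of a] norm[of b]
    by (simp add: f_simps ip_simps ip_commute[of "f b" "f a"] inner_commute[of b a] algebra_simps
        power2_norm_eq_inner)
  obtain y where y: "y \<notin> range f" using nsurj by blast
  define p where "p = (\<Sum>b\<in>Basis. ip y (f b) *\<^sub>R b)"
  define v where "v = y - f p"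
  have vf: "ip v (f a) = 0" for a
  proof -
    have ipy: "linear (\<lambda>z. ip y z)" using ip_bilinear by (simp add: bilinear_def)
    have "ip y (f a) = ip y (f (\<Sum>b\<in>Basis. (a \<bullet> b) *\<^sub>R b))"
      by (simp add: euclidean_representation)
    also have "\<dots> = (\<Sum>b\<in>Basis. (a \<bullet> b) * ip y (f b))"
      by (simp add: f_simps linear_sum[OF ipy] ip_simps)
    also have "\<dots> = p \<bullet> a"
      by (simp add: p_def inner_sum_left inner_commute[of a] mult.commute)
    finally show ?thesis by (simp add: v_def ip_simps inner)
  qed
  have "v \<noteq> 0" using y by (auto simp: v_def)
  define r where "r = sqrt (ip v v)"
  have r: "r > 0" "r * r = ip v v" using \<open>v \<noteq> 0\<close> ip_pos by (auto simp: r_def)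
  have "ip ((1 / r) *\<^sub>R v) (f a) = 0" for a by (simp add: ip_simps vf)
  moreover have "ip ((1 / r) *\<^sub>R v) ((1 / r) *\<^sub>R v) = 1" using r by (simp add: ip_simps flip: r(2))
  ultimately show ?thesis using that by blast
qed

lemma embedding_isomorphism:
  assumes f: "embedding mK cK f" and surj: "range f = UNIV"
  shows "isometric_isomorphism m (\<lambda>x. sqrt (ip x x)) mK (inv_into UNIV f)"
proof -
  have lin: "linear f" and mult: "\<And>x y. f (mK x y) = f x \<odot> f y"
    and norm: "\<And>x. ip (f x) (f x) = (norm x)\<^sup>2"
    using f by (auto simp: embedding_def)
  have "inj f"
    by (rule linear_injective_0[OF lin, THEN iffD2]) (metis norm ip_simps(9) norm_eq_zero zero_eq_power2)
  then have "bij f" using surj by (simp add: bij_def)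
  note ff = surj_f_inv_f[OF surj] and ff' = inv_f_f[OF \<open>inj f\<close>]
  have "linear (inv_into UNIV f)"
    by (rule linearI) (metis ff ff' linear_add[OF lin] linear_cmul[OF lin])+
  moreover have "inv_into UNIV f (m x y) = mK (inv_into UNIV f x) (inv_into UNIV f y)" for x y
    by (metis ff ff' mult)
  moreover have "norm (inv_into UNIV f x) = sqrt (ip x x)" for x
    using norm[of "inv_into UNIV f x"] by (simp add: ff)
  ultimately show ?thesis
    using bij_imp_bij_inv[OF \<open>bij f\<close>] by (simp add: isometric_isomorphism_def)
qed

theorem isometric_to_RCHO: "isometric_to_RCHO m (\<lambda>x. sqrt (ip x x))"
proof -
  define f0 where "f0 r = r *\<^sub>R e" for r :: real
  have f0: "embedding (*) id f0"
    unfolding embedding_def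
  proof (intro conjI allI)
    show "linear f0" by (rule linearI) (simp_all add: f0_def algebra_simps)
    show "f0 (id x) = conjugate (f0 x)" for x
      by (simp add: f0_def conjugate_def ip_simps flip: scaleR_left_diff_distrib)
    show "e \<in> range f0" by (rule image_eqI[of _ _ 1]) (simp_all add: f0_def)
  qed (simp_all add: f0_def mult_simps ip_simps power2_eq_square)
  show ?thesis
  proof (cases "range f0 = UNIV")
    case True
    then show ?thesis using embedding_isomorphism[OF f0] by (auto simp: isometric_to_RCHO_def)
  next
    case False
    obtain l0 where l0: "\<And>a. ip l0 (f0 a) = 0" "ip l0 l0 = 1"
      using embedding_complement[OF f0 False] by blast
    define g where "g = (\<lambda>(a, b). f0 a + f0 b \<odot> l0)"
    have g: "embedding (cd_mult (*) id) (cd_conj id) g"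
      unfolding g_def by (rule embedding_doubling[OF f0 l0])
    \<comment> \<open>The doubling of the reals consists of pairs; this transports it to the type of
      complex numbers, from which the later doublings start.\<close>
    define f1 where "f1 z = g (Re z, Im z)" for z
    have g_simps: "linear g" "\<And>x y. g (cd_mult (*) id x y) = g x \<odot> g y"
        "\<And>x. g (cd_conj id x) = conjugate (g x)" "\<And>x. ip (g x) (g x) = (norm x)\<^sup>2" "e \<in> range g"
      using g by (auto simp: embedding_def)
    have f1: "embedding (*) cnj f1"
      unfolding embedding_def
    proof (intro conjI allI)
      have "linear (\<lambda>z. (Re z, Im z))" by (rule linearI) simp_all
      from linear_compose[OF this g_simps(1)] show "linear f1" by (simp add: f1_def[abs_def] o_def)
      show "f1 (x * y) = f1 x \<odot> f1 y" for x y
        by (simp add: f1_def cd_mult_def algebra_simps flip: g_simps(2))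
      show "f1 (cnj x) = conjugate (f1 x)" for x
        by (simp add: f1_def cd_conj_def flip: g_simps(3))
      show "ip (f1 x) (f1 x) = (norm x)\<^sup>2" for x
        by (simp add: f1_def g_simps(4) norm_Pair cmod_def)
      obtain a b where "e = g (a, b)" using g_simps(5) by auto
      then show "e \<in> range f1" by (intro image_eqI[of _ _ "Complex a b"]) (simp_all add: f1_def)
    qed
    show ?thesis
    proof (cases "range f1 = UNIV")
      case True
      then show ?thesis using embedding_isomorphism[OF f1] by (auto simp: isometric_to_RCHO_def)
    next
      case False
      obtain l1 where l1: "\<And>a. ip l1 (f1 a) = 0" "ip l1 l1 = 1"
        using embedding_complement[OF f1 False] by blast
      define f2 where "f2 = (\<lambda>(a, b). f1 a + f1 b \<odot> l1)"
      have f2: "embedding quat_mult quat_conj f2"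
        unfolding f2_def quat_mult_def quat_conj_def by (rule embedding_doubling[OF f1 l1])
      show ?thesis
      proof (cases "range f2 = UNIV")
        case True
        then show ?thesis using embedding_isomorphism[OF f2] by (auto simp: isometric_to_RCHO_def)
      next
        case False
        obtain l2 where l2: "\<And>a. ip l2 (f2 a) = 0" "ip l2 l2 = 1"
          using embedding_complement[OF f2 False] by blast
        define f3 where "f3 = (\<lambda>(a, b). f2 a + f2 b \<odot> l2)"
        have f3: "embedding oct_mult oct_conj f3"
          unfolding f3_def oct_mult_def oct_conj_def by (rule embedding_doubling[OF f2 l2])
        have "range f3 = UNIV"
        proof (rule ccontr)
          assume False: "range f3 \<noteq> UNIV"
          obtain l3 where l3: "\<And>a. ip l3 (f3 a) = 0" "ip l3 l3 = 1"
            using embedding_complement[OF f3 False] by blast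
          \<comment> \<open>One more doubling would embed the sedenions isometrically and make their
            Euclidean norm multiplicative.\<close>
          define f4 where "f4 = (\<lambda>(a, b). f3 a + f3 b \<odot> l3)"
          have f4: "embedding (cd_mult oct_mult oct_conj) (cd_conj oct_conj) f4"
            unfolding f4_def by (rule embedding_doubling[OF f3 l3])
          have "(norm (cd_mult oct_mult oct_conj x y))\<^sup>2 = (norm x)\<^sup>2 * (norm y)\<^sup>2" for x y
            by (rule embedding_norm_mult[OF f4])
          from this[of "(((\<i>, 0), (0, 0)), ((0, 1), (0, 0)))" "(((0, 0), (1, 0)), ((0, 0), (0, - \<i>)))"]
          show False unfolding cd_mult_octonions_zero_divisor by (simp add: norm_Pair)
        qed
        then show ?thesis using embedding_isomorphism[OF f3] by (auto simp: isometric_to_RCHO_def)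
      qed
    qed
  qed
qed

end

section \<open>Quasi-division algebras\<close>

context left_alternative_algebra
begin

lemma quasi_division_imp_domain:
  assumes "quasi_division m"
  shows "left_alternative_domain m"
proof
  fix a b assume ab: "a \<odot> b = 0" "b \<odot> a = 0"
  show "a = 0 \<or> b = 0"
  proof (cases "a = 0")
    case False
    then consider "inj (\<lambda>x. a \<odot> x)" | "inj (\<lambda>x. x \<odot> a)"
      using assms by (auto simp: quasi_division_def bij_def)
    then have "b = 0" using ab by cases (auto dest: injD[where x = b and y = 0] simp: mult_simps)
    then show ?thesis by simp
  qed simp
qed

text \<open>It suffices to find a nonzero idempotent. If some right multiplication R_b is bijective,
  the solution e of e b = b is one. Otherwise all L_a with a nonzero are bijective; then a e = a is
  solved, and the two expressions for L of e a, from linearization and from the Moufang identity,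
  combine to (L_e - 1) L_a (L_e - 1) = 0.\<close>

lemma quasi_division_unit:
  assumes qd: "quasi_division m" and nz: "\<exists>x::'a. x \<noteq> 0"
  obtains e where "is_unit_element m e" "e \<noteq> 0"
proof -
  interpret left_alternative_domain m by (rule quasi_division_imp_domain[OF qd])
  have "\<exists>e. e \<odot> e = e \<and> e \<noteq> 0"
  proof (cases "\<exists>b. b \<noteq> 0 \<and> bij (\<lambda>x. x \<odot> b)")
    case True
    then obtain b where b: "b \<noteq> 0" "bij (\<lambda>x. x \<odot> b)" by blast
    then obtain e where e: "e \<odot> b = b" by (metis bij_pointE)
    then have "(e \<odot> e) \<odot> b = e \<odot> b" by (simp add: left_alt)
    then have "e \<odot> e = e" using b(2) by (meson bij_is_inj injD)
    moreover have "e \<noteq> 0" using e b by (auto simp: mult_simps)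
    ultimately show ?thesis by blast
  next
    case False
    then have bijL: "bij (\<lambda>x. a \<odot> x)" if "a \<noteq> 0" for a
      using qd that by (auto simp: quasi_division_def)
    then have cancel: "x = y" if "a \<odot> x = a \<odot> y" "a \<noteq> 0" for a x y
      using that by (meson bij_is_inj injD)
    obtain a :: 'a where a: "a \<noteq> 0" using nz by blast
    then obtain e where e: "a \<odot> e = a" using bijL by (metis bij_pointE)
    have "e \<noteq> 0" using e a by (auto simp: mult_simps)
    have L: "(e \<odot> a) \<odot> z = a \<odot> (e \<odot> z) + e \<odot> (a \<odot> z) - a \<odot> z" for z
      using left_alt_linearized[of a e z] e by (simp add: mult_simps algebra_simps)
    have L': "(e \<odot> a) \<odot> z = e \<odot> (a \<odot> (e \<odot> z))" for z
      using left_moufang[of e a z] e by simp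
    have nan: "e \<odot> (a \<odot> (e \<odot> z - z)) = a \<odot> (e \<odot> z - z)" for z
      using L[of z] L'[of z] by (simp add: mult_simps algebra_simps)
    \<comment> \<open>Chosen so that L_k = L_a (L_e - 1) L_a, which annihilates the range of L_e -
      1. If k were nonzero, injectivity of L_k would give L_e = 1 and hence k = 0.\<close>
    define k where "k = a \<odot> (e \<odot> a - a)"
    have k: "k \<odot> z = a \<odot> (e \<odot> (a \<odot> z) - a \<odot> z)" for z
      unfolding k_def mult_simps left_moufang by (simp add: mult_simps left_alt)
    have "k = 0"
    proof (rule ccontr)
      assume "k \<noteq> 0"
      have "k \<odot> (e \<odot> z - z) = 0" for z
        unfolding k nan by (simp add: mult_simps)
      then have "e \<odot> z - z = 0" for z
        using cancel[of k "e \<odot> z - z" 0] \<open>k \<noteq> 0\<close> by (simp add: mult_simps)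
      then show False using \<open>k \<noteq> 0\<close> by (simp add: k_def mult_simps)
    qed
    then have "e \<odot> a = a" using cancel[of a "e \<odot> a" a] a by (simp add: k_def mult_simps)
    then have "a \<odot> (e \<odot> e) = a \<odot> e" using L[of e] e by simp
    then have "e \<odot> e = e" using cancel a by blast
    then show ?thesis using \<open>e \<noteq> 0\<close> by blast
  qed
  then show ?thesis using idempotent_unit that by blast
qed

text \<open>Bijectivity on one side supplies a one-sided inverse, which is two-sided by
  \<open>left_inverse_is_right_inverse\<close>. Uniqueness comes from cancelling with
  \<open>left_mult_inverse\<close>.\<close>

lemma quasi_division_imp_classical_division:
  assumes qd: "quasi_division m" and nz: "\<exists>x::'a. x \<noteq> 0"
  shows "classical_division m"
proof -
  interpret left_alternative_domain m by (rule quasi_division_imp_domain[OF qd])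
  obtain e where e: "is_unit_element m e" "e \<noteq> 0" using quasi_division_unit[OF qd nz] .
  have [simp]: "unit_of m = e" by (rule unit_of_eqI[OF e(1)])
  have "invertible_in m a" if "a \<noteq> 0" for a
  proof -
    have "bij (\<lambda>x. a \<odot> x) \<or> bij (\<lambda>x. x \<odot> a)" using qd \<open>a \<noteq> 0\<close> by (simp add: quasi_division_def)
    then have "\<exists>c. a \<odot> c = e \<or> c \<odot> a = e" by (metis bij_pointE)
    then obtain c where c: "a \<odot> c = e" "c \<odot> a = e"
      using left_inverse_is_right_inverse[OF e(1)] by blast
    have uniq: "b = c" if "a \<odot> b = e" for b
    proof -
      have "c \<odot> (a \<odot> b) = b" by (rule left_mult_inverse[OF e(1) c(2,1)])
      then show ?thesis using that e by (simp add: is_unit_element_def)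
    qed
    have "\<exists>!b. is_inverse m a b"
    proof (rule ex1I[of _ c])
      show "is_inverse m a c" using c by (simp add: is_inverse_def)
      show "b = c" if "is_inverse m a b" for b
        by (rule uniq) (use that in \<open>simp add: is_inverse_def\<close>)
    qed
    moreover have "unital m" using e unital_def by blast
    ultimately show ?thesis by (simp add: invertible_in_def)
  qed
  then show ?thesis using e by (auto simp: classical_division_def unital_def)
qed

lemma classical_division_inverse:
  assumes "classical_division m" "a \<noteq> 0"
  obtains c where "a \<odot> c = unit_of m" "c \<odot> a = unit_of m"
proof -
  have "\<exists>c. is_inverse m a c"
    using assms unfolding classical_division_def invertible_in_def by blast
  then show ?thesis using that unfolding is_inverse_def by blast
qed

lemma classical_division_unit:
  assumes "classical_division m"
  shows "is_unit_element m (unit_of m)"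
proof -
  obtain e where "is_unit_element m e" using assms by (auto simp: classical_division_def unital_def)
  then show ?thesis using unit_of_eqI by fastforce
qed

lemma classical_division_imp_quasi_division:
  assumes cd: "classical_division m"
  shows "quasi_division m"
  unfolding quasi_division_def
proof (intro allI impI disjI1)
  fix a :: 'a assume "a \<noteq> 0"
  then obtain c where c: "a \<odot> c = unit_of m" "c \<odot> a = unit_of m"
    using classical_division_inverse[OF cd] by blast
  note u = classical_division_unit[OF cd]
  show "bij (\<lambda>x. a \<odot> x)"
    by (rule o_bij[where g = "\<lambda>x. c \<odot> x"])
      (auto simp: left_mult_inverse[OF u c] left_mult_inverse[OF u c(2,1)])
qed

end

section \<open>Algebraic algebras\<close>

text \<open>Horner evaluation of p(T) v. For T = L_x and v = x it is the value of t p(t) at x, a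
  polynomial without constant term, so it makes sense before a unit is known.\<close>

definition op_poly :: "('a \<Rightarrow> 'a) \<Rightarrow> real poly \<Rightarrow> 'a::real_vector \<Rightarrow> 'a" where
  "op_poly T p v = fold_coeffs (\<lambda>a w. a *\<^sub>R v + T w) p 0"

lemma op_poly_0 [simp]: "op_poly T 0 v = 0"
  by (simp add: op_poly_def)

context
  fixes T :: "'a::real_vector \<Rightarrow> 'a"
  assumes T: "linear T"
begin

lemmas T_simps = linear_add[OF T] linear_diff[OF T] linear_cmul[OF T] linear_neg[OF T] linear_0[OF T]

lemma op_poly_pCons [simp]: "op_poly T (pCons a p) v = a *\<^sub>R v + T (op_poly T p v)"
  by (cases "p = 0 \<and> a = 0") (auto simp: op_poly_def T_simps)

lemma op_poly_add: "op_poly T (p + q) v = op_poly T p v + op_poly T q v"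
  by (induction p q rule: poly_induct2) (simp_all add: T_simps algebra_simps)

lemma op_poly_smult: "op_poly T (smult c p) v = c *\<^sub>R op_poly T p v"
  by (induction p) (simp_all add: T_simps algebra_simps)

lemma op_poly_diff: "op_poly T (p - q) v = op_poly T p v - op_poly T q v"
proof -
  have "p - q = p + smult (- 1) q" by simp
  then show ?thesis by (simp only: op_poly_add op_poly_smult) simp
qed

lemma op_poly_sum: "op_poly T (\<Sum>i\<in>A. p i) v = (\<Sum>i\<in>A. op_poly T (p i) v)"
  by (induction A rule: infinite_finite_induct) (simp_all add: op_poly_add)

lemma op_poly_monom: "op_poly T (monom c i) v = c *\<^sub>R (T ^^ i) v"
  by (induction i) (simp_all add: monom_0 monom_Suc T_simps)

lemma op_poly_commute: "T (op_poly T p v) = op_poly T p (T v)"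
  by (induction p) (simp_all add: T_simps)

lemma op_poly_mult: "op_poly T (p * q) v = op_poly T p (op_poly T q v)"
  by (induction p) (simp_all add: op_poly_add op_poly_smult)

end

lemma op_poly_complex: "op_poly ((*) z) p w = poly (map_poly of_real p) z * (w::complex)"
proof -
  have "linear ((*) z)" by (rule linearI) (simp_all add: algebra_simps)
  then show ?thesis
    by (induction p) (simp_all add: map_poly_pCons scaleR_conv_of_real algebra_simps)
qed

text \<open>A complex root z yields the factor: t - z if z is real, and (t - z) (t - cnj z)
  otherwise.\<close>

lemma real_poly_quadratic_factor:
  fixes p :: "real poly"
  assumes "degree p > 0"
  obtains r q where "p = [:- r, 1:] * q" | a b q where "p = [:a\<^sup>2 + b\<^sup>2, - 2 * a, 1:] * q"
proof -
  have "degree (map_poly of_real p :: complex poly) > 0" using assms by (simp add: degree_map_poly)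
  then have "\<not> constant (poly (map_poly of_real p :: complex poly))" by (simp add: constant_degree)
  from Fundamental_Theorem_Algebra.fundamental_theorem_of_algebra[OF this]
  obtain z :: complex where z: "poly (map_poly of_real p) z = 0" ..
  define d where "d = [:(Re z)\<^sup>2 + (Im z)\<^sup>2, - 2 * Re z, 1:]"
  have lin: "linear ((*) z)" by (rule linearI) (simp_all add: algebra_simps)
  have d: "poly (map_poly of_real d) z = 0"
    by (simp add: d_def map_poly_pCons complex_eq_iff power2_eq_square algebra_simps)
  show ?thesis
  proof (cases "Im z = 0")
    case True
    have "of_real (poly p (Re z)) = poly (map_poly of_real p) (of_real (Re z) :: complex)"
      by (induction p) (simp_all add: map_poly_pCons)
    also have "\<dots> = 0" using True z by (simp add: complex_is_Real_iff)
    finally have "[:- Re z, 1:] dvd p" by (simp add: poly_eq_0_iff_dvd)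
    then show ?thesis using that(1) by (auto elim: dvdE)
  next
    case False
    \<comment> \<open>The remainder has degree at most 1, real coefficients and the nonreal root z,
      so it is zero. Evaluation at z goes through \<open>op_poly\<close> for multiplication by z,
      whose multiplicativity has been shown.\<close>
    define r where "r = p mod d"
    have "degree d = 2" by (simp add: d_def)
    moreover have "d \<noteq> 0" by (simp add: d_def)
    ultimately have "degree r < 2"
      using degree_mod_less[of d p] by (cases "p mod d = 0") (auto simp: r_def)
    then obtain s t where r: "r = [:s, t:]"
      by (metis degree_eq_zeroE degree_pCons_eq_if less_2_cases_iff pCons_cases pCons_0_0 Suc_inject One_nat_def)
    have "op_poly ((*) z) p 1 = op_poly ((*) z) (p div d * d) 1 + op_poly ((*) z) r 1"
      by (simp add: r_def flip: op_poly_add[OF lin])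
    moreover have "op_poly ((*) z) (p div d * d) 1 = 0"
      unfolding op_poly_mult[OF lin] by (simp add: op_poly_complex d)
    ultimately have "poly (map_poly of_real r) z = 0"
      using z by (simp add: op_poly_complex)
    then have "of_real s + z * of_real t = 0" by (simp add: r map_poly_pCons)
    then have "r = 0" using False by (auto simp: complex_eq_iff r)
    then have "p = d * (p div d)" by (metis r_def add.right_neutral mult_div_mod_eq)
    then show ?thesis using that(2) unfolding d_def by blast
  qed
qed

context left_alternative_algebra
begin

text \<open>Left multiplication by a polynomial in x is that polynomial in L_x. In the induction w
  commutes with x, so the linearized left alternative law gives twice the desired identity.\<close>

lemma op_poly_mult_left: "op_poly (m x) p x \<odot> y = op_poly (m x) p (x \<odot> y)"
proof (induction p arbitrary: y)
  case 0
  then show ?case by (simp add: mult_simps)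
next
  case (pCons a p)
  note lin = linear_mult_left[of x]
  define w where "w = op_poly (m x) p x"
  have wx: "w \<odot> x = x \<odot> w"
    by (simp add: w_def pCons.IH op_poly_commute[OF lin])
  have "2 *\<^sub>R ((x \<odot> w) \<odot> y) = x \<odot> (w \<odot> y) + w \<odot> (x \<odot> y)"
    using left_alt_linearized[of x w y] by (simp add: wx mult_simps scaleR_2)
  also have "\<dots> = 2 *\<^sub>R (x \<odot> op_poly (m x) p (x \<odot> y))"
    by (simp add: w_def pCons.IH scaleR_2 flip: op_poly_commute[OF lin])
  finally show ?case
    by (simp add: op_poly_pCons[OF lin] mult_simps flip: w_def)
qed

end

context left_alternative_domain
begin

text \<open>If an annihilating polynomial p of least degree is d q with d nonconstant, then the
  values of d and q multiply to zero in both orders and the value of q is nonzero. So d annihilates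
  x already, and a real factor of degree 1 or 2 suffices.\<close>

lemma cubic_of_annihilating_poly:
  assumes "p \<noteq> 0" "op_poly (m x) p x = 0"
  shows "\<exists>\<alpha> \<beta>. x \<odot> (x \<odot> x) = (2 * \<alpha>) *\<^sub>R (x \<odot> x) - (\<alpha>\<^sup>2 + \<beta>\<^sup>2) *\<^sub>R x"
proof (cases "x = 0")
  case True
  then show ?thesis by (simp add: mult_simps)
next
  case False
  note lin = linear_mult_left[of x]
  obtain p where p: "p \<noteq> 0" "op_poly (m x) p x = 0"
    and min: "\<And>q. q \<noteq> 0 \<Longrightarrow> op_poly (m x) q x = 0 \<Longrightarrow> degree p \<le> degree q"
    using ex_has_least_nat[of "\<lambda>p. p \<noteq> 0 \<and> op_poly (m x) p x = 0" p degree] assms by blast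
  have "degree p > 0"
  proof (rule ccontr)
    assume "\<not> degree p > 0"
    then obtain c where "p = [:c:]" by (metis degree_eq_zeroE neq0_conv)
    then show False using p False by (simp add: op_poly_pCons[OF lin] mult_simps)
  qed
  have factor: "op_poly (m x) d x = 0" if pdq: "p = d * q" and "degree d > 0" for d q
  proof -
    have "d \<noteq> 0" "q \<noteq> 0" using pdq p(1) by auto
    then have "degree q < degree p" using pdq \<open>degree d > 0\<close> by (simp add: degree_mult_eq)
    then have q: "op_poly (m x) q x \<noteq> 0" using min[of q] \<open>q \<noteq> 0\<close> by auto
    have "op_poly (m x) q x \<odot> op_poly (m x) d x = x \<odot> op_poly (m x) (q * d) x"
      by (simp add: op_poly_mult_left op_poly_mult[OF lin] op_poly_commute[OF lin])
    moreover have "op_poly (m x) d x \<odot> op_poly (m x) q x = x \<odot> op_poly (m x) (d * q) x"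
      by (simp add: op_poly_mult_left op_poly_mult[OF lin] op_poly_commute[OF lin])
    ultimately show ?thesis
      using no_joint_zero_divisor q p(2) pdq by (auto simp: mult.commute mult_simps)
  qed
  from \<open>degree p > 0\<close> show ?thesis
  proof (cases rule: real_poly_quadratic_factor)
    case (1 r q)
    \<comment> \<open>A real root r counts as the double root \<alpha> = r, \<beta> = 0, since x x =
      r x makes both sides r^2 x.\<close>
    from factor[OF this] have "x \<odot> x = r *\<^sub>R x"
      by (simp add: op_poly_pCons[OF lin] mult_simps)
    then show ?thesis
      by (intro exI[of _ r] exI[of _ 0]) (simp add: mult_simps power2_eq_square algebra_simps flip: scaleR_add_left)
  next
    case (2 a b q)
    from factor[OF this] show ?thesis
      by (intro exI[of _ a] exI[of _ b]) (simp add: op_poly_pCons[OF lin] mult_simps algebra_simps)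
  qed
qed

lemma algebraic_imp_cubic:
  assumes "algebraic_algebra m"
  shows "\<exists>\<alpha> \<beta>. x \<odot> (x \<odot> x) = (2 * \<alpha>) *\<^sub>R (x \<odot> x) - (\<alpha>\<^sup>2 + \<beta>\<^sup>2) *\<^sub>R x"
proof -
  note lin = linear_mult_left[of x]
  obtain B where B: "finite B" "is_subalgebra m hull {x} \<subseteq> span B"
    using assms by (auto simp: algebraic_algebra_def)
  define H where "H = is_subalgebra m hull {x}"
  have sub: "is_subalgebra m H" unfolding H_def by (rule is_subalgebra_hull)
  have x: "x \<in> H" using hull_subset[of "{x}" "is_subalgebra m"] by (simp add: H_def)
  define f where "f i = (m x ^^ i) x" for i
  have f: "f i \<in> span B" for i
  proof -
    have "f i \<in> H"
      by (induction i) (use sub x in \<open>auto simp: f_def is_subalgebra_def\<close>)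
    then show ?thesis using B by (auto simp: H_def)
  qed
  have "\<exists>p. p \<noteq> 0 \<and> op_poly (m x) p x = 0"
  \<comment> \<open>These are card B + 1 powers in a space spanned by card B vectors. Repetitions
    are treated separately because \<open>dependent\<close> sees only the set of vectors.\<close>
  proof (cases "inj_on f {..card B}")
    case False
    then obtain i j where ij: "i \<noteq> j" "f i = f j" by (auto simp: inj_on_def)
    have "coeff (monom 1 i - monom (1::real) j) i = 1" using ij by simp
    then have "monom 1 i - monom (1::real) j \<noteq> 0" by (metis coeff_0 zero_neq_one)
    moreover have "op_poly (m x) (monom 1 i - monom 1 j) x = 0"
      using ij by (simp add: op_poly_diff[OF lin] op_poly_monom[OF lin] f_def)
    ultimately show ?thesis by blast
  next
    case True
    have "dependent (f ` {..card B})"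
      using independent_span_bound[OF B(1), of "f ` {..card B}"] f True
      by (fastforce simp: card_image)
    then obtain u where u: "\<exists>v\<in>f ` {..card B}. u v \<noteq> 0" "(\<Sum>v\<in>f ` {..card B}. u v *\<^sub>R v) = 0"
      by (auto simp: dependent_finite)
    define p where "p = (\<Sum>i\<le>card B. monom (u (f i)) i)"
    have "coeff p i = u (f i)" if "i \<le> card B" for i
      using that by (simp add: p_def coeff_sum)
    then have "p \<noteq> 0" using u(1) by auto
    moreover have "(\<Sum>i\<le>card B. u (f i) *\<^sub>R f i) = 0" using u(2) True by (simp add: sum.reindex)
    then have "op_poly (m x) p x = 0"
      by (simp add: p_def op_poly_sum[OF lin] op_poly_monom[OF lin] flip: f_def)
    ultimately show ?thesis by blast
  qed
  then show ?thesis using cubic_of_annihilating_poly by blast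
qed

end

section \<open>Normed algebras\<close>

text \<open>
  An elementary substitute for the nonemptiness of the approximate point spectrum that needs no
  completeness.  As in Rickart's proof of the Gelfand-Mazur theorem, the resolvents
  \<open>1 / (1 - z t)\<close> are averaged over the \<open>2\<^sup>j\<close>-th roots of unity: the average over the circle of
  radius \<open>r\<close> is \<open>1 / (1 - r\<^sup>N t\<^sup>N)\<close> with \<open>N = 2\<^sup>j\<close>, and it depends on \<open>r\<close>
  equicontinuously in \<open>j\<close>.  All inequalities between such fractions are stated after
  multiplication with the denominators.
\<close>

lemma poly_seminorm_not_bounded_below:
  fixes n :: "complex poly \<Rightarrow> real"
  assumes nonneg: "\<And>p. 0 \<le> n p"
    and tri: "\<And>p q. n (p + q) \<le> n p + n q"
    and scale: "\<And>r p. n ([:of_real r:] * p) = \<bar>r\<bar> * n p"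
    and cscale: "\<And>c p. n ([:c:] * p) \<le> 2 * cmod c * n p"
    and shift: "\<And>p. n ([:0, 1:] * p) \<le> K * n p" "0 \<le> K"
    and nontrivial: "0 < n 1"
    and lower: "\<And>c. \<exists>d>0. \<forall>p. d * n p \<le> n ([:- c, 1:] * p)"
  shows False
proof -
  define t where "t = [:0, 1 :: complex:]"
  have pow2: "y ^ 2 ^ Suc j = y ^ 2 ^ j * y ^ 2 ^ j" for y :: complex and j
    by (simp add: mult_2 power_add)
  have tpow2: "t ^ 2 ^ Suc j = t ^ 2 ^ j * t ^ 2 ^ j" for j
    by (simp add: mult_2 power_add)
  have two: "[:of_real 2:] = (2 :: complex poly)" by (simp add: numeral_poly)
  have minus: "n (- p) = n p" for p
    using scale[of "- 1" p] by (simp add: one_pCons[symmetric])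
  have tri': "n (p - q) \<le> n p + n q" for p q
    using tri[of p "- q"] minus[of q] by simp
  have tri2: "n p \<le> n q + n (p - q)" for p q
    using tri[of q "p - q"] by simp
  have nt: "n (t * p) \<le> K * n p" for p using shift by (simp add: t_def)
  have bounded_below: "\<exists>d>0. \<forall>p. d * n p \<le> n ((1 - [:z:] * t) * p)" for z
  proof (cases "z = 0")
    case True
    then show ?thesis by (intro exI[of _ 1]) simp
  next
    case False
    obtain d where d: "d > 0" "\<And>p. d * n p \<le> n ([:- (1 / z), 1:] * p)" using lower by blast
    have "d * cmod z / 2 * n p \<le> n ((1 - [:z:] * t) * p)" for p
    proof -
      have "[:- (1 / z), 1:] * p = [:- (1 / z):] * ((1 - [:z:] * t) * p)"
      proof -
        have "[:- (1 / z), 1:] = [:- (1 / z):] * (1 - [:z:] * t)"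
          using False by (simp add: t_def one_pCons)
        then show ?thesis by (simp only: mult.assoc)
      qed
      then have "d * n p \<le> 2 * cmod (- (1 / z)) * n ((1 - [:z:] * t) * p)"
        using d(2)[of p] cscale by (metis order_trans)
      then show ?thesis using False by (simp add: norm_divide field_simps)
    qed
    then show ?thesis using d False by (intro exI[of _ "d * cmod z / 2"]) auto
  qed
  have uniform: "\<exists>d>0. \<forall>z\<in>cball 0 B. \<forall>p. d * n p \<le> n ((1 - [:z:] * t) * p)" for B
  proof (rule ccontr)
    assume neg: "\<not> ?thesis"
    have "\<exists>z\<in>cball 0 B. \<exists>p. n ((1 - [:z:] * t) * p) < inverse (real (Suc k)) * n p" for k
      using neg[simplified] by (auto simp: not_le dest!: spec[of _ "inverse (real (Suc k))"])
    then obtain z p where zp: "\<And>k. z k \<in> cball 0 B"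
      "\<And>k. n ((1 - [:z k:] * t) * p k) < inverse (real (Suc k)) * n (p k)"
      by metis
    obtain l r where r: "strict_mono r" "(z \<circ> r) \<longlonglongrightarrow> l"
      using compact_cball[of "0 :: complex" B] zp(1) unfolding compact_def by blast
    obtain d where d: "d > 0" "\<And>p. d * n p \<le> n ((1 - [:l:] * t) * p)" using bounded_below by blast
    have "(\<lambda>k. 2 * cmod (z (r k) - l) * K + inverse (real (Suc (r k)))) \<longlonglongrightarrow> 2 * 0 * K + 0"
    proof (intro tendsto_intros)
      show "(\<lambda>k. cmod (z (r k) - l)) \<longlonglongrightarrow> 0"
        using r(2) by (simp add: tendsto_norm_zero_iff LIM_zero_iff o_def)
      show "(\<lambda>k. inverse (real (Suc (r k)))) \<longlonglongrightarrow> 0"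
        using LIMSEQ_subseq_LIMSEQ[OF LIMSEQ_inverse_real_of_nat r(1)] by (simp add: o_def)
    qed
    then have "\<forall>\<^sub>F k in sequentially. 2 * cmod (z (r k) - l) * K + inverse (real (Suc (r k))) < d"
      using d(1) by (intro order_tendstoD) simp_all
    then obtain k where k: "2 * cmod (z (r k) - l) * K + inverse (real (Suc (r k))) < d"
      by (auto simp: eventually_sequentially)
    define P where "P = p (r k)"
    define Z where "Z = z (r k)"
    have eq: "(1 - [:l:] * t) * P - (1 - [:Z:] * t) * P = [:Z - l:] * (t * P)"
    proof -
      have Zl: "[:Z - l:] = [:Z:] - [:l:]" by simp
      have "(1 - A * t) * P - (1 - B * t) * P = (B - A) * (t * P)" for A B
        by (simp add: algebra_simps)
      then show ?thesis unfolding Zl .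
    qed
    have "d * n P \<le> n ((1 - [:Z:] * t) * P) + n ([:Z - l:] * (t * P))"
      using d(2)[of P] tri2[of "(1 - [:l:] * t) * P" "(1 - [:Z:] * t) * P"] by (simp only: eq)
    also have "\<dots> \<le> inverse (real (Suc (r k))) * n P + 2 * cmod (Z - l) * (K * n P)"
    proof (rule add_mono)
      show "n ((1 - [:Z:] * t) * P) \<le> inverse (real (Suc (r k))) * n P"
        using zp(2)[of "r k"] by (simp add: P_def Z_def)
      show "n ([:Z - l:] * (t * P)) \<le> 2 * cmod (Z - l) * (K * n P)"
        using cscale[of "Z - l" "t * P"] nt[of P] by (meson mult_left_mono order_trans mult_nonneg_nonneg norm_ge_zero zero_le_numeral)
    qed
    also have "\<dots> = (2 * cmod (z (r k) - l) * K + inverse (real (Suc (r k)))) * n P"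
      by (simp add: Z_def algebra_simps)
    finally have "d * n P \<le> (2 * cmod (z (r k) - l) * K + inverse (real (Suc (r k)))) * n P" .
    moreover have "0 < n P"
      using zp(2)[of "r k"] nonneg[of "(1 - [:z (r k):] * t) * p (r k)"] nonneg[of P]
      by (cases "n P = 0") (auto simp: P_def)
    ultimately show False using k by (simp add: mult_le_cancel_right)
  qed
  obtain d0 where d0: "d0 > 0" "\<And>p. d0 * n p \<le> n (t * p)"
    using lower[of 0] by (auto simp: t_def)
  \<comment> \<open>For |z| = R the lower bound \<open>d0\<close> and the factor 2 lost in
    \<open>cscale\<close> give n (z t p) \<ge> 5 n p, hence n ((1 - z t) p) \<ge> 4 n p: resolvents
    on this circle have norm at most 1/4.\<close>
  define R where "R = 10 / d0"
  have "R > 0" using d0 by (simp add: R_def)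
  have large: "n p \<le> 1 / 4 * n ((1 - [:z:] * t) * p)" if "cmod z = R" for z p
  proof -
    have "z \<noteq> 0" using that \<open>R > 0\<close> by auto
    have "t * p = [:1 / z:] * ([:z:] * (t * p))" using \<open>z \<noteq> 0\<close> by simp
    then have "n (t * p) \<le> 2 * cmod (1 / z) * n ([:z:] * (t * p))" using cscale by metis
    also have "2 * cmod (1 / z) = d0 / 5" using that d0 by (simp add: norm_divide R_def)
    finally have "d0 * n p \<le> d0 / 5 * n ([:z:] * (t * p))" using d0(2)[of p] by linarith
    then have "5 * n p \<le> n ([:z:] * (t * p))" using d0(1) by (simp add: field_simps)
    also have "[:z:] * (t * p) = p - (1 - [:z:] * t) * p" by (simp only: algebra_simps mult_1_left)
    also have "n \<dots> \<le> n p + n ((1 - [:z:] * t) * p)" by (rule tri')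
    finally show ?thesis by simp
  qed
  have roots: "\<exists>w. w ^ 2 = z \<and> cmod w = 1" if "cmod z = 1" for z :: complex
    using that by (intro exI[of _ "csqrt z"]) simp
  \<comment> \<open>From N to 2 N by 2 / (1 - a^2 s^2) = 1 / (1 - a s) + 1 / (1 + a s), where a and
    -a belong to the two square roots of z. The constant 1/4 survives because \<open>scale\<close>
    is exact for the real factor 2.\<close>
  have largeN: "n p \<le> 1 / 4 * n ((1 - [:of_real (R ^ 2 ^ j) * z:] * t ^ 2 ^ j) * p)"
    if "cmod z = 1" for z p j
    using that
  proof (induction j arbitrary: z p)
    case 0
    then show ?case using large[of "of_real R * z" p] \<open>R > 0\<close> by (simp add: norm_mult)
  next
    case (Suc j)
    obtain w where w: "w ^ 2 = z" "cmod w = 1" using roots Suc.prems by blast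
    define s where "s = t ^ 2 ^ j"
    define a where "a = [:of_real (R ^ 2 ^ j) * w:]"
    have a2: "[:of_real (R ^ 2 ^ Suc j) * z:] * t ^ 2 ^ Suc j = (a * s) * (a * s)"
    proof -
      have "[:of_real (R ^ 2 ^ Suc j) * z:] = a * a"
        unfolding a_def w(1)[symmetric] of_real_power pow2 power2_eq_square by (simp add: mult_ac)
      moreover have "t ^ 2 ^ Suc j = s * s"
        unfolding s_def by (rule tpow2)
      ultimately show ?thesis by (simp only: mult_ac)
    qed
    have "n ((1 + a * s) * p) \<le> 1 / 4 * n ((1 - a * s) * ((1 + a * s) * p))"
      using Suc.IH[of w "(1 + a * s) * p"] w by (simp only: a_def s_def)
    moreover have "n ((1 - a * s) * p) \<le> 1 / 4 * n ((1 + a * s) * ((1 - a * s) * p))"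
    proof -
      have "1 - [:of_real (R ^ 2 ^ j) * (- w):] * s = 1 + a * s" by (simp add: a_def)
      then show ?thesis using Suc.IH[of "- w" "(1 - a * s) * p"] w by (simp only: s_def norm_minus_cancel)
    qed
    moreover have "(1 - a * s) * ((1 + a * s) * p) = (1 - (a * s) * (a * s)) * p"
      "(1 + a * s) * ((1 - a * s) * p) = (1 - (a * s) * (a * s)) * p"
      by (simp_all only: algebra_simps) simp_all
    moreover have "n ([:of_real 2:] * p) \<le> n ((1 + a * s) * p) + n ((1 - a * s) * p)"
    proof -
      have "[:of_real 2:] * p = (1 + a * s) * p + (1 - a * s) * p"
        unfolding two by (simp add: algebra_simps mult_2)
      then show ?thesis by (simp only: tri)
    qed
    ultimately show ?case unfolding a2 scale by simp
  qed
  obtain d where d: "d > 0" "\<And>z p. z \<in> cball 0 (R + 1) \<Longrightarrow> d * n p \<le> n ((1 - [:z:] * t) * p)"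
    using uniform by blast
  \<comment> \<open>In the base case of \<open>equicont\<close> the numerator costs 2 \<delta> K and
    has to be at most d^2 / 4, whence the 8; K + 1 avoids division by zero. The bound 1 keeps the
    radii up to R + \<delta> in the disc where d is valid.\<close>
  define \<delta> where "\<delta> = min 1 (d\<^sup>2 / (8 * (K + 1)))"
  have K8: "0 < 8 * (K + 1)" using \<open>0 \<le> K\<close> by simp
  have "\<delta> \<le> d\<^sup>2 / (8 * (K + 1))" by (simp add: \<delta>_def)
  then have \<delta>: "0 < \<delta>" "\<delta> \<le> 1" "\<delta> * (8 * (K + 1)) \<le> d\<^sup>2"
    using d(1) K8 by (simp_all only: pos_le_divide_eq) (simp_all add: \<delta>_def)
  \<comment> \<open>The difference of the averaged resolvents at the radii r and r', with cleared
    denominators. As for \<open>largeN\<close>, the inductive step averages the inequalities for w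
    and -w, so the constant does not depend on j.\<close>
  have equicont: "n ([:(of_real (r ^ 2 ^ j) - of_real (r' ^ 2 ^ j)) * z:] * t ^ 2 ^ j * p)
      \<le> 1 / 4 * n ((1 - [:of_real (r ^ 2 ^ j) * z:] * t ^ 2 ^ j) * (1 - [:of_real (r' ^ 2 ^ j) * z:] * t ^ 2 ^ j) * p)"
    if r: "0 \<le> r" "r \<le> R + 1" "0 \<le> r'" "r' \<le> R + 1" "\<bar>r - r'\<bar> \<le> \<delta>" and "cmod z = 1" for r r' z p j
    using \<open>cmod z = 1\<close>
  proof (induction j arbitrary: z p)
    case 0
    define a where "a = of_real r * z"
    define b where "b = of_real r' * z"
    have "a \<in> cball 0 (R + 1)" "b \<in> cball 0 (R + 1)"
      using 0 r by (simp_all add: a_def b_def norm_mult)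
    then have "d * n ((1 - [:b:] * t) * p) \<le> n ((1 - [:a:] * t) * ((1 - [:b:] * t) * p))"
      "d * n p \<le> n ((1 - [:b:] * t) * p)" using d(2) by blast+
    then have dd: "d * (d * n p) \<le> n ((1 - [:a:] * t) * (1 - [:b:] * t) * p)"
      using d(1) by (smt (verit) mult.assoc mult_left_mono)
    have "cmod ((of_real r - of_real r') * z) \<le> \<delta>"
      using 0 r(5) by (simp add: norm_mult flip: of_real_diff)
    then have "n ([:(of_real r - of_real r') * z:] * (t * p)) \<le> 2 * \<delta> * (K * n p)"
      using cscale[of "(of_real r - of_real r') * z" "t * p"] nt[of p] nonneg[of "t * p"]
      by (smt (verit) mult_mono norm_ge_zero mult_nonneg_nonneg)
    also have "\<dots> \<le> 1 / 4 * (d\<^sup>2 * n p)"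
    proof -
      have "8 * \<delta> * K \<le> d\<^sup>2" using \<delta> by (simp add: algebra_simps)
      then have "8 * \<delta> * K * n p \<le> d\<^sup>2 * n p" using nonneg by (intro mult_right_mono)
      then show ?thesis by simp
    qed
    finally show ?case using dd by (simp add: a_def b_def power2_eq_square mult.assoc)
  next
    case (Suc j)
    obtain w where w: "w ^ 2 = z" "cmod w = 1" using roots Suc.prems by blast
    define s where "s = t ^ 2 ^ j"
    define a where "a = [:of_real (r ^ 2 ^ j) * w:]"
    define b where "b = [:of_real (r' ^ 2 ^ j) * w:]"
    have sq: "[:of_real (r ^ 2 ^ Suc j) * z:] = a * a" "[:of_real (r' ^ 2 ^ Suc j) * z:] = b * b"
      unfolding a_def b_def w(1)[symmetric] of_real_power pow2 power2_eq_square by (simp_all add: mult_ac)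
    have ss: "t ^ 2 ^ Suc j = s * s"
      unfolding s_def by (rule tpow2)
    have sqd: "[:(of_real (r ^ 2 ^ Suc j) - of_real (r' ^ 2 ^ Suc j)) * z:] = a * a - b * b"
      unfolding sq[symmetric] by (simp add: algebra_simps)
    have ab: "[:(of_real (r ^ 2 ^ j) - of_real (r' ^ 2 ^ j)) * w:] = a - b"
      by (simp add: a_def b_def algebra_simps)
    define W where "W = (1 - a * a * (s * s)) * (1 - b * b * (s * s)) * p"
    have "n ((a - b) * s * ((1 + a * s) * (1 + b * s) * p))
        \<le> 1 / 4 * n ((1 - a * s) * (1 - b * s) * ((1 + a * s) * (1 + b * s) * p))"
      using Suc.IH[OF w(2), of "(1 + a * s) * (1 + b * s) * p"]
      unfolding ab by (simp only: a_def b_def s_def)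
    also have "(1 - a * s) * (1 - b * s) * ((1 + a * s) * (1 + b * s) * p) = W"
      unfolding W_def by (simp add: algebra_simps)
    finally have 1: "n ((a - b) * s * ((1 + a * s) * (1 + b * s) * p)) \<le> 1 / 4 * n W" .
    have neg: "[:(of_real (r ^ 2 ^ j) - of_real (r' ^ 2 ^ j)) * (- w):] = - (a - b)"
      "[:of_real (r ^ 2 ^ j) * (- w):] = - a" "[:of_real (r' ^ 2 ^ j) * (- w):] = - b"
      by (simp_all add: a_def b_def algebra_simps)
    have "n (- (a - b) * s * ((1 - a * s) * (1 - b * s) * p))
        \<le> 1 / 4 * n ((1 - (- a) * s) * (1 - (- b) * s) * ((1 - a * s) * (1 - b * s) * p))"
      using Suc.IH[of "- w" "(1 - a * s) * (1 - b * s) * p"] w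
      unfolding neg s_def[symmetric] by (simp only: norm_minus_cancel)
    also have "(1 - (- a) * s) * (1 - (- b) * s) * ((1 - a * s) * (1 - b * s) * p) = W"
      unfolding W_def by (simp add: algebra_simps)
    finally have 2: "n (- (a - b) * s * ((1 - a * s) * (1 - b * s) * p)) \<le> 1 / 4 * n W" .
    have "[:of_real 2:] * ((a * a - b * b) * (s * s) * p)
        = (a - b) * s * ((1 + a * s) * (1 + b * s) * p) + - (a - b) * s * ((1 - a * s) * (1 - b * s) * p)"
    proof -
      have "2 * ((A * A - B * B) * (s * s) * p)
        = (A - B) * s * ((1 + A * s) * (1 + B * s) * p) + - (A - B) * s * ((1 - A * s) * (1 - B * s) * p)" for A B
        by (simp add: algebra_simps)
      then show ?thesis unfolding two .
    qed
    then have "n ([:of_real 2:] * ((a * a - b * b) * (s * s) * p)) \<le> 1 / 4 * n W + 1 / 4 * n W"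
      using 1 2 tri by (smt (verit))
    then have "n ((a * a - b * b) * (s * s) * p) \<le> 1 / 4 * n W" by (simp only: scale)
    then show ?case unfolding sqd sq ss W_def .
  qed
  \<comment> \<open>The powers of r t with exponents 2^j tend to zero in operator norm. This holds
    for small r by the bound K; it is pushed outward in steps of fixed length until r reaches R,
    where it contradicts \<open>largeN\<close>.\<close>
  define small where "small r \<longleftrightarrow> (\<forall>\<epsilon>>0. \<exists>j0. \<forall>j\<ge>j0. \<forall>p. r ^ 2 ^ j * n (t ^ 2 ^ j * p) \<le> \<epsilon> * n p)" for r
  have pow_small: "\<exists>j0. \<forall>j\<ge>j0. q ^ 2 ^ j \<le> \<epsilon>" if "0 \<le> q" "q < 1" "\<epsilon> > 0" for q \<epsilon> :: real
  proof -
    obtain k where k: "q ^ k < \<epsilon>" using real_arch_pow_inv[OF \<open>\<epsilon> > 0\<close> \<open>q < 1\<close>] by blast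
    have "q ^ 2 ^ j \<le> \<epsilon>" if "j \<ge> k" for j
    proof -
      have "k \<le> 2 ^ j" using that less_exp[where ?n = j] by (meson less_imp_le order_trans)
      then have "q ^ 2 ^ j \<le> q ^ k" using \<open>0 \<le> q\<close> \<open>q < 1\<close> by (intro power_decreasing) auto
      then show ?thesis using k by simp
    qed
    then show ?thesis by blast
  qed
  have small_start: "small (1 / (2 * (K + 1)))"
    unfolding small_def
  proof (intro allI impI)
    fix \<epsilon> :: real assume "\<epsilon> > 0"
    have tN: "n (t ^ N * p) \<le> K ^ N * n p" for N p
    proof (induction N)
      case (Suc N)
      have "n (t ^ Suc N * p) \<le> K * n (t ^ N * p)" using nt[of "t ^ N * p"] by (simp add: mult.assoc)
      also have "\<dots> \<le> K * (K ^ N * n p)" using Suc \<open>0 \<le> K\<close> by (intro mult_left_mono)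
      finally show ?case by (simp add: mult.assoc)
    qed simp
    have bound: "(1 / (2 * (K + 1))) ^ N * n (t ^ N * p) \<le> (1 / 2) ^ N * n p" for N p
    proof -
      have "(1 / (2 * (K + 1))) ^ N * n (t ^ N * p) \<le> (1 / (2 * (K + 1))) ^ N * (K ^ N * n p)"
        using tN \<open>0 \<le> K\<close> by (intro mult_left_mono) auto
      also have "\<dots> = (1 / (2 * (K + 1)) * K) ^ N * n p" by (simp only: power_mult_distrib mult.assoc)
      also have "\<dots> \<le> (1 / 2) ^ N * n p"
        using \<open>0 \<le> K\<close> nonneg by (intro mult_right_mono power_mono) (auto simp: field_simps)
      finally show ?thesis .
    qed
    obtain j0 where "\<And>j. j \<ge> j0 \<Longrightarrow> (1 / 2 :: real) ^ 2 ^ j \<le> \<epsilon>"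
      using pow_small[of "1 / 2" \<epsilon>] \<open>\<epsilon> > 0\<close> by auto
    then show "\<exists>j0. \<forall>j\<ge>j0. \<forall>p. (1 / (2 * (K + 1))) ^ 2 ^ j * n (t ^ 2 ^ j * p) \<le> \<epsilon> * n p"
      using bound nonneg by (meson order_trans mult_right_mono)
  qed
  have small_step: "small (r + \<delta> / 2)" if r: "0 \<le> r" "r \<le> R" and "small r" for r
    unfolding small_def
  proof (intro allI impI)
    fix \<epsilon> :: real assume "\<epsilon> > 0"
    define r' where "r' = r + \<delta>"
    obtain j0 where j0: "\<And>j p. j \<ge> j0 \<Longrightarrow> r ^ 2 ^ j * n (t ^ 2 ^ j * p) \<le> 1 / 10 * n p"
      using \<open>small r\<close> unfolding small_def by (metis zero_less_divide_1_iff zero_less_numeral)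
    have bound: "r' ^ 2 ^ j * n (t ^ 2 ^ j * p) \<le> 3 * n p" if "j \<ge> j0" for j p
    proof -
      define s where "s = t ^ 2 ^ j"
      define a where "a = [:complex_of_real (r ^ 2 ^ j):]"
      define b where "b = [:complex_of_real (r' ^ 2 ^ j):]"
      have a: "n (a * (s * q)) \<le> 1 / 10 * n q" for q
        using j0[OF that, of q] r by (simp only: a_def s_def scale) simp
      have ab: "[:of_real (r ^ 2 ^ j) - of_real (r' ^ 2 ^ j):] = a - b" by (simp add: a_def b_def)
      have r'_range: "0 \<le> r" "r \<le> R + 1" "0 \<le> r'" "r' \<le> R + 1" "\<bar>r - r'\<bar> \<le> \<delta>"
        using r \<delta> by (auto simp: r'_def)
      \<comment> \<open>Equicontinuity bounds the difference term by 1/4 n ((1 - a s) y), at most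
        11/40 n y as a s has norm at most 1/10. This is absorbed into n y and leaves n y \<le> 2 n
        p, so b s is bounded by 3 at radius r + \<delta>. Going back to r + \<delta> / 2 turns
        boundedness into decay.\<close>
      define y where "y = (1 - b * s) * p"
      have "n ((a - b) * s * p) \<le> 1 / 4 * n ((1 - a * s) * (1 - b * s) * p)"
        using equicont[of r r' 1 j p] r'_range
        by (simp only: mult_1_right ab a_def[symmetric] b_def[symmetric] s_def[symmetric]) simp
      also have "(1 - a * s) * (1 - b * s) * p = y - a * (s * y)" unfolding y_def by (simp add: algebra_simps)
      also have "1 / 4 * n (y - a * (s * y)) \<le> 1 / 4 * (11 / 10 * n y)"
        using tri'[of y "a * (s * y)"] a[of y] by simp
      finally have "n ((a - b) * s * p) \<le> 11 / 40 * n y" by simp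
      moreover have "y = p - a * (s * p) + (a - b) * s * p" unfolding y_def by (simp add: algebra_simps)
      then have "n y \<le> n p + n (a * (s * p)) + n ((a - b) * s * p)"
        using tri[of "p - a * (s * p)" "(a - b) * s * p"] tri'[of p "a * (s * p)"] by simp
      ultimately have "n y \<le> 2 * n p" using a[of p] nonneg[of p] by linarith
      moreover have "b * (s * p) = p - y" unfolding y_def by (simp add: algebra_simps)
      then have "n (b * (s * p)) \<le> n p + n y" using tri' by simp
      ultimately have "n (b * (s * p)) \<le> 3 * n p" by linarith
      moreover have "n (b * (s * p)) = r' ^ 2 ^ j * n (s * p)"
        using r \<delta> by (simp only: b_def scale) (simp add: r'_def)
      ultimately show ?thesis by (simp add: s_def)
    qed
    have r': "r' > 0" "0 \<le> (r + \<delta> / 2) / r'" "(r + \<delta> / 2) / r' < 1" using r \<delta> by (auto simp: r'_def)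
    obtain j1 where j1: "\<And>j. j \<ge> j1 \<Longrightarrow> ((r + \<delta> / 2) / r') ^ 2 ^ j \<le> \<epsilon> / 3"
      using pow_small[OF r'(2,3), of "\<epsilon> / 3"] \<open>\<epsilon> > 0\<close> by auto
    have "(r + \<delta> / 2) ^ 2 ^ j * n (t ^ 2 ^ j * p) \<le> \<epsilon> * n p" if "j \<ge> max j0 j1" for j p
    proof -
      have "(r + \<delta> / 2) ^ 2 ^ j * n (t ^ 2 ^ j * p)
          = ((r + \<delta> / 2) / r') ^ 2 ^ j * (r' ^ 2 ^ j * n (t ^ 2 ^ j * p))"
        using r' by (simp add: power_divide)
      also have "\<dots> \<le> (\<epsilon> / 3) * (3 * n p)"
        by (rule mult_mono[OF j1 bound]) (use that r' nonneg \<open>\<epsilon> > 0\<close> in auto)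
      finally show ?thesis by simp
    qed
    then show "\<exists>j0. \<forall>j\<ge>j0. \<forall>p. (r + \<delta> / 2) ^ 2 ^ j * n (t ^ 2 ^ j * p) \<le> \<epsilon> * n p" by blast
  qed
  have "\<exists>r\<ge>R. small r"
  proof (rule ccontr)
    assume *: "\<not> (\<exists>r\<ge>R. small r)"
    have "small (1 / (2 * (K + 1)) + real k * (\<delta> / 2))" for k
    proof (induction k)
      case 0
      then show ?case using small_start by simp
    next
      case (Suc k)
      then have "1 / (2 * (K + 1)) + real k * (\<delta> / 2) \<le> R" using * by (meson linear)
      moreover have "0 \<le> 1 / (2 * (K + 1)) + real k * (\<delta> / 2)" using \<open>0 \<le> K\<close> \<delta> by simp
      ultimately have "small (1 / (2 * (K + 1)) + real k * (\<delta> / 2) + \<delta> / 2)"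
        using small_step Suc by blast
      moreover have "1 / (2 * (K + 1)) + real k * (\<delta> / 2) + \<delta> / 2
          = 1 / (2 * (K + 1)) + real (Suc k) * (\<delta> / 2)"
        by (simp only: of_nat_Suc distrib_right mult_1_left add_ac)
      ultimately show ?case by (simp only:)
    qed
    moreover obtain k where "R < real k * (\<delta> / 2)"
      using ex_less_of_nat_mult[of "\<delta> / 2" R] \<delta> by auto
    moreover have "0 \<le> 1 / (2 * (K + 1))" using \<open>0 \<le> K\<close> by simp
    ultimately show False using * by (metis add_increasing less_imp_le)
  qed
  then obtain r where r: "r \<ge> R" "small r" by blast
  obtain j where j: "\<And>p. r ^ 2 ^ j * n (t ^ 2 ^ j * p) \<le> 1 * n p"
    using r(2) unfolding small_def by (metis order_refl zero_less_one)
  have "R ^ 2 ^ j * n (t ^ 2 ^ j * 1) \<le> r ^ 2 ^ j * n (t ^ 2 ^ j * 1)"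
    using r \<open>R > 0\<close> nonneg by (intro mult_right_mono power_mono) auto
  also have "\<dots> \<le> n 1" using j[of 1] by simp
  finally have "n ([:of_real (R ^ 2 ^ j):] * (t ^ 2 ^ j * 1)) \<le> n 1"
    using \<open>R > 0\<close> by (simp only: scale) simp
  \<comment> \<open>At radius R the resolvent average has norm at most 1/4, yet n of R^N t^N is at
    most n 1; together n 1 \<le> 1/2 n 1.\<close>
  moreover have "n 1 \<le> 1 / 4 * n (1 - [:of_real (R ^ 2 ^ j):] * (t ^ 2 ^ j * 1))"
    using largeN[of 1 1 j] by (simp add: algebra_simps)
  ultimately show False
    using tri'[of 1 "[:of_real (R ^ 2 ^ j):] * (t ^ 2 ^ j * 1)"] nontrivial by linarith
qed

section \<open>Norms with bounded multiplications, and the cubic relation they imply\<close>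

locale normed_space =
  fixes M :: "'a::real_vector \<Rightarrow> real"
  assumes vs_norm: "vs_norm M"
begin

lemma norm_nonneg [simp]: "0 \<le> M x" and norm_eq_zero_iff [simp]: "M x = 0 \<longleftrightarrow> x = 0"
  and norm_triangle: "M (x + y) \<le> M x + M y" and norm_scale: "M (r *\<^sub>R x) = \<bar>r\<bar> * M x"
  using vs_norm by (auto simp: vs_norm_def)

lemma norm_zero [simp]: "M 0 = 0"
  by simp

lemma norm_minus [simp]: "M (- x) = M x"
  using norm_scale[of "- 1" x] by simp

lemma norm_triangle_diff: "M (x - y) \<le> M x + M y"
  using norm_triangle[of x "- y"] by simp

lemma norm_pos_iff: "0 < M x \<longleftrightarrow> x \<noteq> 0"
  using norm_nonneg[of x] norm_eq_zero_iff[of x] by linarith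

lemma Metric_space_norm: "Metric_space UNIV (\<lambda>x y. M (x - y))"
proof
  show "M (x - y) = M (y - x)" for x y using norm_minus[of "x - y"] by simp
  show "M (x - z) \<le> M (x - y) + M (y - z)" for x y z
    using norm_triangle[of "x - y" "y - z"] by simp
qed auto

lemma continuous_linear_bounded:
  assumes g: "linear g" and cont: "continuous_map (norm_topology M) (norm_topology M) g"
  shows "\<exists>K\<ge>0. \<forall>x. M (g x) \<le> K * M x"
proof -
  interpret Metric_space UNIV "\<lambda>x y. M (x - y)" by (rule Metric_space_norm)
  have "openin mtopology {x \<in> topspace mtopology. g x \<in> mball 0 1}"
    using cont openin_mball[of 0 1] unfolding norm_topology_def continuous_map_def by blast
  moreover have "0 \<in> {x \<in> topspace mtopology. g x \<in> mball 0 1}"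
    using linear_0[OF g] by simp
  ultimately obtain r where r: "r > 0" "mball 0 r \<subseteq> {x \<in> topspace mtopology. g x \<in> mball 0 1}"
    unfolding openin_mtopology by blast
  then have small: "M (g y) < 1" if "M y < r" for y
    using that by (auto simp: subset_iff)
  have "M (g x) \<le> 2 / r * M x" for x
  proof (cases "x = 0")
    case True
    then show ?thesis using linear_0[OF g] by simp
  next
    case False
    then have pos: "M x > 0" using norm_pos_iff by blast
    define c where "c = r / (2 * M x)"
    have "c > 0" using pos r by (simp add: c_def)
    have "M (c *\<^sub>R x) < r" using pos r \<open>c > 0\<close> by (simp add: norm_scale) (simp add: c_def)
    then have "M (g (c *\<^sub>R x)) < 1" by (rule small)
    then have "c * M (g x) < 1" using \<open>c > 0\<close> by (simp add: linear_cmul[OF g] norm_scale)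
    then show ?thesis using pos r by (simp add: c_def field_simps)
  qed
  then show ?thesis using r by (intro exI[of _ "2 / r"]) auto
qed

end

locale left_bounded_algebra = left_alternative_algebra m + normed_space M
  for m :: "'a::real_vector \<Rightarrow> 'a \<Rightarrow> 'a" (infixl "\<odot>" 70) and M +
  assumes left_bounded: "\<exists>K\<ge>0. \<forall>x. M (a \<odot> x) \<le> K * M x"
begin

lemma no_joint_top_zero_divisor_imp_domain:
  assumes "\<And>a. joint_top_zero_divisor m M a \<Longrightarrow> a = 0"
  shows "left_alternative_domain m"
proof
  fix a b assume ab: "a \<odot> b = 0" "b \<odot> a = 0"
  have "joint_top_zero_divisor m M a" if "b \<noteq> 0"
    unfolding joint_top_zero_divisor_def
  proof (intro exI[of _ "\<lambda>_. (1 / M b) *\<^sub>R b"] conjI allI)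
    show "M ((1 / M b) *\<^sub>R b) = 1" using that norm_pos_iff[of b] by (simp add: norm_scale)
  qed (simp_all add: mult_simps ab)
  then show "a = 0 \<or> b = 0" using assms by blast
qed

text \<open>Vectors violating the estimate for d = 1, 1/2, 1/3, ... become, after normalization, a
  sequence witnessing a joint topological zero-divisor.\<close>

lemma bounded_below_of_not_joint_top_zero_divisor:
  assumes "\<not> joint_top_zero_divisor m M a"
  shows "\<exists>d>0. \<forall>b. d * M b \<le> M (a \<odot> b) + M (b \<odot> a)"
proof (rule ccontr)
  assume neg: "\<not> ?thesis"
  have "\<exists>b. M (a \<odot> b) + M (b \<odot> a) < inverse (real (Suc k)) * M b" for k
    using neg[simplified] by (auto simp: not_le dest!: spec[of _ "inverse (real (Suc k))"])
  then obtain b where b: "\<And>k. M (a \<odot> b k) + M (b k \<odot> a) < inverse (real (Suc k)) * M (b k)"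
    by metis
  have pos: "0 < M (b k)" for k
  proof -
    have "0 < inverse (real (Suc k)) * M (b k)"
      using b[of k] norm_nonneg[of "a \<odot> b k"] norm_nonneg[of "b k \<odot> a"] by linarith
    then show ?thesis by (rule zero_less_mult_pos) simp
  qed
  define c where "c k = (1 / M (b k)) *\<^sub>R b k" for k
  have c1: "M (c k) = 1" for k using pos[of k] by (simp add: c_def norm_scale norm_pos_iff)
  have small: "M (a \<odot> c k) + M (c k \<odot> a) \<le> inverse (real (Suc k))" for k
  proof -
    have "M (a \<odot> c k) + M (c k \<odot> a) = (M (a \<odot> b k) + M (b k \<odot> a)) / M (b k)"
      using pos[of k] by (simp add: c_def mult_simps norm_scale add_divide_distrib)
    then show ?thesis using less_imp_le[OF b[of k]] by (simp only: pos_divide_le_eq[OF pos])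
  qed
  have small': "M (a \<odot> c k) \<le> inverse (real (Suc k))" "M (c k \<odot> a) \<le> inverse (real (Suc k))" for k
    using small[of k] norm_nonneg[of "a \<odot> c k"] norm_nonneg[of "c k \<odot> a"] by linarith+
  have "(\<lambda>k. M (a \<odot> c k)) \<longlonglongrightarrow> 0"
    by (rule tendsto_sandwich[OF _ _ tendsto_const LIMSEQ_inverse_real_of_nat])
      (simp_all del: of_nat_Suc add: small')
  moreover have "(\<lambda>k. M (c k \<odot> a)) \<longlonglongrightarrow> 0"
    by (rule tendsto_sandwich[OF _ _ tendsto_const LIMSEQ_inverse_real_of_nat])
      (simp_all del: of_nat_Suc add: small')
  ultimately show False using assms c1 unfolding joint_top_zero_divisor_def by blast
qed

text \<open>The inverse c of a acts by the bounded operator L_c, which undoes L_a, so a b_k cannot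
  tend to zero for unit vectors b_k.\<close>

lemma classical_division_no_joint_top_zero_divisor:
  assumes cd: "classical_division m" and jt: "joint_top_zero_divisor m M a"
  shows "a = 0"
proof (rule ccontr)
  assume "a \<noteq> 0"
  then obtain c where c: "a \<odot> c = unit_of m" "c \<odot> a = unit_of m"
    using classical_division_inverse[OF cd] by blast
  have inv: "c \<odot> (a \<odot> z) = z" for z
    by (rule left_mult_inverse[OF classical_division_unit[OF cd] c(2,1)])
  obtain K where K: "\<And>x. M (c \<odot> x) \<le> K * M x" using left_bounded by blast
  obtain b where b: "\<And>k. M (b k) = 1" "(\<lambda>k. M (a \<odot> b k)) \<longlonglongrightarrow> 0"
    using jt unfolding joint_top_zero_divisor_def by blast
  have "(\<lambda>k. K * M (a \<odot> b k)) \<longlonglongrightarrow> K * 0" by (intro tendsto_intros b)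
  moreover have "1 \<le> K * M (a \<odot> b k)" for k using K[of "a \<odot> b k"] inv b(1) by simp
  ultimately have "1 \<le> K * 0" by (intro LIMSEQ_le_const) auto
  then show False by simp
qed

text \<open>If the relation fails for x, then for every complex c the value a of t (t - c) (t - cnj
  c) at x is nonzero and hence no joint topological zero-divisor. So multiplication by (t - c) (t -
  cnj c) is bounded below on polynomials in x, and since t - cnj c is bounded above, t - c is
  bounded below. \<open>poly_seminorm_not_bounded_below\<close> excludes this for all c at
  once.\<close>

lemma no_joint_top_zero_divisor_imp_cubic:
  assumes njt: "\<And>a. joint_top_zero_divisor m M a \<Longrightarrow> a = 0"
  shows "\<exists>\<alpha> \<beta>. x \<odot> (x \<odot> x) = (2 * \<alpha>) *\<^sub>R (x \<odot> x) - (\<alpha>\<^sup>2 + \<beta>\<^sup>2) *\<^sub>R x"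
proof (rule ccontr)
  assume neg: "\<not> ?thesis"
  note lin = linear_mult_left[of x]
  have "x \<noteq> 0" using neg by (auto simp: mult_simps)
  obtain K where K: "0 \<le> K" "\<And>y. M (x \<odot> y) \<le> K * M y" using left_bounded by blast
  define ev where "ev p = op_poly (m x) p x" for p
  \<comment> \<open>A norm of the value in the complexification that is homogeneous only for real
    scalars; |Re c| + |Im c| \<le> 2 |c| explains the factor 2 in \<open>cscale\<close>.\<close>
  define n where "n P = M (ev (map_poly Re P)) + M (ev (map_poly Im P))" for P
  have ev_simps: "ev (p + q) = ev p + ev q" "ev (p - q) = ev p - ev q" "ev (smult r p) = r *\<^sub>R ev p"
    "ev (pCons r p) = r *\<^sub>R x + x \<odot> ev p" for p q r
    by (simp_all add: ev_def op_poly_add[OF lin] op_poly_diff[OF lin] op_poly_smult[OF lin]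
        op_poly_pCons[OF lin])
  have Re_add: "map_poly Re (P + Q) = map_poly Re P + map_poly Re Q"
    and Im_add: "map_poly Im (P + Q) = map_poly Im P + map_poly Im Q" for P Q
    by (auto intro!: poly_eqI simp: coeff_map_poly)
  have Re_smult: "map_poly Re (smult c P) = smult (Re c) (map_poly Re P) - smult (Im c) (map_poly Im P)"
    and Im_smult: "map_poly Im (smult c P) = smult (Re c) (map_poly Im P) + smult (Im c) (map_poly Re P)" for c P
    by (auto intro!: poly_eqI simp: coeff_map_poly)
  have Re_pCons: "map_poly Re (pCons c P) = pCons (Re c) (map_poly Re P)"
    and Im_pCons: "map_poly Im (pCons c P) = pCons (Im c) (map_poly Im P)" for c P
    by (simp_all add: map_poly_pCons)
  have nonneg: "0 \<le> n P" for P by (simp add: n_def)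
  have tri: "n (P + Q) \<le> n P + n Q" for P Q
    unfolding n_def Re_add Im_add ev_simps by (smt (verit) norm_triangle)
  have scale: "n ([:of_real r:] * P) = \<bar>r\<bar> * n P" for r P
    by (simp add: n_def Re_smult Im_smult ev_simps norm_scale algebra_simps)
  have cscale: "n ([:c:] * P) \<le> 2 * cmod c * n P" for c P
  proof -
    define A where "A = ev (map_poly Re P)"
    define B where "B = ev (map_poly Im P)"
    have "n ([:c:] * P) = M (Re c *\<^sub>R A - Im c *\<^sub>R B) + M (Re c *\<^sub>R B + Im c *\<^sub>R A)"
      by (simp add: n_def Re_smult Im_smult ev_simps A_def B_def)
    also have "\<dots> \<le> (\<bar>Re c\<bar> * M A + \<bar>Im c\<bar> * M B) + (\<bar>Re c\<bar> * M B + \<bar>Im c\<bar> * M A)"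
      using norm_triangle_diff[of "Re c *\<^sub>R A" "Im c *\<^sub>R B"] norm_triangle[of "Re c *\<^sub>R B" "Im c *\<^sub>R A"]
      by (simp add: norm_scale)
    also have "\<dots> = (\<bar>Re c\<bar> + \<bar>Im c\<bar>) * (M A + M B)" by (simp add: algebra_simps)
    also have "\<dots> \<le> (2 * cmod c) * (M A + M B)"
      using abs_Re_le_cmod[of c] abs_Im_le_cmod[of c] by (intro mult_right_mono) auto
    finally show ?thesis by (simp add: n_def A_def B_def)
  qed
  have shift: "n ([:0, 1:] * P) \<le> K * n P" for P
    using K(2)[of "ev (map_poly Re P)"] K(2)[of "ev (map_poly Im P)"]
    by (simp add: n_def Re_pCons Im_pCons ev_simps algebra_simps)
  have "n 1 = M x" by (simp add: n_def one_pCons Re_pCons Im_pCons ev_simps mult_simps) (simp add: ev_def mult_simps)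
  then have nontrivial: "0 < n 1" using \<open>x \<noteq> 0\<close> norm_pos_iff by simp
  have lower: "\<exists>d>0. \<forall>P. d * n P \<le> n ([:- c, 1:] * P)" for c
  proof -
    define N where "N = (Re c)\<^sup>2 + (Im c)\<^sup>2"
    define q where "q = [:N, - 2 * Re c, 1:]"
    define a where "a = ev q"
    have "a = N *\<^sub>R x - (2 * Re c) *\<^sub>R (x \<odot> x) + x \<odot> (x \<odot> x)"
      by (simp add: a_def q_def ev_simps mult_simps) (simp add: ev_def mult_simps)
    then have "a = x \<odot> (x \<odot> x) - ((2 * Re c) *\<^sub>R (x \<odot> x) - N *\<^sub>R x)" by simp
    moreover have "x \<odot> (x \<odot> x) \<noteq> (2 * Re c) *\<^sub>R (x \<odot> x) - N *\<^sub>R x"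
      using neg unfolding N_def by blast
    ultimately have "a \<noteq> 0" by simp
    then obtain d where d: "d > 0" "\<And>b. d * M b \<le> M (a \<odot> b) + M (b \<odot> a)"
      using bounded_below_of_not_joint_top_zero_divisor njt by blast
    \<comment> \<open>Values of polynomials commute, so the left and the right product in the lower
      bound for a coincide and one estimate controls both.\<close>
    have prod: "ev p \<odot> ev r = x \<odot> ev (p * r)" for p r
      by (simp add: ev_def op_poly_mult_left op_poly_mult[OF lin] op_poly_commute[OF lin])
    have bound: "d * M (ev p) \<le> 2 * K * M (ev (q * p))" for p
    proof -
      have "d * M (ev p) \<le> 2 * M (x \<odot> ev (q * p))"
        using d(2)[of "ev p"] unfolding a_def prod by (simp add: mult.commute)
      also have "\<dots> \<le> 2 * (K * M (ev (q * p)))" using K(2) by simp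
      finally show ?thesis by simp
    qed
    have nq: "d * n P \<le> 2 * K * n ([:- cnj c, 1:] * ([:- c, 1:] * P))" for P
    proof -
      have eq: "[:- cnj c, 1:] * ([:- c, 1:] * P)
          = smult (of_real N) P + (pCons 0 (smult (of_real (- 2 * Re c)) P) + pCons 0 (pCons 0 P))"
      proof -
        have "[:- cnj c, 1:] * [:- c, 1:] = [:of_real N, of_real (- 2 * Re c), 1:]"
          by (simp add: N_def complex_eq_iff power2_eq_square)
        then have "[:- cnj c, 1:] * ([:- c, 1:] * P) = [:of_real N, of_real (- 2 * Re c), 1:] * P"
          by (simp only: mult.assoc[symmetric])
        then show ?thesis by simp
      qed
      have qp: "q * p = smult N p + (pCons 0 (smult (- 2 * Re c) p) + pCons 0 (pCons 0 p))" for p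
        by (simp add: q_def)
      have "map_poly Re ([:- cnj c, 1:] * ([:- c, 1:] * P)) = q * map_poly Re P"
        "map_poly Im ([:- cnj c, 1:] * ([:- c, 1:] * P)) = q * map_poly Im P"
        unfolding eq qp Re_add Im_add Re_pCons Im_pCons Re_smult Im_smult by simp_all
      then show ?thesis
        using bound[of "map_poly Re P"] bound[of "map_poly Im P"] by (simp add: n_def algebra_simps)
    qed
    have lin_bound: "n ([:- cnj c, 1:] * Q) \<le> (2 * cmod c + K) * n Q" for Q
    proof -
      have "[:- cnj c, 1:] * Q = [:- cnj c:] * Q + [:0, 1:] * Q" by simp
      then have "n ([:- cnj c, 1:] * Q) \<le> n ([:- cnj c:] * Q) + n ([:0, 1:] * Q)"
        using tri by metis
      then show ?thesis using cscale[of "- cnj c" Q] shift[of Q] by (simp add: algebra_simps)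
    qed
    define L where "L = 2 * K * (2 * cmod c + K) + 1"
    have "L > 0" using K by (simp add: L_def add_nonneg_pos)
    have "d * n P \<le> L * n ([:- c, 1:] * P)" for P
    proof -
      have "d * n P \<le> 2 * K * ((2 * cmod c + K) * n ([:- c, 1:] * P))"
        using nq[of P] lin_bound[of "[:- c, 1:] * P"] K(1) by (smt (verit) mult_left_mono)
      then show ?thesis using nonneg[of "[:- c, 1:] * P"] unfolding L_def by (simp only: distrib_right mult.assoc mult_1_left)
    qed
    then show ?thesis using \<open>L > 0\<close> d(1) by (intro exI[of _ "d / L"]) (auto simp: field_simps)
  qed
  show False
    by (rule poly_seminorm_not_bounded_below[of n K, OF nonneg tri scale cscale shift K(1) nontrivial lower])
qed

end

section \<open>Topological division algebras\<close>

context left_alternative_algebra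
begin

lemma inverse_in_eqI:
  assumes cd: "classical_division m" and c: "a \<odot> c = unit_of m" "c \<odot> a = unit_of m"
  shows "inverse_in m a = c"
  unfolding inverse_in_def
proof (rule the_equality)
  show "is_inverse m a c" using c by (simp add: is_inverse_def)
  fix b assume "is_inverse m a b"
  then have "c \<odot> (a \<odot> b) = c \<odot> unit_of m" by (simp add: is_inverse_def)
  then show "b = c"
    using left_mult_inverse[OF classical_division_unit[OF cd] c(2,1)] classical_division_unit[OF cd]
    by (simp add: is_unit_element_def)
qed

text \<open>Gelfand-Mazur by Liouville's theorem. If the relation fails, q(z) = (x - z) (x - cnj z)
  is nonzero and so invertible for every complex z. Each continuous functional of the resolvent is
  entire and vanishes at infinity, hence is zero, although the functionals separate points.\<close>

theorem topological_division_imp_cubic: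
  assumes top: "topological_algebra m T" and cd: "classical_division m" and dual: "dual_separates_points T"
  shows "\<exists>\<alpha> \<beta>. x \<odot> (x \<odot> x) = (2 * \<alpha>) *\<^sub>R (x \<odot> x) - (\<alpha>\<^sup>2 + \<beta>\<^sup>2) *\<^sub>R x"
proof (rule ccontr)
  assume neg: "\<not> ?thesis"
  have topspace: "topspace T = UNIV"
    and cont_add: "continuous_map (prod_topology T T) T (\<lambda>(x, y). x + y)"
    and cont_scale: "continuous_map (prod_topology euclideanreal T) T (\<lambda>(r, x). r *\<^sub>R x)"
    and cont_mult: "\<And>a. continuous_map T T (\<lambda>x. a \<odot> x)"
    and cont_inverse: "continuous_map (subtopology T {a. invertible_in m a}) T (inverse_in m)"
    using top by (auto simp: topological_algebra_def separately_continuous_def)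
  define e where "e = unit_of m"
  have unit: "is_unit_element m e" unfolding e_def by (rule classical_division_unit[OF cd])
  then have ex [simp]: "e \<odot> z = z" "z \<odot> e = z" for z by (auto simp: is_unit_element_def)
  define q where "q z = x \<odot> x - (2 * Re z) *\<^sub>R x + ((Re z)\<^sup>2 + (Im z)\<^sup>2) *\<^sub>R e" for z
  \<comment> \<open>Equal to |z|^2 q(1/z) for z nonzero, but defined and invertible at 0 too.
    Continuity of inversion at p(0) = e replaces a norm estimate of the resolvent at
    infinity.\<close>
  define p where "p z = e + (- 2 * Re z) *\<^sub>R x + ((Re z)\<^sup>2 + (Im z)\<^sup>2) *\<^sub>R (x \<odot> x)" for z
  have q_nz: "q z \<noteq> 0" for z
  proof
    assume "q z = 0"
    then have "x \<odot> q z = 0" by (simp add: mult_simps)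
    then have "x \<odot> (x \<odot> x) = (2 * Re z) *\<^sub>R (x \<odot> x) - ((Re z)\<^sup>2 + (Im z)\<^sup>2) *\<^sub>R x"
      by (simp add: q_def mult_simps algebra_simps)
    then show False using neg by blast
  qed
  have qp: "p z = ((Re z)\<^sup>2 + (Im z)\<^sup>2) *\<^sub>R q (inverse z)" if "z \<noteq> 0" for z
  proof -
    define N where "N = (Re z)\<^sup>2 + (Im z)\<^sup>2"
    have "N \<noteq> 0" using that by (auto simp: N_def complex_eq_iff sum_power2_eq_zero_iff)
    moreover have r: "Re (inverse z) = Re z / N" "(Re (inverse z))\<^sup>2 + (Im (inverse z))\<^sup>2 = 1 / N"
    proof -
      show "Re (inverse z) = Re z / N" by (simp add: N_def)
      have "(Re (inverse z))\<^sup>2 + (Im (inverse z))\<^sup>2 = N / N\<^sup>2"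
        by (simp add: N_def power_divide add_divide_distrib)
      then show "(Re (inverse z))\<^sup>2 + (Im (inverse z))\<^sup>2 = 1 / N"
        using \<open>N \<noteq> 0\<close> by (simp add: power2_eq_square)
    qed
    ultimately show ?thesis
      unfolding p_def q_def N_def[symmetric] r(2) unfolding r(1) by (simp add: algebra_simps)
  qed
  have e_nz: "e \<noteq> 0"
  proof
    assume "e = 0"
    then have "x = 0" using ex(1)[of x] by (simp add: mult_simps)
    then show False using neg by (simp add: mult_simps)
  qed
  have p_nz: "p z \<noteq> 0" for z
  proof (cases "z = 0")
    case True
    then show ?thesis using e_nz by (simp add: p_def)
  next
    case False
    then show ?thesis using qp[of z] q_nz[of "inverse z"]
      by (auto simp: complex_eq_iff sum_power2_eq_zero_iff)
  qed
  have inv: "a \<odot> inverse_in m a = e" "inverse_in m a \<odot> a = e" if a: "a \<noteq> 0" for a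
  proof -
    obtain c where c: "a \<odot> c = unit_of m" "c \<odot> a = unit_of m"
      using classical_division_inverse[OF cd a] by blast
    then show "a \<odot> inverse_in m a = e" "inverse_in m a \<odot> a = e"
      by (simp_all add: inverse_in_eqI[OF cd] e_def)
  qed
  define Q where "Q z = inverse_in m (q z)" for z
  define P where "P z = inverse_in m (p z)" for z
  have Q: "q z \<odot> Q z = e" "Q z \<odot> q z = e" for z using inv[OF q_nz] by (simp_all add: Q_def)
  have QP: "Q (inverse z) = ((Re z)\<^sup>2 + (Im z)\<^sup>2) *\<^sub>R P z" if "z \<noteq> 0" for z
    unfolding Q_def
  proof (rule inverse_in_eqI[OF cd])
    show "q (inverse z) \<odot> ((Re z)\<^sup>2 + (Im z)\<^sup>2) *\<^sub>R P z = unit_of m"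
      using inv(1)[OF p_nz[of z]] qp[OF that] by (simp add: P_def mult_simps e_def)
    show "((Re z)\<^sup>2 + (Im z)\<^sup>2) *\<^sub>R P z \<odot> q (inverse z) = unit_of m"
      using inv(2)[OF p_nz[of z]] qp[OF that] by (simp add: P_def mult_simps e_def)
  qed
  have cont_line: "continuous_map euclidean T (\<lambda>z::complex. g z *\<^sub>R v)" if "continuous_on UNIV g" for g v
  proof -
    have "continuous_map euclidean (prod_topology euclideanreal T) (\<lambda>z. (g z, v))"
      using that topspace by (intro continuous_map_pairedI) auto
    from continuous_map_compose[OF this cont_scale] show ?thesis by (simp add: o_def)
  qed
  have cont_sum: "continuous_map euclidean T (\<lambda>z::complex. g z + h z)"
    if "continuous_map euclidean T g" "continuous_map euclidean T h" for g h
    using continuous_map_compose[OF continuous_map_pairedI[OF that] cont_add] by (simp add: o_def)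
  have cont_inv: "continuous_map euclidean T (\<lambda>z::complex. inverse_in m (g z))"
    if "continuous_map euclidean T g" "\<And>z. g z \<noteq> 0" for g
  proof -
    have "continuous_map euclidean (subtopology T {a. invertible_in m a}) g"
      using that cd by (intro continuous_map_into_subtopology) (auto simp: classical_division_def)
    from continuous_map_compose[OF this cont_inverse] show ?thesis by (simp add: o_def)
  qed
  have cont_const: "continuous_map euclidean T (\<lambda>z::complex. v)" for v
    using topspace by simp
  have "continuous_map euclidean T q"
  proof -
    have q_eq: "q = (\<lambda>z. (x \<odot> x + (- 2 * Re z) *\<^sub>R x) + ((Re z)\<^sup>2 + (Im z)\<^sup>2) *\<^sub>R e)"
      by (simp add: q_def fun_eq_iff)
    show ?thesis
      unfolding q_eq by (intro cont_sum cont_line cont_const continuous_intros)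
  qed
  then have cont_Q: "continuous_map euclidean T Q" unfolding Q_def[abs_def] using q_nz by (rule cont_inv)
  have "continuous_map euclidean T p"
    unfolding p_def[abs_def] by (intro cont_sum cont_line cont_const continuous_intros)
  then have cont_P: "continuous_map euclidean T P" unfolding P_def[abs_def] using p_nz by (rule cont_inv)
  have qy: "q z \<odot> y = x \<odot> (x \<odot> y) - (2 * Re z) *\<^sub>R (x \<odot> y) + ((Re z)\<^sup>2 + (Im z)\<^sup>2) *\<^sub>R y" for z y
    by (simp add: q_def mult_simps left_alt)
  have qQ: "q z \<odot> (Q z \<odot> y) = y" and Qq: "Q z \<odot> (q z \<odot> y) = y" for z y
    by (rule left_mult_inverse[OF unit Q] left_mult_inverse[OF unit Q(2,1)])+
  have qq: "q z \<odot> (q w \<odot> y) = q w \<odot> (q z \<odot> y)" for z w y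
    by (simp add: qy mult_simps algebra_simps)
  have zero: "f (Q \<i>) = 0" if f: "linear f" "continuous_map T euclideanreal f" for f
  proof -
    note f_simps = linear_add[OF f(1)] linear_diff[OF f(1)] linear_cmul[OF f(1)] linear_0[OF f(1)]
    have cont_f: "continuous_on UNIV (\<lambda>z::complex. f (g z))" if "continuous_map euclidean T g" for g
      using continuous_map_compose[OF that f(2)] by (simp add: o_def)
    have cont_fmult: "continuous_on UNIV (\<lambda>z::complex. f (a \<odot> g z))" if "continuous_map euclidean T g" for a g
      using continuous_map_compose[OF that cont_mult[of a]] by (intro cont_f) (simp add: o_def)
    have cont_mult': "continuous_map euclidean T (\<lambda>z::complex. a \<odot> g z)" if "continuous_map euclidean T g" for a g
      using continuous_map_compose[OF that cont_mult[of a]] by (simp add: o_def)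
    txt \<open>The complex number \<open>f ((x - z)\<^sup>-\<^sup>1)\<close>, where \<open>(x - z)\<^sup>-\<^sup>1 = (x - cnj z) q(z)\<^sup>-\<^sup>1\<close>.\<close>
    define \<phi> where "\<phi> z = Complex (f (x \<odot> Q z) - Re z * f (Q z)) (Im z * f (Q z))" for z
    have deriv: "\<exists>D. (\<phi> has_field_derivative D) (at w)" for w
    proof -
      define S where "S z = Q w \<odot> Q z" for z
      define s0 s1 s2 where "s0 z = f (S z)" and "s1 z = f (x \<odot> S z)" and "s2 z = f (x \<odot> (x \<odot> S z))" for z
      define s3 where "s3 z = f (x \<odot> (x \<odot> (x \<odot> S z)))" for z
      \<comment> \<open>By the resolvent identity the difference quotient is the functional applied
        to (x - cnj z) (x - cnj w) Q(w) Q(z), here split into real and imaginary part. With w fixed,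
        its continuity needs only separate continuity of the product.\<close>
      define H where "H z = Complex
        (s2 z - (Re z + Re w) * s1 z + Re z * Re w * s0 z - Im z * Im w * s0 z)
        (Im w * (s1 z - Re z * s0 z) + Im z * (s1 z - Re w * s0 z))" for z
      have Qz: "Q z = q w \<odot> S z" for z by (simp add: S_def qQ)
      have Qw: "Q w = q z \<odot> S z" for z
      proof -
        have "Q w \<odot> (q z \<odot> (q w \<odot> (Q w \<odot> Q z))) = q z \<odot> (Q w \<odot> Q z)"
          by (simp add: qq[of z w] Qq)
        then show ?thesis by (simp add: qQ Q S_def)
      qed
      have "\<phi> z - \<phi> w = H z * (z - w)" for z
      proof -
        have 1: "f (Q z) = s2 z - 2 * Re w * s1 z + ((Re w)\<^sup>2 + (Im w)\<^sup>2) * s0 z"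
          by (subst Qz) (simp add: qy f_simps s0_def s1_def s2_def)
        have 2: "f (x \<odot> Q z) = s3 z - 2 * Re w * s2 z + ((Re w)\<^sup>2 + (Im w)\<^sup>2) * s1 z"
          by (subst Qz) (simp add: qy f_simps mult_simps s3_def s1_def s2_def)
        have 3: "f (Q w) = s2 z - 2 * Re z * s1 z + ((Re z)\<^sup>2 + (Im z)\<^sup>2) * s0 z"
          by (subst Qw[of z]) (simp add: qy f_simps s0_def s1_def s2_def)
        have 4: "f (x \<odot> Q w) = s3 z - 2 * Re z * s2 z + ((Re z)\<^sup>2 + (Im z)\<^sup>2) * s1 z"
          by (subst Qw[of z]) (simp add: qy f_simps mult_simps s3_def s1_def s2_def)
        show ?thesis
          unfolding \<phi>_def H_def 1 2 3 4
          by (simp add: complex_eq_iff power2_eq_square algebra_simps)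
      qed
      moreover have "isCont H w"
      proof -
        have S: "continuous_map euclidean T S" unfolding S_def[abs_def] by (rule cont_mult'[OF cont_Q])
        have "continuous_on UNIV s0" "continuous_on UNIV s1" "continuous_on UNIV s2"
          unfolding s0_def s1_def s2_def by (intro cont_f cont_mult' S)+
        then have "continuous_on UNIV H"
          unfolding H_def[abs_def] Complex_eq by (intro continuous_intros)
        then show ?thesis by (simp add: continuous_on_eq_continuous_at)
      qed
      ultimately show ?thesis unfolding CARAT_DERIV by blast
    qed
    then have "\<phi> holomorphic_on UNIV"
      by (simp add: holomorphic_on_def field_differentiable_def)
    moreover have "(\<phi> \<longlongrightarrow> 0) at_infinity"
    proof -
      \<comment> \<open>This is \<phi>(1/z) rewritten with Q(1/z) = |z|^2 P(z), which removes the
        singularity at 0.\<close>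
      define \<psi> where "\<psi> z = Complex (((Re z)\<^sup>2 + (Im z)\<^sup>2) * f (x \<odot> P z) - Re z * f (P z)) (- Im z * f (P z))" for z
      have "continuous_on UNIV \<psi>"
        unfolding \<psi>_def[abs_def] Complex_eq by (intro continuous_intros cont_f cont_mult' cont_P)
      then have "(\<psi> \<longlongrightarrow> \<psi> 0) (at 0)" by (simp add: continuous_on_def)
      also have "\<psi> 0 = 0" by (simp add: \<psi>_def complex_eq_iff)
      finally have psi: "(\<psi> \<longlongrightarrow> 0) (at 0)" .
      have eq: "\<psi> z = (\<phi> \<circ> inverse) z" if "z \<noteq> 0" for z
      proof -
        have "(Re z)\<^sup>2 + (Im z)\<^sup>2 \<noteq> 0"
          using that by (auto simp: complex_eq_iff sum_power2_eq_zero_iff)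
        then show ?thesis
          by (simp add: \<psi>_def \<phi>_def QP[OF that] mult_simps f_simps)
      qed
      have "\<forall>\<^sub>F z in at 0. \<psi> z = (\<phi> \<circ> inverse) z"
        unfolding eventually_at_filter using eq by (intro always_eventually) blast
      from Lim_transform_eventually[OF psi this]
      have "((\<phi> \<circ> inverse) \<longlongrightarrow> 0) (at 0)" .
      then show ?thesis by (simp add: lim_at_infinity_0)
    qed
    ultimately have "\<phi> \<i> = 0" by (rule Liouville_weak)
    \<comment> \<open>At the point \<i> the imaginary part of \<phi> is exactly the functional at
      \<open>Q \<i>\<close>.\<close>
    then show ?thesis by (simp add: \<phi>_def complex_eq_iff)
  qed
  have "Q \<i> \<noteq> 0" using Q(1)[of \<i>] e_nz by (auto simp: mult_simps)
  then obtain f where "linear f" "continuous_map T euclideanreal f" "f (Q \<i>) \<noteq> f 0"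
    using dual unfolding dual_separates_points_def by blast
  then show False using zero[of f] linear_0[of f] by simp
qed

end

section \<open>One-sided alternative algebras\<close>

text \<open>
  Right alternative algebras are handled by passing to the opposite product; all hypotheses and the
  composition form are symmetric.
\<close>

definition opposite :: "('a \<Rightarrow> 'a \<Rightarrow> 'a) \<Rightarrow> 'a \<Rightarrow> 'a \<Rightarrow> 'a" where
  "opposite m x y = m y x"

lemma opposite_apply [simp]: "opposite m x = (\<lambda>y. m y x)"
  by (simp add: opposite_def fun_eq_iff)

lemma bilinear_opposite: "bilinear m \<Longrightarrow> bilinear (opposite m)"
  by (simp add: bilinear_def)

lemma left_alternative_opposite: "right_alternative m \<Longrightarrow> left_alternative (opposite m)"
  by (simp add: left_alternative_def right_alternative_def)

lemma is_unit_element_opposite: "is_unit_element (opposite m) = is_unit_element m"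
  by (auto simp: is_unit_element_def fun_eq_iff)

lemma unit_of_opposite: "unit_of (opposite m) = unit_of m"
  by (simp add: unit_of_def is_unit_element_opposite)

lemma is_inverse_opposite: "is_inverse (opposite m) = is_inverse m"
  by (auto simp: is_inverse_def unit_of_opposite fun_eq_iff)

lemma invertible_in_opposite: "invertible_in (opposite m) = invertible_in m"
  by (simp add: invertible_in_def unital_def is_unit_element_opposite is_inverse_opposite fun_eq_iff)

lemma inverse_in_opposite: "inverse_in (opposite m) = inverse_in m"
  by (simp add: inverse_in_def is_inverse_opposite fun_eq_iff)

lemma classical_division_opposite: "classical_division (opposite m) = classical_division m"
  by (simp add: classical_division_def unital_def is_unit_element_opposite invertible_in_opposite)

lemma quasi_division_opposite: "quasi_division (opposite m) = quasi_division m"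
  by (auto simp: quasi_division_def)

lemma algebraic_algebra_opposite: "algebraic_algebra (opposite m) = algebraic_algebra m"
proof -
  have "is_subalgebra (opposite m) = is_subalgebra m" by (auto simp: is_subalgebra_def fun_eq_iff)
  then show ?thesis by (simp add: algebraic_algebra_def)
qed

lemma joint_zero_divisor_opposite: "joint_zero_divisor (opposite m) a = joint_zero_divisor m a"
  by (auto simp: joint_zero_divisor_def)

lemma joint_top_zero_divisor_opposite:
  "joint_top_zero_divisor (opposite m) M a = joint_top_zero_divisor m M a"
  by (auto simp: joint_top_zero_divisor_def)

lemma topological_algebra_opposite: "topological_algebra (opposite m) T = topological_algebra m T"
  by (auto simp: topological_algebra_def separately_continuous_def invertible_in_opposite inverse_in_opposite)

lemma euclidean_composition_algebra_opposite:
  assumes "euclidean_composition_algebra (opposite m) ip e"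
  shows "euclidean_composition_algebra m ip e"
proof -
  interpret o: euclidean_composition_algebra "opposite m" ip e by fact
  show ?thesis
  proof
    show "bilinear m" using o.bilinear_mult by (simp add: bilinear_def)
    show "is_unit_element m e" using o.unit by (simp only: is_unit_element_opposite)
  qed (use o.unit_nonzero o.composition in \<open>auto simp: mult.commute\<close>)
qed

section \<open>One hypothesis covering all cases and invariant under the opposite product\<close>

definition bounded_mult :: "('a::real_vector \<Rightarrow> 'a \<Rightarrow> 'a) \<Rightarrow> ('a \<Rightarrow> real) \<Rightarrow> bool" where
  "bounded_mult m M \<longleftrightarrow> (\<forall>a. (\<exists>K\<ge>0. \<forall>x. M (m a x) \<le> K * M x) \<and> (\<exists>K\<ge>0. \<forall>x. M (m x a) \<le> K * M x))"

lemma bounded_mult_opposite: "bounded_mult (opposite m) M = bounded_mult m M"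
  by (auto simp: bounded_mult_def)

lemma bounded_mult_of_separately_continuous:
  assumes "bilinear m" "vs_norm M" "separately_continuous m (norm_topology M)"
  shows "bounded_mult m M"
proof -
  interpret normed_space M by standard fact
  show ?thesis
    using assms continuous_linear_bounded
    unfolding bounded_mult_def separately_continuous_def bilinear_def by blast
qed

lemma bounded_mult_of_submultiplicative:
  assumes "vs_norm M" "\<And>a b. M (m a b) \<le> M a * M b"
  shows "bounded_mult m M"
proof -
  interpret normed_space M by standard fact
  show ?thesis
    unfolding bounded_mult_def
  proof (intro allI conjI exI)
    fix a x
    show "0 \<le> M a" "M (m a x) \<le> M a * M x" by (simp_all add: assms(2))
    show "0 \<le> M a" "M (m x a) \<le> M a * M x" using assms(2)[of x a] by (simp_all add: mult.commute)
  qed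
qed

lemma no_joint_top_zero_divisor_of_supermultiplicative:
  assumes M: "vs_norm M" and c: "c > 0" "supermultiplicative m M c" and jt: "joint_top_zero_divisor m M a"
  shows "a = 0"
proof -
  interpret normed_space M by standard fact
  obtain b where b: "\<And>n. M (b n) = 1" "(\<lambda>n. M (m a (b n))) \<longlonglongrightarrow> 0"
    using jt unfolding joint_top_zero_divisor_def by blast
  have "c * M a \<le> M (m a (b n))" for n
    using c(2) b(1)[of n] unfolding supermultiplicative_def by (metis mult.right_neutral)
  then have "c * M a \<le> 0" using b(2) by (intro LIMSEQ_le_const) auto
  then have "M a \<le> 0" using c(1) by (simp add: mult_le_0_iff)
  then show ?thesis using norm_pos_iff[of a] by linarith
qed

text \<open>Supermultiplicative norms fall under the second alternative, because they exclude joint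
  topological zero-divisors. Each alternative is unchanged by reversing the product, which is what
  reduces the right alternative case to the left one.\<close>

definition division_hypothesis :: "('a::real_vector \<Rightarrow> 'a \<Rightarrow> 'a) \<Rightarrow> bool" where
  "division_hypothesis m \<longleftrightarrow>
     (algebraic_algebra m \<and> (\<forall>a. joint_zero_divisor m a \<longrightarrow> a = 0)) \<or>
     (\<exists>M. vs_norm M \<and> bounded_mult m M \<and>
        ((\<forall>a. joint_top_zero_divisor m M a \<longrightarrow> a = 0) \<or> quasi_division m)) \<or>
     (\<exists>T. topological_algebra m T \<and> quasi_division m \<and> dual_separates_points T)"

lemma division_hypothesis_opposite: "division_hypothesis m \<Longrightarrow> division_hypothesis (opposite m)"
  unfolding division_hypothesis_def algebraic_algebra_opposite joint_zero_divisor_opposite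
    joint_top_zero_divisor_opposite quasi_division_opposite topological_algebra_opposite
    bounded_mult_opposite .

lemma (in left_alternative_algebra) division_hypothesis_imp_composition:
  assumes nz: "\<exists>x::'a. x \<noteq> 0" and hyp: "division_hypothesis m"
  shows "\<exists>ip e. euclidean_composition_algebra m ip e"
proof -
  have *: "left_alternative_domain m \<and> (\<forall>x. \<exists>\<alpha> \<beta>. x \<odot> (x \<odot> x)
      = (2 * \<alpha>) *\<^sub>R (x \<odot> x) - (\<alpha>\<^sup>2 + \<beta>\<^sup>2) *\<^sub>R x)"
    using hyp unfolding division_hypothesis_def
  proof (elim disjE exE conjE)
    assume alg: "algebraic_algebra m" and jz: "\<forall>a. joint_zero_divisor m a \<longrightarrow> a = 0"
    interpret left_alternative_domain m
    proof
      fix x y assume "x \<odot> y = 0" "y \<odot> x = 0"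
      then have "y \<noteq> 0 \<Longrightarrow> joint_zero_divisor m x" unfolding joint_zero_divisor_def by blast
      then show "x = 0 \<or> y = 0" using jz by blast
    qed
    show ?thesis by (intro conjI allI left_alternative_domain_axioms algebraic_imp_cubic[OF alg])
  next
    fix M assume M: "vs_norm M" "bounded_mult m M"
      and jt: "\<forall>a. joint_top_zero_divisor m M a \<longrightarrow> a = 0"
    interpret left_bounded_algebra m M
      by standard (use M in \<open>simp_all add: bounded_mult_def\<close>)
    show ?thesis
      by (intro conjI allI no_joint_top_zero_divisor_imp_domain no_joint_top_zero_divisor_imp_cubic)
        (use jt in blast)+
  next
    fix M assume M: "vs_norm M" "bounded_mult m M" and qd: "quasi_division m"
    interpret left_bounded_algebra m M
      by standard (use M in \<open>simp_all add: bounded_mult_def\<close>)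
    note jt = classical_division_no_joint_top_zero_divisor[OF quasi_division_imp_classical_division[OF qd nz]]
    show ?thesis
      by (intro conjI allI no_joint_top_zero_divisor_imp_domain no_joint_top_zero_divisor_imp_cubic jt)
  next
    fix T assume T: "topological_algebra m T" "dual_separates_points T" and qd: "quasi_division m"
    show ?thesis
      by (intro conjI allI quasi_division_imp_domain[OF qd] topological_division_imp_cubic[OF T(1) _ T(2)]
          quasi_division_imp_classical_division[OF qd nz])
  qed
  then interpret left_alternative_domain m by (rule conjunct1)
  show ?thesis by (rule exists_composition_form[OF nz]) (use * in \<open>rule conjunct2[THEN spec]\<close>)
qed

lemma one_sided_alternative_composition:
  assumes "nonassoc_algebra m" "left_alternative m \<or> right_alternative m" "division_hypothesis m"
  shows "\<exists>ip e. euclidean_composition_algebra m ip e"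
  using assms(2)
proof
  assume "left_alternative m"
  then interpret left_alternative_algebra m
    using assms(1) by unfold_locales (auto simp: nonassoc_algebra_def)
  show ?thesis using assms(1,3) division_hypothesis_imp_composition by (simp add: nonassoc_algebra_def)
next
  assume "right_alternative m"
  then interpret left_alternative_algebra "opposite m"
    using assms(1) by unfold_locales
      (auto simp: nonassoc_algebra_def intro: bilinear_opposite left_alternative_opposite)
  have "\<exists>x::'a. x \<noteq> 0" using assms(1) by (simp add: nonassoc_algebra_def)
  from division_hypothesis_imp_composition[OF this division_hypothesis_opposite[OF assms(3)]]
  show ?thesis using euclidean_composition_algebra_opposite by blast
qed

lemma quasi_division_iff_classical_division:
  assumes "nonassoc_algebra m" "left_alternative m \<or> right_alternative m"
  shows "quasi_division m \<longleftrightarrow> classical_division m"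
proof -
  have left: "quasi_division m' \<longleftrightarrow> classical_division m'"
    if "bilinear m'" "left_alternative m'" for m' :: "'a \<Rightarrow> 'a \<Rightarrow> 'a"
  proof -
    interpret left_alternative_algebra m' by standard fact+
    show ?thesis
      using assms(1) quasi_division_imp_classical_division classical_division_imp_quasi_division
      by (auto simp: nonassoc_algebra_def)
  qed
  have "bilinear m" using assms(1) by (simp add: nonassoc_algebra_def)
  with assms(2) show ?thesis
    using left[of m] left[of "opposite m"] bilinear_opposite[of m] left_alternative_opposite[of m]
    by (auto simp: quasi_division_opposite classical_division_opposite)
qed

section \<open>The given norm of a real C-star algebra\<close>

context euclidean_composition_algebra
begin

text \<open>The involution carries the quadratic equation of x to one for s x. Its coefficients are
  unique unless s x is a multiple of e, in which case s x = x.\<close>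

lemma ip_antiautomorphism:
  assumes s: "linear s" "\<And>x. s (s x) = x" "\<And>x y. s (x \<odot> y) = s y \<odot> s x"
  shows "ip (s x) (s x) = ip x x"
proof -
  have "s (e \<odot> s e) = s (s e) \<odot> s e" by (rule s(3))
  then have se: "s e = e" by (simp add: s(2))
  define t where "t = ip e x"
  define t' where "t' = ip e (s x)"
  have "s (x \<odot> x) = (2 * t) *\<^sub>R s x - ip x x *\<^sub>R e"
    by (subst square) (simp add: linear_diff[OF s(1)] linear_cmul[OF s(1)] se t_def)
  moreover have "s (x \<odot> x) = (2 * t') *\<^sub>R s x - ip (s x) (s x) *\<^sub>R e"
    unfolding s(3) by (subst square) (simp add: t'_def)
  ultimately have rel: "(2 * (t - t')) *\<^sub>R s x = (ip x x - ip (s x) (s x)) *\<^sub>R e"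
    by (simp add: algebra_simps)
  show ?thesis
  proof (cases "t = t'")
    case True
    then show ?thesis using rel unit_nonzero by simp
  next
    case False
    define r where "r = inverse (2 * (t - t')) * (ip x x - ip (s x) (s x))"
    have "s x = inverse (2 * (t - t')) *\<^sub>R ((2 * (t - t')) *\<^sub>R s x)" using False by simp
    then have sx: "s x = r *\<^sub>R e" unfolding rel by (simp add: r_def)
    then have "x = r *\<^sub>R e" using s(2)[of x] by (simp add: linear_cmul[OF s(1)] se)
    then show ?thesis using sx by simp
  qed
qed

text \<open>On elements fixed by s the C-star identity is the power identity for k = 2, and squaring
  stays among them, so both norms agree there. The general case follows by applying this to s x
  \<odot> x, whose Euclidean length is \<open>ip x x\<close>.\<close>

lemma cstar_norm_eq_sqrt_ip:
  assumes M: "vs_norm M"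
    and s: "linear s" "\<And>x. s (s x) = x" "\<And>x y. s (x \<odot> y) = s y \<odot> s x"
    and cstar: "\<And>x. M (s x \<odot> x) = (M x)\<^sup>2"
  shows "M x = sqrt (ip x x)"
proof -
  interpret normed_space M by standard fact
  have selfadjoint: "M y = sqrt (ip y y)" if "s y = y" for y
  proof (rule power_norm_on_eq_sqrt_ip[OF M, where k = 2 and Y = "{y. s y = y}"])
    fix z assume "z \<in> {y. s y = y}"
    then have z: "s z = z" by simp
    then show "M (alg_power m z 2) = M z ^ 2" using cstar[of z] by (simp add: alg_power_def)
    show "alg_power m z 2 \<in> {y. s y = y}" using z s(3) by (simp add: alg_power_def)
    show "r *\<^sub>R z \<in> {y. s y = y}" for r using z by (simp add: linear_cmul[OF s(1)])
  qed (use that in auto)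
  have "(M x)\<^sup>2 = sqrt (ip (s x \<odot> x) (s x \<odot> x))"
    using selfadjoint[of "s x \<odot> x"] s(2,3) cstar[of x] by simp
  also have "\<dots> = ip x x"
    by (simp add: sqrt_ip_mult ip_antiautomorphism[OF s])
  finally show ?thesis using norm_nonneg[of x] by (metis real_sqrt_unique)
qed

end

lemma real_cstar_algebra_norm:
  assumes cs: "real_cstar_algebra TYPE('b::banach) m M"
  obtains s where "vs_norm M" "bounded_mult m M" "linear s" "\<And>x. s (s x) = x"
    "\<And>x y. s (m x y) = m (s y) (s x)" "\<And>x. M (m (s x) x) = (M x)\<^sup>2"
proof -
  obtain sc mB st and j :: "'a \<Rightarrow> 'b" where cstar: "cstar_algebra sc mB st"
    and j: "linear j" "inj j" "\<And>x y. j (m x y) = mB (j x) (j y)" "\<And>x. M x = norm (j x)"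
    and st: "st ` range j \<subseteq> range j"
    using cs unfolding real_cstar_algebra_def by blast
  have sc: "sc (complex_of_real r) y = r *\<^sub>R y" and submult: "norm (mB y z) \<le> norm y * norm z"
    and st_add: "st (y + z) = st y + st z" and st_sc: "st (sc c y) = sc (cnj c) (st y)"
    and st_st: "st (st y) = y" and st_mult: "st (mB y z) = mB (st z) (st y)"
    and cs': "norm (mB (st y) y) = norm y ^ 2" for r c y z
    using cstar by (auto simp: cstar_algebra_def)
  have st_scale: "st (r *\<^sub>R y) = r *\<^sub>R st y" for r y
    using st_sc[of "complex_of_real r" y] by (simp add: sc)
  have M: "vs_norm M"
    unfolding vs_norm_def j(4) linear_add[OF j(1)] linear_cmul[OF j(1)]
    using linear_injective_0[OF j(1)] j(2) linear_0[OF j(1)] by (auto intro: norm_triangle_ineq)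
  moreover have "bounded_mult m M"
    by (rule bounded_mult_of_submultiplicative[OF M]) (simp add: j(3,4) submult)
  \<comment> \<open>The ambient involution pulled back along j; the choice is unique because j is
    injective and exists because the range is closed under the involution.\<close>
  moreover define s where "s x = (SOME y. j y = st (j x))" for x
  have js: "j (s x) = st (j x)" for x
  proof -
    have "st (j x) \<in> range j" using st by (simp add: image_subset_iff)
    then have "\<exists>y. j y = st (j x)" by (metis rangeE)
    then show ?thesis unfolding s_def by (rule someI_ex)
  qed
  have inj: "j x = j y \<Longrightarrow> x = y" for x y using j(2) by (simp add: injD)
  have "linear s"
    by (rule linearI; rule inj) (simp_all add: js linear_add[OF j(1)] linear_cmul[OF j(1)] st_add st_scale)
  moreover have "s (s x) = x" for x by (rule inj) (simp add: js st_st)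
  moreover have "s (m x y) = m (s y) (s x)" for x y by (rule inj) (simp add: js j(3) st_mult)
  moreover have "M (m (s x) x) = (M x)\<^sup>2" for x by (simp add: j(3,4) js cs')
  ultimately show ?thesis using that by blast
qed

theorem theorem5p8:
  fixes m :: "'a::real_vector \<Rightarrow> 'a \<Rightarrow> 'a"
  assumes "nonassoc_algebra m"
    and "left_alternative m \<or> right_alternative m"
  shows
    "(algebraic_algebra m \<and> (\<forall>a. joint_zero_divisor m a \<longrightarrow> a = 0)
        \<longrightarrow> locally_complex m \<and> (\<exists>N. natural_norm m N \<and> isometric_to_RCHO m N))
     \<and>
     ((\<exists>M. vs_norm M \<and> separately_continuous m (norm_topology M) \<and>
            (\<forall>a. joint_top_zero_divisor m M a \<longrightarrow> a = 0)) \<or>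
      (quasi_division m \<and> (\<exists>M. vs_norm M \<and> separately_continuous m (norm_topology M))) \<or>
      (\<exists>M. vs_norm M \<and> (\<exists>c>0. supermultiplicative m M c) \<and>
            separately_continuous m (norm_topology M)) \<or>
      (\<exists>M. nearly_absolute_value m M) \<or>
      (\<exists>T. topological_algebra m T \<and> (quasi_division m \<or> classical_division m) \<and>
            dual_separates_points T)
        \<longrightarrow> locally_complex m \<and> (\<exists>N. natural_norm m N \<and> isometric_to_RCHO m N))
     \<and>
     (\<forall>T. topological_algebra m T \<and> quasi_division m \<longleftrightarrow>
          topological_algebra m T \<and> classical_division m)
     \<and>
     (\<forall>M. (real_cstar_algebra TYPE('b::banach) m M \<and>
              ((\<forall>a. joint_top_zero_divisor m M a \<longrightarrow> a = 0) \<or> quasi_division m)) \<or>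
           (vs_norm M \<and> separately_continuous m (norm_topology M) \<and>
              (\<exists>k>1. power_norm m M k) \<and> (\<forall>a. joint_top_zero_divisor m M a \<longrightarrow> a = 0)) \<or>
           (quasi_division m \<and> vs_norm M \<and> separately_continuous m (norm_topology M) \<and>
              (\<exists>k>1. power_norm m M k)) \<or>
           absolute_value m M
        \<longrightarrow> isometric_to_RCHO m M \<and> locally_complex m \<and> natural_norm m M)"
proof -
  have bil: "bilinear m" using assms(1) by (simp add: nonassoc_algebra_def)
  note sepcont = bounded_mult_of_separately_continuous[OF bil]
  note qc = quasi_division_iff_classical_division[OF assms]
  note composition = one_sided_alternative_composition[OF assms]
  have conclusion: "locally_complex m \<and> (\<exists>N. natural_norm m N \<and> isometric_to_RCHO m N)"
    if hyp: "division_hypothesis m"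
  proof -
    obtain ip e where "euclidean_composition_algebra m ip e" using composition[OF hyp] by blast
    then interpret euclidean_composition_algebra m ip e .
    show ?thesis using locally_complex natural_norm_sqrt_ip isometric_to_RCHO by blast
  qed
  \<comment> \<open>When a norm is given, it only remains to identify it with the Euclidean norm of
    an arbitrary composition form, since none is singled out in advance.\<close>
  have norm_conclusion: "isometric_to_RCHO m M \<and> locally_complex m \<and> natural_norm m M"
    if hyp: "division_hypothesis m"
      and eq: "\<And>ip e x. euclidean_composition_algebra m ip e \<Longrightarrow> M x = sqrt (ip x x)" for M
  proof -
    obtain ip e where ec: "euclidean_composition_algebra m ip e" using composition[OF hyp] by blast
    then interpret euclidean_composition_algebra m ip e .
    have "M = (\<lambda>x. sqrt (ip x x))" using eq[OF ec] by (simp add: fun_eq_iff)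
    then show ?thesis using locally_complex natural_norm_sqrt_ip isometric_to_RCHO by simp
  qed
  have normed: "division_hypothesis m" if "vs_norm M" "bounded_mult m M"
    "(\<forall>a. joint_top_zero_divisor m M a \<longrightarrow> a = 0) \<or> quasi_division m" for M
    unfolding division_hypothesis_def
    by (intro disjI2 disjI1 exI[of _ M] conjI that)
  have algebraic: "division_hypothesis m"
    if "algebraic_algebra m" "\<forall>a. joint_zero_divisor m a \<longrightarrow> a = 0"
    unfolding division_hypothesis_def by (intro disjI1 conjI that)
  have topological: "division_hypothesis m"
    if "topological_algebra m T" "quasi_division m" "dual_separates_points T" for T
    unfolding division_hypothesis_def by (intro disjI2 exI[of _ T] conjI that)
  have nearly: "division_hypothesis m" if M: "nearly_absolute_value m M" for M
  proof -
    obtain c where c: "vs_norm M" "\<And>a b. M (m a b) \<le> M a * M b" "c > 0" "supermultiplicative m M c"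
      using M unfolding nearly_absolute_value_def by blast
    have "\<forall>a. joint_top_zero_divisor m M a \<longrightarrow> a = 0"
      using no_joint_top_zero_divisor_of_supermultiplicative[OF c(1,3,4)] by blast
    then show ?thesis
      by (intro normed[OF c(1) bounded_mult_of_submultiplicative[OF c(1,2)]] disjI1)
  qed
  have power_conclusion: "isometric_to_RCHO m M \<and> locally_complex m \<and> natural_norm m M"
    if hyp: "division_hypothesis m" and M: "vs_norm M" "k > 1" "power_norm m M k" for M k
    using hyp
  proof (rule norm_conclusion)
    fix ip e x assume "euclidean_composition_algebra m ip e"
    then show "M x = sqrt (ip x x)" using M by (rule euclidean_composition_algebra.power_norm_eq_sqrt_ip)
  qed
  show ?thesis
  proof (intro conjI allI impI)
    assume "algebraic_algebra m \<and> (\<forall>a. joint_zero_divisor m a \<longrightarrow> a = 0)"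
    then have "division_hypothesis m" by (elim conjE) (rule algebraic)
    from conclusion[OF this]
    show "locally_complex m" "\<exists>N. natural_norm m N \<and> isometric_to_RCHO m N" by simp_all
  next
    assume ii: "(\<exists>M. vs_norm M \<and> separately_continuous m (norm_topology M) \<and>
            (\<forall>a. joint_top_zero_divisor m M a \<longrightarrow> a = 0)) \<or>
      (quasi_division m \<and> (\<exists>M. vs_norm M \<and> separately_continuous m (norm_topology M))) \<or>
      (\<exists>M. vs_norm M \<and> (\<exists>c>0. supermultiplicative m M c) \<and>
            separately_continuous m (norm_topology M)) \<or>
      (\<exists>M. nearly_absolute_value m M) \<or>
      (\<exists>T. topological_algebra m T \<and> (quasi_division m \<or> classical_division m) \<and>
            dual_separates_points T)"
    have "division_hypothesis m"
      using ii
    proof (elim disjE exE conjE)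
      fix M assume "vs_norm M" "separately_continuous m (norm_topology M)"
        "\<forall>a. joint_top_zero_divisor m M a \<longrightarrow> a = 0"
      then show ?thesis by (intro normed sepcont disjI1)
    next
      fix M assume "quasi_division m" "vs_norm M" "separately_continuous m (norm_topology M)"
      then show ?thesis by (intro normed sepcont disjI2)
    next
      fix M c assume M: "vs_norm M" "separately_continuous m (norm_topology M)"
        and c: "(0::real) < c" "supermultiplicative m M c"
      have "\<forall>a. joint_top_zero_divisor m M a \<longrightarrow> a = 0"
        using no_joint_top_zero_divisor_of_supermultiplicative[OF M(1) c] by blast
      with M show ?thesis by (intro normed sepcont disjI1)
    next
      fix M assume "nearly_absolute_value m M"
      then show ?thesis by (rule nearly)
    next
      fix T assume "topological_algebra m T" "dual_separates_points T" "quasi_division m"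
      then show ?thesis by (intro topological)
    next
      fix T assume "topological_algebra m T" "dual_separates_points T" "classical_division m"
      then show ?thesis unfolding qc[symmetric] by (intro topological)
    qed
    from conclusion[OF this]
    show "locally_complex m" "\<exists>N. natural_norm m N \<and> isometric_to_RCHO m N" by simp_all
  next
    fix T show "topological_algebra m T \<and> quasi_division m \<longleftrightarrow> topological_algebra m T \<and> classical_division m"
      using qc by simp
  next
    fix M
    assume iii: "(real_cstar_algebra TYPE('b) m M \<and>
              ((\<forall>a. joint_top_zero_divisor m M a \<longrightarrow> a = 0) \<or> quasi_division m)) \<or>
           (vs_norm M \<and> separately_continuous m (norm_topology M) \<and>
              (\<exists>k>1. power_norm m M k) \<and> (\<forall>a. joint_top_zero_divisor m M a \<longrightarrow> a = 0)) \<or>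
           (quasi_division m \<and> vs_norm M \<and> separately_continuous m (norm_topology M) \<and>
              (\<exists>k>1. power_norm m M k)) \<or>
           absolute_value m M"
    have cstar: "isometric_to_RCHO m M \<and> locally_complex m \<and> natural_norm m M"
      if cs: "real_cstar_algebra TYPE('b) m M"
        and "(\<forall>a. joint_top_zero_divisor m M a \<longrightarrow> a = 0) \<or> quasi_division m"
    proof -
      obtain s where s: "vs_norm M" "bounded_mult m M" "linear s" "\<And>x. s (s x) = x"
        "\<And>x y. s (m x y) = m (s y) (s x)" "\<And>x. M (m (s x) x) = (M x)\<^sup>2"
        by (rule real_cstar_algebra_norm[OF cs]) (rule that)
      show ?thesis
      proof (rule norm_conclusion[OF normed[OF s(1,2) that(2)]])
        fix ip e x assume "euclidean_composition_algebra m ip e"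
        then show "M x = sqrt (ip x x)"
          using s(1,3-6) by (rule euclidean_composition_algebra.cstar_norm_eq_sqrt_ip)
      qed
    qed
    from iii have "isometric_to_RCHO m M \<and> locally_complex m \<and> natural_norm m M"
    proof (elim disjE exE conjE)
      fix k assume "vs_norm M" "separately_continuous m (norm_topology M)" "1 < k" "power_norm m M k"
        "\<forall>a. joint_top_zero_divisor m M a \<longrightarrow> a = 0"
      then show "isometric_to_RCHO m M \<and> locally_complex m \<and> natural_norm m M" by (intro power_conclusion[of M k] normed sepcont disjI1)
    next
      fix k assume "vs_norm M" "separately_continuous m (norm_topology M)" "1 < k" "power_norm m M k"
        "quasi_division m"
      then show "isometric_to_RCHO m M \<and> locally_complex m \<and> natural_norm m M" by (intro power_conclusion[of M k] normed sepcont disjI2)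
    next
      assume "absolute_value m M"
      then have M: "vs_norm M" "\<And>a b. M (m a b) = M a * M b" by (auto simp: absolute_value_def)
      \<comment> \<open>An absolute value is supermultiplicative with c = 1 and satisfies the power
        identity for k = 2, so the power case applies.\<close>
      then have "nearly_absolute_value m M"
        by (auto simp: nearly_absolute_value_def supermultiplicative_def intro!: exI[of _ 1])
      moreover have "power_norm m M 2" by (simp add: power_norm_def alg_power_def M(2) power2_eq_square)
      ultimately show "isometric_to_RCHO m M \<and> locally_complex m \<and> natural_norm m M" by (intro power_conclusion[of M 2] nearly M(1)) simp_all
    qed (intro cstar disjI1 disjI2; assumption)+
    then show "isometric_to_RCHO m M" "locally_complex m" "natural_norm m M" by simp_all
  qed
qed

end
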